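(* Let $n,m\in\mathbb{N}$. The space $\mathcal{D}_{L^1}$ of integrable smooth functions satisfies the kernel identity $$\mathcal{D}_{L^1}(\mathbb{R}^n_x\times\mathbb{R}^m_y)=\mathcal{D}_{L^1}(\mathbb{R}^n_x)\,\widehat{\otimes}_\pi\,\mathcal{D}_{L^1}(\mathbb{R}^m_y)$$ algebraically and topologically; that is, the canonical map from the right-hand side, extending $f\otimes g\mapsto \big((x,y)\mapsto f(x)g(y)\big)$, is an isomorphism of locally convex spaces onto the left-hand side.
   Context: $\mathcal{D}_{L^1}(\mathbb{R}^d)$ is the Fréchet space of all $f\in C^\infty(\mathbb{R}^d)$ with $\partial^\alpha f\in L^1(\mathbb{R}^d)$ for all multi-indices $\alpha$, with the topology given by the seminorms $f\mapsto\|\partial^\alpha f\|_{L^1}$. For locally convex spaces $F,G$, $F\widehat{\otimes}_\pi G$ is the completion of $F\otimes G$ in the projective ($\pi$-) tensor product topology. *)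

theory Defs
  imports "HOL-Analysis.Analysis"
begin

section \<open>Locally convex spaces over the complex numbers\<close>

text \<open>A locally convex space is given by an explicit carrier, its vector space operations and a
  family of seminorms generating its topology. Everything is relative to the carrier.\<close>

record 'a lcs =
  carrier :: "'a set"
  vzero :: 'a
  vadd :: "'a \<Rightarrow> 'a \<Rightarrow> 'a"
  vscale :: "complex \<Rightarrow> 'a \<Rightarrow> 'a"
  seminorms :: "('a \<Rightarrow> real) set"

definition vdiff :: "'a lcs \<Rightarrow> 'a \<Rightarrow> 'a \<Rightarrow> 'a" where
  "vdiff X x y = vadd X x (vscale X (- 1) y)"

text \<open>The carrier is added to the generating sets so that the topology has the right underlying
  set also for an empty family of seminorms.\<close>

definition lcs_topology :: "'a lcs \<Rightarrow> 'a topology" where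
  "lcs_topology X = topology_generated_by
     (insert (carrier X)
       {{y \<in> carrier X. p (vdiff X y x) < r} | p x r. p \<in> seminorms X \<and> x \<in> carrier X \<and> 0 < r})"

definition is_seminorm :: "'a lcs \<Rightarrow> ('a \<Rightarrow> real) \<Rightarrow> bool" where
  "is_seminorm X p \<longleftrightarrow>
     (\<forall>x\<in>carrier X. 0 \<le> p x) \<and>
     (\<forall>x\<in>carrier X. \<forall>y\<in>carrier X. p (vadd X x y) \<le> p x + p y) \<and>
     (\<forall>c. \<forall>x\<in>carrier X. p (vscale X c x) = cmod c * p x)"

definition continuous_seminorms :: "'a lcs \<Rightarrow> ('a \<Rightarrow> real) set" where
  "continuous_seminorms X =
     {p. is_seminorm X p \<and> continuous_map (lcs_topology X) euclideanreal p}"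

definition linear_map :: "'a lcs \<Rightarrow> 'b lcs \<Rightarrow> ('a \<Rightarrow> 'b) \<Rightarrow> bool" where
  "linear_map X Y T \<longleftrightarrow>
     T \<in> carrier X \<rightarrow> carrier Y \<and>
     (\<forall>x\<in>carrier X. \<forall>y\<in>carrier X. T (vadd X x y) = vadd Y (T x) (T y)) \<and>
     (\<forall>c. \<forall>x\<in>carrier X. T (vscale X c x) = vscale Y c (T x))"

definition lcs_isomorphism :: "'a lcs \<Rightarrow> 'b lcs \<Rightarrow> ('a \<Rightarrow> 'b) \<Rightarrow> bool" where
  "lcs_isomorphism X Y T \<longleftrightarrow>
     linear_map X Y T \<and> homeomorphic_map (lcs_topology X) (lcs_topology Y) T"


section \<open>Completion\<close>

text \<open>The points of the completion are equivalence classes of Cauchy filters, two filters being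
  equivalent if their difference tends to zero. A seminorm extends by taking its limit.\<close>

definition asymptotic :: "'a lcs \<Rightarrow> 'a filter \<Rightarrow> 'a filter \<Rightarrow> bool" where
  "asymptotic X F G \<longleftrightarrow>
     (\<forall>p\<in>seminorms X. ((\<lambda>(x, y). p (vdiff X x y)) \<longlongrightarrow> 0) (F \<times>\<^sub>F G))"

definition lcs_cauchy_filter :: "'a lcs \<Rightarrow> 'a filter \<Rightarrow> bool" where
  "lcs_cauchy_filter X F \<longleftrightarrow>
     F \<noteq> bot \<and> eventually (\<lambda>x. x \<in> carrier X) F \<and> asymptotic X F F"

definition cauchy_class :: "'a lcs \<Rightarrow> 'a filter \<Rightarrow> 'a filter set" where
  "cauchy_class X F = {G. lcs_cauchy_filter X G \<and> asymptotic X F G}"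

definition completion :: "'a lcs \<Rightarrow> 'a filter set lcs" where
  "completion X =
     \<lparr>carrier = cauchy_class X ` {F. lcs_cauchy_filter X F},
      vzero = cauchy_class X (principal {vzero X}),
      vadd = (\<lambda>A B. \<Union>F\<in>A. \<Union>G\<in>B. cauchy_class X (filtermap (\<lambda>(x, y). vadd X x y) (F \<times>\<^sub>F G))),
      vscale = (\<lambda>c A. \<Union>F\<in>A. cauchy_class X (filtermap (vscale X c) F)),
      seminorms = (\<lambda>p A. THE l. \<forall>F\<in>A. (p \<longlongrightarrow> l) F) ` seminorms X\<rparr>"

definition to_completion :: "'a lcs \<Rightarrow> 'a \<Rightarrow> 'a filter set" where
  "to_completion X x = cauchy_class X (principal {x})"


section \<open>Projective tensor product\<close>

definition bilinear_form :: "'a lcs \<Rightarrow> 'b lcs \<Rightarrow> ('a \<Rightarrow> 'b \<Rightarrow> complex) \<Rightarrow> bool" where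
  "bilinear_form X Y B \<longleftrightarrow>
     (\<forall>x\<in>carrier X. \<forall>x'\<in>carrier X. \<forall>y\<in>carrier Y. B (vadd X x x') y = B x y + B x' y) \<and>
     (\<forall>x\<in>carrier X. \<forall>y\<in>carrier Y. \<forall>y'\<in>carrier Y. B x (vadd Y y y') = B x y + B x y') \<and>
     (\<forall>c. \<forall>x\<in>carrier X. \<forall>y\<in>carrier Y. B (vscale X c x) y = c * B x y) \<and>
     (\<forall>c. \<forall>x\<in>carrier X. \<forall>y\<in>carrier Y. B x (vscale Y c y) = c * B x y)"

text \<open>The algebraic tensor product is realised inside the algebraic dual of the space of all
  (not only the continuous) bilinear forms, an elementary tensor acting by evaluation. The value
  \<open>0\<close> at arguments which are not bilinear forms is a dummy.\<close>

type_synonym ('a, 'b) tensor = "('a \<Rightarrow> 'b \<Rightarrow> complex) \<Rightarrow> complex"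

definition tensor :: "'a lcs \<Rightarrow> 'b lcs \<Rightarrow> 'a \<Rightarrow> 'b \<Rightarrow> ('a, 'b) tensor" where
  "tensor X Y x y = (\<lambda>B. if bilinear_form X Y B then B x y else 0)"

definition tensor_sum :: "'a lcs \<Rightarrow> 'b lcs \<Rightarrow> ('a \<times> 'b) list \<Rightarrow> ('a, 'b) tensor" where
  "tensor_sum X Y xys = (\<lambda>B. \<Sum>(x, y)\<leftarrow>xys. tensor X Y x y B)"

definition projective_seminorm ::
    "'a lcs \<Rightarrow> 'b lcs \<Rightarrow> ('a \<Rightarrow> real) \<Rightarrow> ('b \<Rightarrow> real) \<Rightarrow> ('a, 'b) tensor \<Rightarrow> real" where
  "projective_seminorm X Y p q u =
     Inf {\<Sum>(x, y)\<leftarrow>xys. p x * q y | xys.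
            xys \<in> lists (carrier X \<times> carrier Y) \<and> tensor_sum X Y xys = u}"

text \<open>All continuous seminorms have to be used here: the generating families of the two factors
  need not be directed.\<close>

definition projective_tensor :: "'a lcs \<Rightarrow> 'b lcs \<Rightarrow> ('a, 'b) tensor lcs" where
  "projective_tensor X Y =
     \<lparr>carrier = tensor_sum X Y ` lists (carrier X \<times> carrier Y),
      vzero = (\<lambda>B. 0),
      vadd = (\<lambda>u v B. u B + v B),
      vscale = (\<lambda>c u B. c * u B),
      seminorms = {projective_seminorm X Y p q | p q.
         p \<in> continuous_seminorms X \<and> q \<in> continuous_seminorms Y}\<rparr>"

definition completed_projective_tensor ::
    "'a lcs \<Rightarrow> 'b lcs \<Rightarrow> ('a, 'b) tensor filter set lcs" where
  "completed_projective_tensor X Y = completion (projective_tensor X Y)"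

definition completed_tensor :: "'a lcs \<Rightarrow> 'b lcs \<Rightarrow> 'a \<Rightarrow> 'b \<Rightarrow> ('a, 'b) tensor filter set" where
  "completed_tensor X Y x y = to_completion (projective_tensor X Y) (tensor X Y x y)"


section \<open>Integrable smooth functions\<close>

text \<open>A multi-index is written as a list of standard basis vectors, the directions in which one
  differentiates successively. On smooth functions the order is irrelevant, so that the
  derivatives along such lists are precisely the usual \<open>\<partial>\<^sup>\<alpha>\<close>.\<close>

primrec partial_derivative ::
    "'a::euclidean_space list \<Rightarrow> ('a \<Rightarrow> complex) \<Rightarrow> 'a \<Rightarrow> complex" where
  "partial_derivative [] f = f"
| "partial_derivative (b # bs) f =
     (\<lambda>x. frechet_derivative (partial_derivative bs f) (at x) b)"

text \<open>If all iterated partial derivatives are differentiable, they are all continuous; hence this is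
  \<open>C\<^sup>\<infinity>\<close>.\<close>

definition smooth :: "('a::euclidean_space \<Rightarrow> complex) \<Rightarrow> bool" where
  "smooth f \<longleftrightarrow> (\<forall>bs\<in>lists Basis. partial_derivative bs f differentiable_on UNIV)"

definition DL1 :: "('a::euclidean_space \<Rightarrow> complex) lcs" where
  "DL1 =
     \<lparr>carrier = {f. smooth f \<and> (\<forall>bs\<in>lists Basis. integrable lborel (partial_derivative bs f))},
      vzero = (\<lambda>x. 0),
      vadd = (\<lambda>f g x. f x + g x),
      vscale = (\<lambda>c f x. c * f x),
      seminorms = (\<lambda>bs f. LINT x|lborel. cmod (partial_derivative bs f x)) ` lists Basis\<rparr>"

end

theory Submission
  imports Defs "HOL-Probability.Distributions" "HOL-Library.Sublist"
begin

text \<open>A tensor \<open>u\<close> is a functional on bilinear forms. Its value at the form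
  \<open>(f, g) \<mapsto> f x * g y\<close> defines a function of \<open>(x, y)\<close>, the kernel of \<open>u\<close>. The theorem holds because the
  map from tensors to kernels is linear, has dense range in the complete Hausdorff space \<open>DL1\<close> of the
  product, and is an embedding: projective seminorms and the seminorms of the kernel dominate each
  other. A complete Hausdorff space into which a space is densely embedded is its completion
  (\<open>completion_isomorphism\<close>).

  The seminorms of the kernel are bounded by projective seminorms, because the \<open>L\<^sup>1\<close> norm of
  \<open>f x * g y\<close> is the product of the \<open>L\<^sup>1\<close> norms (\<open>kernel_bounded\<close>). Completeness and
  the Hausdorff property rest on the Sobolev inequality, which bounds the values of a function by \<open>L\<^sup>1\<close>
  norms of its derivatives (\<open>sobolev_inequality\<close>, \<open>DL1_complete\<close>).

  The heart of the matter is the converse estimate (\<open>kernel_embedding\<close>). Let \<open>\<phi>\<close> be a Gaussian mollifier.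
  Averaging over unit segments yields finitely many words \<open>w\<^sub>j\<close> of directions and functions \<open>\<psi>\<^sub>j\<close> such that
  \<open>\<phi>\<close> is the sum of the derivatives of \<open>\<psi>\<^sub>j\<close> along \<open>w\<^sub>j\<close>, while \<open>p \<psi>\<^sub>j\<close> is bounded independently of the
  width of the mollifier (\<open>derivative_decomposition\<close>): the \<open>\<psi>\<^sub>j\<close> play the role of mollified fundamental
  solutions. After an integration by parts, \<open>f\<close> is approximately the sum over \<open>j\<close> of the integrals of
  \<open>(\<partial>\<^sup>w f)(s) \<psi>\<^sub>j(x - s)\<close>, with \<open>w = w\<^sub>j\<close>, with respect to \<open>s\<close>. Replacing \<open>s\<close> by a simple function of \<open>s\<close> turns
  these integrals into finite sums, that is, into an operator \<open>T\<close> of finite rank whose coefficients are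
  integrals of derivatives of \<open>f\<close> over the cells of a partition (\<open>finite_rank_approximation\<close>). If \<open>T\<close> and
  an operator \<open>T'\<close> of the same kind are applied to the two factors of \<open>u\<close>, the coefficients become
  integrals of derivatives of the kernel over products of cells. The moduli of these integrals add up
  to at most an \<open>L\<^sup>1\<close> norm, and the vectors occurring have bounded seminorms; so the projective
  seminorm of the new tensor is bounded as desired, and it is as close to that of \<open>u\<close> as one likes.

  Density comes from the same discretisation, applied on the product space to a mollifier which is
  itself a product (\<open>kernel_dense\<close>).\<close>

section \<open>Topologies generated by seminorms\<close>

text \<open>The topology depends only on the distances \<open>p (x - y)\<close>. Isolating their two relevant
  properties makes the results applicable to completions, whose points are sets of filters, as well as
  to spaces of functions.\<close>

locale seminorm_distance =
  fixes X :: "'a lcs"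
  assumes distance_refl: "p \<in> seminorms X \<Longrightarrow> x \<in> carrier X \<Longrightarrow> p (vdiff X x x) = 0"
    and distance_triangle: "p \<in> seminorms X \<Longrightarrow> x \<in> carrier X \<Longrightarrow> y \<in> carrier X \<Longrightarrow> z \<in> carrier X \<Longrightarrow>
      p (vdiff X x z) \<le> p (vdiff X x y) + p (vdiff X y z)"
begin

lemma topspace_lcs_topology: "topspace (lcs_topology X) = carrier X"
  by (auto simp: lcs_topology_def)

lemma openin_seminorm_ball:
  assumes "finite P" "P \<subseteq> seminorms X" "x \<in> carrier X" "0 < r"
  shows "openin (lcs_topology X) {y \<in> carrier X. \<forall>p\<in>P. p (vdiff X y x) < r}"
  using assms(1,2)
proof (induction P)
  case empty
  then show ?case
    using openin_topspace[of "lcs_topology X"] by (simp add: topspace_lcs_topology)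
next
  case (insert p P)
  have "openin (lcs_topology X) {y \<in> carrier X. p (vdiff X y x) < r}"
    unfolding lcs_topology_def using insert.prems assms(3,4)
    by (intro topology_generated_by_Basis) blast
  moreover have "{y \<in> carrier X. \<forall>q\<in>insert p P. q (vdiff X y x) < r}
      = {y \<in> carrier X. p (vdiff X y x) < r} \<inter> {y \<in> carrier X. \<forall>q\<in>P. q (vdiff X y x) < r}"
    by auto
  ultimately show ?case
    using insert by (simp add: openin_Int)
qed

lemma openin_contains_seminorm_ball:
  assumes "openin (lcs_topology X) U" "x \<in> U"
  obtains P r where "finite P" "P \<subseteq> seminorms X" "0 < r"
    "{y \<in> carrier X. \<forall>p\<in>P. p (vdiff X y x) < r} \<subseteq> U"
proof -
  let ?S = "insert (carrier X)
       {{y \<in> carrier X. p (vdiff X y x) < r} | p x r. p \<in> seminorms X \<and> x \<in> carrier X \<and> 0 < r}"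
  have "generate_topology_on ?S U"
    using assms(1) unfolding lcs_topology_def by (rule openin_topology_generated_by)
  then have "\<exists>P r. finite P \<and> P \<subseteq> seminorms X \<and> 0 < r \<and>
      {y \<in> carrier X. \<forall>p\<in>P. p (vdiff X y x) < r} \<subseteq> U"
    using assms(2)
  proof (induction arbitrary: x)
    case Empty
    then show ?case by simp
  next
    case (Int a b)
    obtain P r where 1: "finite P" "P \<subseteq> seminorms X" "0 < (r::real)"
      "{y \<in> carrier X. \<forall>p\<in>P. p (vdiff X y x) < r} \<subseteq> a"
      using Int.IH(1)[of x] Int.prems by blast
    obtain Q s where 2: "finite Q" "Q \<subseteq> seminorms X" "0 < (s::real)"
      "{y \<in> carrier X. \<forall>p\<in>Q. p (vdiff X y x) < s} \<subseteq> b"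
      using Int.IH(2)[of x] Int.prems by blast
    show ?case
      using 1 2 by (intro exI[of _ "P \<union> Q"] exI[of _ "min r s"]) auto
  next
    case (UN K)
    then obtain k where k: "k \<in> K" "x \<in> k" by blast
    obtain P r where "finite P \<and> P \<subseteq> seminorms X \<and> 0 < r \<and>
      {y \<in> carrier X. \<forall>p\<in>P. p (vdiff X y x) < r} \<subseteq> k"
      using UN.IH[OF k] by blast
    then show ?case using k(1) by (intro exI[of _ P] exI[of _ r]) blast
  next
    case (Basis s)
    show ?case
    proof (cases "s = carrier X")
      case True
      then show ?thesis by (intro exI[of _ "{}"] exI[of _ 1]) auto
    next
      case False
      then obtain q z r where q: "s = {y \<in> carrier X. q (vdiff X y z) < r}" "q \<in> seminorms X"
        "z \<in> carrier X" "0 < r"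
        using Basis.hyps False by blast
      have "q (vdiff X y z) < r" if "y \<in> carrier X" "q (vdiff X y x) < r - q (vdiff X x z)" for y
        using distance_triangle[OF q(2) that(1) _ q(3), of x] that Basis.prems q(1) by auto
      then show ?thesis
        using q Basis.prems by (intro exI[of _ "{q}"] exI[of _ "r - q (vdiff X x z)"]) auto
    qed
  qed
  then show thesis using that by blast
qed

end

text \<open>A generating family of seminorms need not be directed, hence the finite sums.\<close>

definition dominated_map :: "'a lcs \<Rightarrow> 'b lcs \<Rightarrow> ('a \<Rightarrow> 'b) \<Rightarrow> bool" where
  "dominated_map X Y T \<longleftrightarrow> T \<in> carrier X \<rightarrow> carrier Y \<and>
     (\<forall>q\<in>seminorms Y. \<exists>P C. finite P \<and> P \<subseteq> seminorms X \<and> 0 \<le> C \<and>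
       (\<forall>x\<in>carrier X. \<forall>y\<in>carrier X. q (vdiff Y (T x) (T y)) \<le> C * (\<Sum>p\<in>P. p (vdiff X x y))))"

lemma dominated_map_continuous:
  assumes X: "seminorm_distance X" and Y: "seminorm_distance Y" and T: "dominated_map X Y T"
  shows "continuous_map (lcs_topology X) (lcs_topology Y) T"
proof -
  interpret X: seminorm_distance X by fact
  interpret Y: seminorm_distance Y by fact
  have Tc: "T x \<in> carrier Y" if "x \<in> carrier X" for x
    using T that by (auto simp: dominated_map_def)
  show ?thesis
    unfolding lcs_topology_def[of Y]
  proof (rule continuous_on_generated_topo)
    fix U
    assume U: "U \<in> insert (carrier Y)
       {{y \<in> carrier Y. p (vdiff Y y x) < r} | p x r. p \<in> seminorms Y \<and> x \<in> carrier Y \<and> 0 < r}"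
    show "openin (lcs_topology X) (T -` U \<inter> topspace (lcs_topology X))"
    proof (cases "U = carrier Y")
      case True
      then have "T -` U \<inter> topspace (lcs_topology X) = topspace (lcs_topology X)"
        using Tc by (auto simp: X.topspace_lcs_topology)
      then show ?thesis by simp
    next
      case False
      with U have "\<exists>q z r. U = {y \<in> carrier Y. q (vdiff Y y z) < r} \<and> q \<in> seminorms Y \<and>
          z \<in> carrier Y \<and> 0 < r"
        by (elim insertE CollectE) iprover+
      then obtain q z r where q: "U = {y \<in> carrier Y. q (vdiff Y y z) < r}" "q \<in> seminorms Y"
        "z \<in> carrier Y" "0 < r"
        by (elim exE conjE) iprover
      obtain P C where P: "finite P" "P \<subseteq> seminorms X" "0 \<le> C"
        "\<And>x y. x \<in> carrier X \<Longrightarrow> y \<in> carrier X \<Longrightarrow>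
           q (vdiff Y (T x) (T y)) \<le> C * (\<Sum>p\<in>P. p (vdiff X x y))"
        using bspec[OF conjunct2[OF T[unfolded dominated_map_def]] q(2)] by blast
      show ?thesis
      proof (subst openin_subopen, safe)
        fix x assume x: "x \<in> topspace (lcs_topology X)" "T x \<in> U"
        then have xc: "x \<in> carrier X" by (simp add: X.topspace_lcs_topology)
        define e where "e = r - q (vdiff Y (T x) z)"
        define d where "d = e / (C * card P + 1)"
        have e: "e > 0" using x(2) q(1) by (simp add: e_def)
        have pos: "C * card P + 1 > 0" using P(3) by (simp add: add_nonneg_pos)
        have d: "d > 0" unfolding d_def using e pos by simp
        let ?B = "{y \<in> carrier X. \<forall>p\<in>P. p (vdiff X y x) < d}"
        have "y \<in> T -` U" if y: "y \<in> ?B" for y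
        proof -
          have "(\<Sum>p\<in>P. p (vdiff X y x)) \<le> card P * d"
            using y by (intro sum_bounded_above less_imp_le) auto
          then have "q (vdiff Y (T y) (T x)) \<le> C * (card P * d)"
            using P(4)[of y x] y xc P(3) by (smt (verit) mem_Collect_eq mult_left_mono)
          also have "\<dots> < (C * card P + 1) * d" using d by (simp add: algebra_simps)
          also have "\<dots> = e" using pos by (simp add: d_def)
          finally have "q (vdiff Y (T y) z) < r"
            using Y.distance_triangle[OF q(2), of "T y" "T x" z] Tc y xc q(3) by (auto simp: e_def)
          then show ?thesis using q(1) Tc y by auto
        qed
        moreover have "openin (lcs_topology X) ?B"
          using X.openin_seminorm_ball[OF P(1,2) xc d] .
        moreover have "p (vdiff X x x) < d" if "p \<in> P" for p
          using X.distance_refl[OF subsetD[OF P(2) that] xc] d by simp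
        then have "x \<in> ?B" using xc by simp
        ultimately show "\<exists>V. openin (lcs_topology X) V \<and> x \<in> V \<and> V \<subseteq> T -` U \<inter> topspace (lcs_topology X)"
          by (intro exI[of _ ?B]) (auto simp: X.topspace_lcs_topology)
      qed
    qed
  next
    show "T ` topspace (lcs_topology X) \<subseteq> \<Union> (insert (carrier Y)
       {{y \<in> carrier Y. p (vdiff Y y x) < r} | p x r. p \<in> seminorms Y \<and> x \<in> carrier Y \<and> 0 < r})"
      using Tc by (auto simp: X.topspace_lcs_topology)
  qed
qed

lemma dominated_inverse_homeomorphic:
  assumes "seminorm_distance X" "seminorm_distance Y"
    and "dominated_map X Y T" "dominated_map Y X S"
    and "\<And>x. x \<in> carrier X \<Longrightarrow> S (T x) = x" "\<And>y. y \<in> carrier Y \<Longrightarrow> T (S y) = y"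
  shows "homeomorphic_map (lcs_topology X) (lcs_topology Y) T"
  unfolding homeomorphic_map_maps homeomorphic_maps_def
  using assms dominated_map_continuous[of X Y T] dominated_map_continuous[of Y X S]
  by (intro exI[of _ S]) (auto simp: seminorm_distance.topspace_lcs_topology)

text \<open>The spaces \<open>DL1\<close> and, since tensors are functionals, also their tensor products consist of
  complex functions with pointwise operations. All laws of vector spaces thus hold automatically.\<close>

locale function_lcs =
  fixes X :: "('i \<Rightarrow> complex) lcs"
  assumes vzero_eq [simp]: "vzero X = (\<lambda>i. 0)"
    and vadd_eq [simp]: "vadd X = (\<lambda>f g i. f i + g i)"
    and vscale_eq [simp]: "vscale X = (\<lambda>c f i. c * f i)"
    and zero_closed: "(\<lambda>i. 0) \<in> carrier X"
    and add_closed: "f \<in> carrier X \<Longrightarrow> g \<in> carrier X \<Longrightarrow> (\<lambda>i. f i + g i) \<in> carrier X"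
    and scale_closed: "f \<in> carrier X \<Longrightarrow> (\<lambda>i. c * f i) \<in> carrier X"
    and seminorms_are_seminorms: "p \<in> seminorms X \<Longrightarrow> is_seminorm X p"
begin

lemma vdiff_eq [simp]: "vdiff X f g = (\<lambda>i. f i - g i)"
  by (simp add: vdiff_def fun_eq_iff)

lemma diff_closed: "f \<in> carrier X \<Longrightarrow> g \<in> carrier X \<Longrightarrow> (\<lambda>i. f i - g i) \<in> carrier X"
  using add_closed[of f "\<lambda>i. - 1 * g i"] scale_closed[of g "- 1"] by simp

lemma sum_closed: "(\<And>k. k \<in> K \<Longrightarrow> f k \<in> carrier X) \<Longrightarrow> (\<lambda>i. \<Sum>k\<in>K. f k i) \<in> carrier X"
  by (induction K rule: infinite_finite_induct) (auto simp: zero_closed intro!: add_closed)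

lemma seminorm_nonneg: "is_seminorm X p \<Longrightarrow> f \<in> carrier X \<Longrightarrow> 0 \<le> p f"
  by (simp add: is_seminorm_def)

lemma seminorm_add:
  "is_seminorm X p \<Longrightarrow> f \<in> carrier X \<Longrightarrow> g \<in> carrier X \<Longrightarrow> p (\<lambda>i. f i + g i) \<le> p f + p g"
  by (simp add: is_seminorm_def)

lemma seminorm_scale: "is_seminorm X p \<Longrightarrow> f \<in> carrier X \<Longrightarrow> p (\<lambda>i. c * f i) = cmod c * p f"
  by (simp add: is_seminorm_def)

lemma seminorm_zero: "is_seminorm X p \<Longrightarrow> p (\<lambda>i. 0) = 0"
  using seminorm_scale[of p "\<lambda>i. 0" 0] zero_closed by simp

lemma seminorm_commute:
  assumes "is_seminorm X p" "f \<in> carrier X" "g \<in> carrier X"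
  shows "p (\<lambda>i. f i - g i) = p (\<lambda>i. g i - f i)"
  using seminorm_scale[OF assms(1) diff_closed[OF assms(2,3)], of "-1"] by simp

lemma seminorm_triangle:
  assumes "is_seminorm X p" "f \<in> carrier X" "g \<in> carrier X" "h \<in> carrier X"
  shows "p (\<lambda>i. f i - h i) \<le> p (\<lambda>i. f i - g i) + p (\<lambda>i. g i - h i)"
  using seminorm_add[OF assms(1) diff_closed[OF assms(2,3)] diff_closed[OF assms(3,4)]] by simp

lemma seminorm_diff_bound:
  assumes "is_seminorm X p" "f \<in> carrier X" "g \<in> carrier X"
  shows "\<bar>p f - p g\<bar> \<le> p (\<lambda>i. f i - g i)"
  using seminorm_triangle[OF assms(1,2,3) zero_closed] seminorm_triangle[OF assms(1,3,2) zero_closed]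
    seminorm_commute[OF assms] by simp

lemma seminorm_sum:
  assumes "is_seminorm X p" "\<And>k. k \<in> K \<Longrightarrow> f k \<in> carrier X"
  shows "p (\<lambda>i. \<Sum>k\<in>K. f k i) \<le> (\<Sum>k\<in>K. p (f k))"
  using assms(2)
proof (induction K rule: infinite_finite_induct)
  case (insert k K)
  then have "p (\<lambda>i. f k i + (\<Sum>k\<in>K. f k i)) \<le> p (f k) + p (\<lambda>i. \<Sum>k\<in>K. f k i)"
    by (intro seminorm_add assms(1) sum_closed) auto
  with insert show ?case by fastforce
qed (simp_all add: seminorm_zero assms(1))

sublocale seminorm_distance X
proof
  fix p x assume "p \<in> seminorms X" "x \<in> carrier X"
  then show "p (vdiff X x x) = 0"
    using seminorm_zero seminorms_are_seminorms by simp
next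
  fix p x y z assume "p \<in> seminorms X" "x \<in> carrier X" "y \<in> carrier X" "z \<in> carrier X"
  then show "p (vdiff X x z) \<le> p (vdiff X x y) + p (vdiff X y z)"
    using seminorm_triangle seminorms_are_seminorms by simp
qed

lemma generators_continuous:
  assumes p: "p \<in> seminorms X"
  shows "p \<in> continuous_seminorms X"
proof -
  have sp: "is_seminorm X p" using p by (rule seminorms_are_seminorms)
  have "openin (lcs_topology X) {f \<in> carrier X. p f \<in> U}" if U: "open U" for U
  proof (subst openin_subopen, safe)
    fix f assume f: "f \<in> carrier X" "p f \<in> U"
    then obtain e where e: "e > 0" "\<And>t. \<bar>t - p f\<bar> < e \<Longrightarrow> t \<in> U"
      using U unfolding open_dist dist_real_def by metis
    let ?B = "{g \<in> carrier X. \<forall>q\<in>{p}. q (vdiff X g f) < e}"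
    have "openin (lcs_topology X) ?B"
      using p f e by (intro openin_seminorm_ball) auto
    moreover have "f \<in> ?B" using f e p distance_refl[OF p f(1)] by simp
    moreover have "?B \<subseteq> {f \<in> carrier X. p f \<in> U}"
    proof safe
      fix g assume g: "g \<in> carrier X" "\<forall>q\<in>{p}. q (vdiff X g f) < e"
      show "p g \<in> U"
        using seminorm_diff_bound[OF sp g(1) f(1)] g(2) by (intro e(2)) auto
    qed
    ultimately show "\<exists>T. openin (lcs_topology X) T \<and> f \<in> T \<and> T \<subseteq> {f \<in> carrier X. p f \<in> U}"
      by blast
  qed
  then show ?thesis
    using sp unfolding continuous_seminorms_def continuous_map_def
    by (auto simp: topspace_lcs_topology)
qed

text \<open>By continuity at \<open>0\<close>, the seminorm is less than \<open>1\<close> on a ball given by finitely many generating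
  seminorms; homogeneity turns this into an inequality.\<close>

lemma continuous_seminorm_bound:
  assumes p: "p \<in> continuous_seminorms X"
  obtains Q C where "finite Q" "Q \<subseteq> seminorms X" "0 \<le> C"
    "\<And>f. f \<in> carrier X \<Longrightarrow> p f \<le> C * (\<Sum>q\<in>Q. q f)"
proof -
  have sp: "is_seminorm X p" and cp: "continuous_map (lcs_topology X) euclideanreal p"
    using p by (auto simp: continuous_seminorms_def)
  have "openin (lcs_topology X) {f \<in> topspace (lcs_topology X). p f \<in> {..<1}}"
    by (rule openin_continuous_map_preimage[OF cp]) simp
  moreover have "(\<lambda>i. 0) \<in> {f \<in> topspace (lcs_topology X). p f \<in> {..<1}}"
    by (simp add: topspace_lcs_topology zero_closed seminorm_zero[OF sp])
  ultimately obtain Q r where Q: "finite Q" "Q \<subseteq> seminorms X" "0 < r"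
    "{f \<in> carrier X. \<forall>q\<in>Q. q (vdiff X f (\<lambda>i. 0)) < r} \<subseteq> {f \<in> topspace (lcs_topology X). p f \<in> {..<1}}"
    by (rule openin_contains_seminorm_ball)
  have "p f \<le> (1 / r) * (\<Sum>q\<in>Q. q f)" if f: "f \<in> carrier X" for f
  proof (rule field_le_epsilon)
    fix e :: real assume e: "0 < e"
    define s where "s = (\<Sum>q\<in>Q. q f)"
    have qn: "0 \<le> q f" if "q \<in> Q" for q
      using seminorm_nonneg seminorms_are_seminorms Q(2) f that by blast
    have s0: "0 \<le> s" unfolding s_def using qn by (intro sum_nonneg)
    have qs: "q f \<le> s" if "q \<in> Q" for q
      unfolding s_def using qn Q(1) that by (intro member_le_sum) auto
    \<comment> \<open>the scaling factor puts the multiple of \<open>f\<close> into the ball of radius \<open>r\<close>\<close>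
    define c where "c = 1 / (s / r + e)"
    have se: "s / r + e > 0" using s0 Q(3) e by (simp add: add_nonneg_pos)
    have c: "c > 0" unfolding c_def using se by simp
    have "q (\<lambda>i. of_real c * f i) < r" if q: "q \<in> Q" for q
    proof -
      have "q (\<lambda>i. of_real c * f i) = c * q f"
        using seminorm_scale[of q f "of_real c"] seminorms_are_seminorms Q(2) f q c by auto
      also have "\<dots> \<le> c * s" using qs[OF q] c by simp
      also have "\<dots> < r"
        unfolding c_def using se Q(3) e by (simp add: field_simps)
      finally show ?thesis .
    qed
    then have "p (\<lambda>i. of_real c * f i) < 1"
      using Q(4) scale_closed[OF f, of "of_real c"] by auto
    then have "c * p f < 1" using seminorm_scale[OF sp f, of "of_real c"] c by simp
    then have "p f < s / r + e" using se unfolding c_def by (simp add: field_simps)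
    then show "p f \<le> (1 / r) * (\<Sum>q\<in>Q. q f) + e" by (simp add: s_def)
  qed
  then show thesis using that[of Q "1 / r"] Q by simp
qed

end

section \<open>Completions of densely embedded spaces\<close>

lemma tendsto_0_dominated_sum:
  fixes f :: "'a \<Rightarrow> real"
  assumes "\<forall>\<^sub>F x in F. 0 \<le> f x \<and> f x \<le> C * (\<Sum>p\<in>P. g p x)"
    and "\<And>p. p \<in> P \<Longrightarrow> (g p \<longlongrightarrow> 0) F"
  shows "(f \<longlongrightarrow> 0) F"
proof (rule tendsto_sandwich)
  show "\<forall>\<^sub>F x in F. 0 \<le> f x" using assms(1) by eventually_elim simp
  show "\<forall>\<^sub>F x in F. f x \<le> C * (\<Sum>p\<in>P. g p x)" using assms(1) by eventually_elim simp
  have "((\<lambda>x. C * (\<Sum>p\<in>P. g p x)) \<longlongrightarrow> C * (\<Sum>p\<in>P. 0)) F"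
    using assms(2) by (intro tendsto_intros)
  then show "((\<lambda>x. C * (\<Sum>p\<in>P. g p x)) \<longlongrightarrow> 0) F" by simp
qed simp

lemma tendsto_prod_filter_fst: "(h \<longlongrightarrow> l) F \<Longrightarrow> ((\<lambda>(x, y). h x) \<longlongrightarrow> l) (F \<times>\<^sub>F G)"
  using filterlim_compose[of h "nhds l" F fst] filtermap_fst_prod_filter[of F G]
  by (simp add: filterlim_def case_prod_unfold)

lemma tendsto_prod_filter_snd: "(h \<longlongrightarrow> l) G \<Longrightarrow> ((\<lambda>(x, y). h y) \<longlongrightarrow> l) (F \<times>\<^sub>F G)"
  using filterlim_compose[of h "nhds l" G snd] filtermap_snd_prod_filter[of F G]
  by (simp add: filterlim_def case_prod_unfold)

text \<open>This transfers limits from one representative of a point of the completion to another one.\<close>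

lemma tendsto_prod_filter_snd_rev:
  assumes "((\<lambda>(x, y). h y) \<longlongrightarrow> l) (F \<times>\<^sub>F G)" "F \<noteq> bot"
  shows "(h \<longlongrightarrow> l) G"
  unfolding tendsto_def
proof safe
  fix S assume "open S" "l \<in> S"
  then have "\<forall>\<^sub>F z in F \<times>\<^sub>F G. (case z of (x, y) \<Rightarrow> h y) \<in> S"
    using assms(1) unfolding tendsto_def by blast
  then obtain Pf Pg where "eventually Pf F" "eventually Pg G" "\<And>x y. Pf x \<Longrightarrow> Pg y \<Longrightarrow> h y \<in> S"
    unfolding eventually_prod_filter by auto
  moreover obtain x where "Pf x"
    using \<open>eventually Pf F\<close> eventually_happens' assms(2) by blast
  ultimately show "\<forall>\<^sub>F y in G. h y \<in> S" by (auto elim: eventually_mono)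
qed

definition converges_in :: "'a lcs \<Rightarrow> 'a filter \<Rightarrow> 'a \<Rightarrow> bool" where
  "converges_in X F z \<longleftrightarrow> (\<forall>p\<in>seminorms X. ((\<lambda>x. p (vdiff X x z)) \<longlongrightarrow> 0) F)"

lemma (in function_lcs) tendsto_seminorm_limit:
  assumes "\<forall>\<^sub>F x in F. g x \<in> carrier X" "z \<in> carrier X" "is_seminorm X p"
    and "((\<lambda>x. p (\<lambda>i. g x i - z i)) \<longlongrightarrow> 0) F"
  shows "((\<lambda>x. p (g x)) \<longlongrightarrow> p z) F"
proof (rule LIM_zero_cancel, rule Lim_null_comparison[OF _ assms(4)])
  show "\<forall>\<^sub>F x in F. norm (p (g x) - p z) \<le> p (\<lambda>i. g x i - z i)"
    using assms(1) by eventually_elim (use seminorm_diff_bound assms in auto)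
qed

text \<open>The two families of estimates say that \<open>T\<close> is an embedding. Together with the density of its
  range they make \<open>Z\<close> a model of the completion of \<open>X\<close>.\<close>

locale dense_embedding =
  X: function_lcs X + Z: function_lcs Z
  for X :: "('i \<Rightarrow> complex) lcs" and Z :: "('j \<Rightarrow> complex) lcs" +
  fixes T :: "('i \<Rightarrow> complex) \<Rightarrow> 'j \<Rightarrow> complex"
  assumes linear: "linear_map X Z T"
    and bounded: "q \<in> seminorms Z \<Longrightarrow> \<exists>P C. finite P \<and> P \<subseteq> seminorms X \<and> 0 \<le> C \<and>
      (\<forall>x\<in>carrier X. q (T x) \<le> C * (\<Sum>p\<in>P. p x))"
    and embedding: "p \<in> seminorms X \<Longrightarrow> \<exists>Q C. finite Q \<and> Q \<subseteq> seminorms Z \<and> 0 \<le> C \<and>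
      (\<forall>x\<in>carrier X. p x \<le> C * (\<Sum>q\<in>Q. q (T x)))"
    and dense: "z \<in> carrier Z \<Longrightarrow> finite Q \<Longrightarrow> Q \<subseteq> seminorms Z \<Longrightarrow> 0 < e \<Longrightarrow>
      \<exists>x\<in>carrier X. \<forall>q\<in>Q. q (\<lambda>i. T x i - z i) < e"
    and complete: "lcs_cauchy_filter Z F \<Longrightarrow> \<exists>z\<in>carrier Z. converges_in Z F z"
    and hausdorff: "z \<in> carrier Z \<Longrightarrow> (\<And>q. q \<in> seminorms Z \<Longrightarrow> q z = 0) \<Longrightarrow> z = (\<lambda>i. 0)"
begin

lemma T_closed: "x \<in> carrier X \<Longrightarrow> T x \<in> carrier Z"
  using linear by (auto simp: linear_map_def)

lemma T_add: "x \<in> carrier X \<Longrightarrow> y \<in> carrier X \<Longrightarrow> T (\<lambda>i. x i + y i) = (\<lambda>i. T x i + T y i)"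
  using linear by (simp add: linear_map_def)

lemma T_scale: "x \<in> carrier X \<Longrightarrow> T (\<lambda>i. c * x i) = (\<lambda>i. c * T x i)"
  using linear by (simp add: linear_map_def)

lemma T_diff: "x \<in> carrier X \<Longrightarrow> y \<in> carrier X \<Longrightarrow> T (\<lambda>i. x i - y i) = (\<lambda>i. T x i - T y i)"
  using T_add[of x "\<lambda>i. - 1 * y i"] T_scale[of y "-1"] X.scale_closed[of y "-1"] by simp

text \<open>The point of the completion that corresponds to \<open>z\<close>. This map from \<open>Z\<close> to the completion is
  the inverse of the isomorphism to be constructed.\<close>

definition limit_class :: "('j \<Rightarrow> complex) \<Rightarrow> ('i \<Rightarrow> complex) filter set" where
  "limit_class z = {G. lcs_cauchy_filter X G \<and>
     (\<forall>q\<in>seminorms Z. ((\<lambda>x. q (\<lambda>i. T x i - z i)) \<longlongrightarrow> 0) G)}"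

lemma eventually_pair_carrier:
  assumes "\<forall>\<^sub>F x in F. x \<in> carrier X" "\<forall>\<^sub>F x in G. x \<in> carrier X"
  shows "\<forall>\<^sub>F (x, y) in F \<times>\<^sub>F G. x \<in> carrier X \<and> y \<in> carrier X"
  using eventually_prodI[OF assms] by (simp add: case_prod_unfold)

text \<open>As \<open>T\<close> is an embedding, filters can be compared through their images in \<open>Z\<close>, where limits are
  points.\<close>

lemma asymptotic_iff:
  assumes "\<forall>\<^sub>F x in F. x \<in> carrier X" "\<forall>\<^sub>F x in G. x \<in> carrier X"
  shows "asymptotic X F G \<longleftrightarrow>
    (\<forall>q\<in>seminorms Z. ((\<lambda>(x, y). q (\<lambda>i. T x i - T y i)) \<longlongrightarrow> 0) (F \<times>\<^sub>F G))" (is "?L \<longleftrightarrow> ?R")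
proof
  note ev = eventually_pair_carrier[OF assms]
  assume L: ?L
  show ?R
  proof
    fix q assume q: "q \<in> seminorms Z"
    obtain P C where P: "finite P" "P \<subseteq> seminorms X" "0 \<le> C"
      "\<And>x. x \<in> carrier X \<Longrightarrow> q (T x) \<le> C * (\<Sum>p\<in>P. p x)"
      using bounded[OF q] by auto
    show "((\<lambda>(x, y). q (\<lambda>i. T x i - T y i)) \<longlongrightarrow> 0) (F \<times>\<^sub>F G)"
    proof (rule tendsto_0_dominated_sum)
      show "\<forall>\<^sub>F z in F \<times>\<^sub>F G. 0 \<le> (case z of (x, y) \<Rightarrow> q (\<lambda>i. T x i - T y i)) \<and>
         (case z of (x, y) \<Rightarrow> q (\<lambda>i. T x i - T y i)) \<le> C * (\<Sum>p\<in>P. case z of (x, y) \<Rightarrow> p (\<lambda>i. x i - y i))"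
        using ev
      proof eventually_elim
        case (elim z)
        obtain x y where z: "z = (x, y)" by force
        have "x \<in> carrier X" "y \<in> carrier X" using elim z by auto
        then show ?case
          using P(4)[OF X.diff_closed[of x y]] T_diff[of x y]
            Z.seminorm_nonneg[OF Z.seminorms_are_seminorms[OF q] T_closed[OF X.diff_closed[of x y]]]
          by (simp add: z)
      qed
    next
      fix p assume "p \<in> P"
      then show "((\<lambda>z. case z of (x, y) \<Rightarrow> p (\<lambda>i. x i - y i)) \<longlongrightarrow> 0) (F \<times>\<^sub>F G)"
        using L P(2) unfolding asymptotic_def by auto
    qed
  qed
next
  note ev = eventually_pair_carrier[OF assms]
  assume R: ?R
  show ?L
    unfolding asymptotic_def
  proof
    fix p assume p: "p \<in> seminorms X"
    obtain Q C where Q: "finite Q" "Q \<subseteq> seminorms Z" "0 \<le> C"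
      "\<And>x. x \<in> carrier X \<Longrightarrow> p x \<le> C * (\<Sum>q\<in>Q. q (T x))"
      using embedding[OF p] by auto
    show "((\<lambda>(x, y). p (vdiff X x y)) \<longlongrightarrow> 0) (F \<times>\<^sub>F G)"
    proof (rule tendsto_0_dominated_sum)
      show "\<forall>\<^sub>F z in F \<times>\<^sub>F G. 0 \<le> (case z of (x, y) \<Rightarrow> p (vdiff X x y)) \<and>
         (case z of (x, y) \<Rightarrow> p (vdiff X x y)) \<le> C * (\<Sum>q\<in>Q. case z of (x, y) \<Rightarrow> q (\<lambda>i. T x i - T y i))"
        using ev
      proof eventually_elim
        case (elim z)
        obtain x y where z: "z = (x, y)" by force
        have "x \<in> carrier X" "y \<in> carrier X" using elim z by auto
        then show ?case
          using Q(4)[OF X.diff_closed[of x y]] T_diff[of x y]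
            X.seminorm_nonneg[OF X.seminorms_are_seminorms[OF p] X.diff_closed[of x y]]
          by (simp add: z)
      qed
    next
      fix q assume "q \<in> Q"
      then show "((\<lambda>z. case z of (x, y) \<Rightarrow> q (\<lambda>i. T x i - T y i)) \<longlongrightarrow> 0) (F \<times>\<^sub>F G)"
        using R Q(2) by auto
    qed
  qed
qed

lemma cauchy_filter_nonbot: "lcs_cauchy_filter X F \<Longrightarrow> F \<noteq> bot"
  and cauchy_filter_carrier: "lcs_cauchy_filter X F \<Longrightarrow> \<forall>\<^sub>F x in F. x \<in> carrier X"
  by (simp_all add: lcs_cauchy_filter_def)

lemma limit_class_cauchy: "F \<in> limit_class z \<Longrightarrow> lcs_cauchy_filter X F"
  by (simp add: limit_class_def)

lemma limit_class_tendsto: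
  "F \<in> limit_class z \<Longrightarrow> q \<in> seminorms Z \<Longrightarrow> ((\<lambda>x. q (\<lambda>i. T x i - z i)) \<longlongrightarrow> 0) F"
  by (simp add: limit_class_def)

lemma tendsto_image_diff:
  assumes "z \<in> carrier Z" "w \<in> carrier Z" "q \<in> seminorms Z"
    and "\<forall>\<^sub>F x in F. x \<in> carrier X" "\<forall>\<^sub>F x in G. x \<in> carrier X"
    and "((\<lambda>x. q (\<lambda>i. T x i - z i)) \<longlongrightarrow> 0) F" "((\<lambda>x. q (\<lambda>i. T x i - w i)) \<longlongrightarrow> 0) G"
  shows "((\<lambda>(x, y). q (\<lambda>i. T x i - T y i)) \<longlongrightarrow> q (\<lambda>i. z i - w i)) (F \<times>\<^sub>F G)"
proof -
  have sq: "is_seminorm Z q" using assms(3) by (rule Z.seminorms_are_seminorms)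
  have "((\<lambda>p. q ((\<lambda>(x, y) i. T x i - T y i) p)) \<longlongrightarrow> q (\<lambda>i. z i - w i)) (F \<times>\<^sub>F G)"
  proof (rule Z.tendsto_seminorm_limit[OF _ Z.diff_closed[OF assms(1,2)] sq])
    show "\<forall>\<^sub>F p in F \<times>\<^sub>F G. (\<lambda>(x, y) i. T x i - T y i) p \<in> carrier Z"
      using eventually_pair_carrier[OF assms(4,5)]
      by eventually_elim (auto intro!: Z.diff_closed T_closed)
    have lim: "((\<lambda>p. (\<lambda>(x, y). q (\<lambda>i. T x i - z i)) p + (\<lambda>(x, y). q (\<lambda>i. T y i - w i)) p) \<longlongrightarrow> 0) (F \<times>\<^sub>F G)"
      using tendsto_add[OF tendsto_prod_filter_fst[OF assms(6)] tendsto_prod_filter_snd[OF assms(7)]]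
      by simp
    show "((\<lambda>p. q (\<lambda>i. (\<lambda>(x, y) i. T x i - T y i) p i - (z i - w i))) \<longlongrightarrow> 0) (F \<times>\<^sub>F G)"
    proof (rule Lim_null_comparison[OF _ lim])
      show "\<forall>\<^sub>F p in F \<times>\<^sub>F G. norm (q (\<lambda>i. (\<lambda>(x, y) i. T x i - T y i) p i - (z i - w i)))
          \<le> (\<lambda>(x, y). q (\<lambda>i. T x i - z i)) p + (\<lambda>(x, y). q (\<lambda>i. T y i - w i)) p"
        using eventually_pair_carrier[OF assms(4,5)]
      proof eventually_elim
        case (elim p)
        obtain x y where p: "p = (x, y)" by force
        have c: "(\<lambda>i. T x i - z i) \<in> carrier Z" "(\<lambda>i. T y i - w i) \<in> carrier Z"
          using elim assms(1,2) p by (auto intro!: Z.diff_closed T_closed)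
        have "q (\<lambda>i. (T x i - z i) + -1 * (T y i - w i)) \<le>
            q (\<lambda>i. T x i - z i) + q (\<lambda>i. -1 * (T y i - w i))"
          using Z.seminorm_add[OF sq c(1) Z.scale_closed[OF c(2), of "-1"]] .
        moreover have "q (\<lambda>i. -1 * (T y i - w i)) = q (\<lambda>i. T y i - w i)"
          using Z.seminorm_scale[OF sq c(2), of "-1"] by simp
        moreover have "(\<lambda>i. (T x i - z i) + -1 * (T y i - w i)) = (\<lambda>i. T x i - T y i - (z i - w i))"
          by (simp add: fun_eq_iff)
        moreover have "0 \<le> q (\<lambda>i. T x i - T y i - (z i - w i))"
          using elim assms(1,2) p by (auto intro!: Z.seminorm_nonneg[OF sq] Z.diff_closed T_closed)
        ultimately show ?case by (simp add: p)
      qed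
    qed
  qed
  then show ?thesis by (simp add: case_prod_unfold)
qed

lemma limit_classI:
  assumes "z \<in> carrier Z" "F \<noteq> bot" "\<forall>\<^sub>F x in F. x \<in> carrier X"
    and lim: "\<And>q. q \<in> seminorms Z \<Longrightarrow> ((\<lambda>x. q (\<lambda>i. T x i - z i)) \<longlongrightarrow> 0) F"
  shows "F \<in> limit_class z"
proof -
  have "asymptotic X F F"
    unfolding asymptotic_iff[OF assms(3,3)]
  proof
    fix q assume q: "q \<in> seminorms Z"
    show "((\<lambda>(x, y). q (\<lambda>i. T x i - T y i)) \<longlongrightarrow> 0) (F \<times>\<^sub>F F)"
      using tendsto_image_diff[OF assms(1,1) q assms(3,3) lim[OF q] lim[OF q]]
        Z.seminorm_zero[OF Z.seminorms_are_seminorms[OF q]] by simp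
  qed
  then show ?thesis using assms by (simp add: limit_class_def lcs_cauchy_filter_def)
qed

lemma limit_class_asymptotic:
  assumes "z \<in> carrier Z" "F \<in> limit_class z" "G \<in> limit_class z"
  shows "asymptotic X F G"
proof -
  have c: "\<forall>\<^sub>F x in F. x \<in> carrier X" "\<forall>\<^sub>F x in G. x \<in> carrier X"
    using assms cauchy_filter_carrier limit_class_cauchy by blast+
  show ?thesis
    unfolding asymptotic_iff[OF c]
  proof
    fix q assume q: "q \<in> seminorms Z"
    show "((\<lambda>(x, y). q (\<lambda>i. T x i - T y i)) \<longlongrightarrow> 0) (F \<times>\<^sub>F G)"
      using tendsto_image_diff[OF assms(1,1) q c limit_class_tendsto[OF assms(2) q]
        limit_class_tendsto[OF assms(3) q]] Z.seminorm_zero[OF Z.seminorms_are_seminorms[OF q]]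
      by simp
  qed
qed

lemma limit_class_unique:
  assumes "z \<in> carrier Z" "w \<in> carrier Z" "F \<in> limit_class z" "F \<in> limit_class w"
  shows "z = w"
proof -
  have c: "\<forall>\<^sub>F x in F. x \<in> carrier X" and nb: "F \<noteq> bot"
    using assms cauchy_filter_carrier cauchy_filter_nonbot limit_class_cauchy by blast+
  have "(\<lambda>i. z i - w i) = (\<lambda>i. 0)"
  proof (rule hausdorff[OF Z.diff_closed[OF assms(1,2)]])
    fix q assume q: "q \<in> seminorms Z"
    have "((\<lambda>(x, y). q (\<lambda>i. T x i - T y i)) \<longlongrightarrow> q (\<lambda>i. z i - w i)) (F \<times>\<^sub>F F)"
      by (rule tendsto_image_diff[OF assms(1,2) q c c limit_class_tendsto[OF assms(3) q]
        limit_class_tendsto[OF assms(4) q]])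
    moreover have "((\<lambda>(x, y). q (\<lambda>i. T x i - T y i)) \<longlongrightarrow> 0) (F \<times>\<^sub>F F)"
      using bspec[OF iffD1[OF asymptotic_iff[OF c c]] q] limit_class_cauchy[OF assms(3)]
      by (simp add: lcs_cauchy_filter_def)
    ultimately show "q (\<lambda>i. z i - w i) = 0"
      by (rule tendsto_unique[rotated]) (simp add: prod_filter_eq_bot nb)
  qed
  then show ?thesis by (simp add: fun_eq_iff)
qed

lemma limit_class_extend:
  assumes "z \<in> carrier Z" "F \<in> limit_class z" "lcs_cauchy_filter X G" "asymptotic X F G"
  shows "G \<in> limit_class z"
proof -
  have c: "\<forall>\<^sub>F x in F. x \<in> carrier X" "\<forall>\<^sub>F x in G. x \<in> carrier X"
    using assms cauchy_filter_carrier limit_class_cauchy by blast+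
  have "((\<lambda>x. q (\<lambda>i. T x i - z i)) \<longlongrightarrow> 0) G" if q: "q \<in> seminorms Z" for q
  proof (rule tendsto_prod_filter_snd_rev)
    have sq: "is_seminorm Z q" using q by (rule Z.seminorms_are_seminorms)
    show "F \<noteq> bot" using assms(2) limit_class_cauchy cauchy_filter_nonbot by blast
    have "((\<lambda>(x, y). q (\<lambda>i. T x i - T y i)) \<longlongrightarrow> 0) (F \<times>\<^sub>F G)"
      using assms(4) q unfolding asymptotic_iff[OF c] by blast
    from tendsto_add[OF this tendsto_prod_filter_fst[OF limit_class_tendsto[OF assms(2) q]]]
    have lim: "((\<lambda>p. (\<lambda>(x, y). q (\<lambda>i. T x i - T y i)) p + (\<lambda>(x, y). q (\<lambda>i. T x i - z i)) p) \<longlongrightarrow> 0) (F \<times>\<^sub>F G)"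
      by simp
    show "((\<lambda>(x, y). q (\<lambda>i. T y i - z i)) \<longlongrightarrow> 0) (F \<times>\<^sub>F G)"
    proof (rule Lim_null_comparison[OF _ lim])
      show "\<forall>\<^sub>F p in F \<times>\<^sub>F G. norm (case p of (x, y) \<Rightarrow> q (\<lambda>i. T y i - z i))
          \<le> (\<lambda>(x, y). q (\<lambda>i. T x i - T y i)) p + (\<lambda>(x, y). q (\<lambda>i. T x i - z i)) p"
        using eventually_pair_carrier[OF c]
      proof eventually_elim
        case (elim p)
        obtain x y where p: "p = (x, y)" by force
        have xy: "T x \<in> carrier Z" "T y \<in> carrier Z" using elim p T_closed by auto
        show ?case
          using Z.seminorm_triangle[OF sq xy(2,1) assms(1)] Z.seminorm_commute[OF sq xy]
            Z.seminorm_nonneg[OF sq Z.diff_closed[OF xy(2) assms(1)]]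
          by (simp add: p)
      qed
    qed
  qed
  with assms(3) show ?thesis by (simp add: limit_class_def)
qed

lemma cauchy_class_eq_limit_class:
  assumes "z \<in> carrier Z" "F \<in> limit_class z"
  shows "cauchy_class X F = limit_class z"
  unfolding cauchy_class_def
  using limit_class_asymptotic[OF assms] limit_class_extend[OF assms] limit_class_cauchy by blast

lemma cauchy_filter_has_limit:
  assumes "lcs_cauchy_filter X F"
  obtains z where "z \<in> carrier Z" "F \<in> limit_class z"
proof -
  have c: "\<forall>\<^sub>F x in F. x \<in> carrier X" and nb: "F \<noteq> bot" and as: "asymptotic X F F"
    using assms by (auto simp: lcs_cauchy_filter_def)
  have prod: "filtermap T F \<times>\<^sub>F filtermap T F = filtermap (\<lambda>(x, y). (T x, T y)) (F \<times>\<^sub>F F)"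
    by (simp add: prod_filtermap1 prod_filtermap2 filtermap_filtermap case_prod_unfold apfst_def apsnd_def map_prod_def)
  have "lcs_cauchy_filter Z (filtermap T F)"
    unfolding lcs_cauchy_filter_def
  proof (intro conjI)
    show "filtermap T F \<noteq> bot" using nb by (simp add: filtermap_bot_iff)
    show "\<forall>\<^sub>F x in filtermap T F. x \<in> carrier Z"
      unfolding eventually_filtermap using c by eventually_elim (rule T_closed)
    show "asymptotic Z (filtermap T F) (filtermap T F)"
      using as unfolding asymptotic_iff[OF c c] unfolding asymptotic_def prod filterlim_filtermap
      by (simp add: case_prod_unfold)
  qed
  then obtain z where z: "z \<in> carrier Z" "converges_in Z (filtermap T F) z"
    using complete by blast
  then have "F \<in> limit_class z"
    using assms by (simp add: limit_class_def converges_in_def filterlim_filtermap)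
  with z(1) show thesis by (rule that)
qed

lemma limit_class_principal:
  assumes "x \<in> carrier X"
  shows "principal {x} \<in> limit_class (T x)"
proof -
  have lim: "(f \<longlongrightarrow> (0::real)) (principal {a})" if "f a = 0" for f :: "'c \<Rightarrow> real" and a
    using that by (auto simp: tendsto_def eventually_principal)
  have "((\<lambda>y. q (\<lambda>i. T y i - T x i)) \<longlongrightarrow> 0) (principal {x})" if "q \<in> seminorms Z" for q
    by (rule lim) (use Z.seminorm_zero[OF Z.seminorms_are_seminorms[OF that]] in simp)
  then show ?thesis
    using assms by (intro limit_classI T_closed) (simp_all add: eventually_principal principal_eq_bot_iff)
qed

text \<open>By density, the sets of all \<open>x\<close> with \<open>q (T x - z) < e\<close> for finitely many \<open>q\<close> are nonempty; they
  form the base of a filter with limit \<open>z\<close>.\<close>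

lemma limit_class_nonempty:
  assumes z: "z \<in> carrier Z"
  obtains F where "F \<in> limit_class z"
proof -
  define I where "I = {(Q, e::real). finite Q \<and> Q \<subseteq> seminorms Z \<and> 0 < e}"
  define B where "B = (\<lambda>(Q, e::real). {x \<in> carrier X. \<forall>q\<in>Q. q (\<lambda>i. T x i - z i) < e})"
  define F where "F = (INF i\<in>I. principal (B i))"
  have ne: "I \<noteq> {}" unfolding I_def by (auto intro!: exI[of _ "{}"] exI[of _ 1])
  have base: "eventually P F \<longleftrightarrow> (\<exists>i\<in>I. eventually P (principal (B i)))" for P
    unfolding F_def
  proof (rule eventually_INF_base[OF ne])
    fix a b assume "a \<in> I" "b \<in> I"
    then show "\<exists>x\<in>I. principal (B x) \<le> inf (principal (B a)) (principal (B b))"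
      by (intro bexI[of _ "(fst a \<union> fst b, min (snd a) (snd b))"])
        (auto simp: I_def B_def case_prod_unfold)
  qed
  have ball: "\<forall>\<^sub>F x in F. q (\<lambda>i. T x i - z i) < e" if "q \<in> seminorms Z" "0 < e" for q e
    unfolding base using that
    by (intro bexI[of _ "({q}, e)"]) (auto simp: I_def B_def eventually_principal)
  have F_carrier: "\<forall>\<^sub>F x in F. x \<in> carrier X"
    unfolding base by (intro bexI[of _ "({}, 1)"]) (auto simp: I_def B_def eventually_principal)
  have nb: "F \<noteq> bot"
  proof
    assume "F = bot"
    then have "eventually (\<lambda>x. False) F" by simp
    then obtain Q e where Qe: "(Q, e) \<in> I" "B (Q, e) = {}"
      unfolding base eventually_principal by auto
    then show False using dense[OF z, of Q e] by (auto simp: I_def B_def)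
  qed
  have lim: "((\<lambda>x. q (\<lambda>i. T x i - z i)) \<longlongrightarrow> 0) F" if q: "q \<in> seminorms Z" for q
  proof (rule tendstoI)
    fix e :: real assume "0 < e"
    then have "\<forall>\<^sub>F x in F. q (\<lambda>i. T x i - z i) < e" by (rule ball[OF q])
    then show "\<forall>\<^sub>F x in F. dist (q (\<lambda>i. T x i - z i)) 0 < e"
      using F_carrier
    proof eventually_elim
      case (elim x)
      then show ?case
        using Z.seminorm_nonneg[OF Z.seminorms_are_seminorms[OF q] Z.diff_closed[OF T_closed z]]
        by simp
    qed
  qed
  have "F \<in> limit_class z" by (rule limit_classI[OF z nb F_carrier lim])
  then show thesis by (rule that)
qed

lemma carrier_completion: "carrier (completion X) = limit_class ` carrier Z"
proof (intro equalityI subsetI)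
  fix A assume "A \<in> carrier (completion X)"
  then obtain F where F: "lcs_cauchy_filter X F" "A = cauchy_class X F"
    by (auto simp: completion_def)
  obtain z where "z \<in> carrier Z" "F \<in> limit_class z" using cauchy_filter_has_limit[OF F(1)] .
  then show "A \<in> limit_class ` carrier Z" using F(2) cauchy_class_eq_limit_class by blast
next
  fix A assume "A \<in> limit_class ` carrier Z"
  then obtain z where z: "z \<in> carrier Z" "A = limit_class z" by blast
  obtain F where F: "F \<in> limit_class z" using limit_class_nonempty[OF z(1)] .
  then show "A \<in> carrier (completion X)"
    using cauchy_class_eq_limit_class[OF z(1) F] z(2) limit_class_cauchy[OF F]
    by (auto simp: completion_def)
qed

lemma to_completion_eq: "x \<in> carrier X \<Longrightarrow> to_completion X x = limit_class (T x)"
  unfolding to_completion_def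
  by (rule cauchy_class_eq_limit_class[OF T_closed limit_class_principal])

lemma limit_class_combine:
  assumes z: "z \<in> carrier Z" and w: "w \<in> carrier Z" and F: "F \<in> limit_class z" and G: "G \<in> limit_class w"
  shows "filtermap (\<lambda>(x, y) i. x i + y i) (F \<times>\<^sub>F G) \<in> limit_class (\<lambda>i. z i + w i)"
proof -
  let ?H = "filtermap (\<lambda>(x, y) i. x i + y i) (F \<times>\<^sub>F G)"
  have c: "\<forall>\<^sub>F x in F. x \<in> carrier X" "\<forall>\<^sub>F x in G. x \<in> carrier X"
    using F G cauchy_filter_carrier limit_class_cauchy by blast+
  have nb: "?H \<noteq> bot"
    using F G cauchy_filter_nonbot limit_class_cauchy
    by (simp add: filtermap_bot_iff prod_filter_eq_bot)
  have ev: "\<forall>\<^sub>F x in ?H. x \<in> carrier X"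
    unfolding eventually_filtermap using eventually_pair_carrier[OF c]
    by eventually_elim (auto intro: X.add_closed)
  have zw: "(\<lambda>i. z i + w i) \<in> carrier Z" by (rule Z.add_closed[OF z w])
  have lim: "((\<lambda>x. q (\<lambda>i. T x i - (z i + w i))) \<longlongrightarrow> 0) ?H" if q: "q \<in> seminorms Z" for q
  proof -
    have sq: "is_seminorm Z q" using q by (rule Z.seminorms_are_seminorms)
    have lim: "((\<lambda>p. (\<lambda>(x, y). q (\<lambda>i. T x i - z i)) p + (\<lambda>(x, y). q (\<lambda>i. T y i - w i)) p) \<longlongrightarrow> 0) (F \<times>\<^sub>F G)"
      using tendsto_add[OF tendsto_prod_filter_fst[OF limit_class_tendsto[OF F q]]
          tendsto_prod_filter_snd[OF limit_class_tendsto[OF G q]]] by simp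
    show ?thesis
      unfolding filterlim_filtermap
    proof (rule Lim_null_comparison[OF _ lim])
      show "\<forall>\<^sub>F p in F \<times>\<^sub>F G. norm (q (\<lambda>i. T ((\<lambda>(x, y) i. x i + y i) p) i - (z i + w i)))
          \<le> (\<lambda>(x, y). q (\<lambda>i. T x i - z i)) p + (\<lambda>(x, y). q (\<lambda>i. T y i - w i)) p"
        using eventually_pair_carrier[OF c]
      proof eventually_elim
        case (elim p)
        obtain x y where p: "p = (x, y)" by force
        have xy: "x \<in> carrier X" "y \<in> carrier X" using elim p by auto
        have c: "(\<lambda>i. T x i - z i) \<in> carrier Z" "(\<lambda>i. T y i - w i) \<in> carrier Z"
          using xy z w by (auto intro!: Z.diff_closed T_closed)
        have "(\<lambda>i. T x i + T y i - (z i + w i)) = (\<lambda>i. (T x i - z i) + (T y i - w i))"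
          by (simp add: fun_eq_iff)
        then show ?case
          using Z.seminorm_add[OF sq c] Z.seminorm_nonneg[OF sq Z.add_closed[OF c]] xy
          by (simp add: p T_add)
      qed
    qed
  qed
  show ?thesis by (rule limit_classI[OF zw nb ev lim])
qed

lemma limit_class_scale:
  assumes z: "z \<in> carrier Z" and F: "F \<in> limit_class z"
  shows "filtermap (\<lambda>x i. c * x i) F \<in> limit_class (\<lambda>i. c * z i)"
proof -
  let ?H = "filtermap (\<lambda>x i. c * x i) F"
  have ev0: "\<forall>\<^sub>F x in F. x \<in> carrier X"
    using F cauchy_filter_carrier limit_class_cauchy by blast
  have nb: "?H \<noteq> bot"
    using F cauchy_filter_nonbot limit_class_cauchy by (simp add: filtermap_bot_iff)
  have ev: "\<forall>\<^sub>F x in ?H. x \<in> carrier X"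
    unfolding eventually_filtermap using ev0 by eventually_elim (auto intro: X.scale_closed)
  have cz: "(\<lambda>i. c * z i) \<in> carrier Z" by (rule Z.scale_closed[OF z])
  have lim: "((\<lambda>x. q (\<lambda>i. T x i - c * z i)) \<longlongrightarrow> 0) ?H" if q: "q \<in> seminorms Z" for q
  proof -
    have sq: "is_seminorm Z q" using q by (rule Z.seminorms_are_seminorms)
    have lim: "((\<lambda>x. cmod c * q (\<lambda>i. T x i - z i)) \<longlongrightarrow> 0) F"
      using tendsto_mult_left[OF limit_class_tendsto[OF F q], of "cmod c"] by simp
    have *: "\<forall>\<^sub>F x in F. cmod c * q (\<lambda>i. T x i - z i) = q (\<lambda>i. T (\<lambda>i. c * x i) i - c * z i)"
      using ev0
    proof eventually_elim
      case (elim x)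
      then show ?case
        using Z.seminorm_scale[OF sq Z.diff_closed[OF T_closed[OF elim] z], of c] T_scale[of x c]
        by (simp add: right_diff_distrib)
    qed
    show ?thesis
      unfolding filterlim_filtermap using tendsto_cong[OF *] lim by blast
  qed
  show ?thesis by (rule limit_classI[OF cz nb ev lim])
qed

lemma completion_add:
  assumes "z \<in> carrier Z" "w \<in> carrier Z"
  shows "vadd (completion X) (limit_class z) (limit_class w) = limit_class (\<lambda>i. z i + w i)"
proof -
  have "cauchy_class X (filtermap (\<lambda>(x, y). vadd X x y) (F \<times>\<^sub>F G)) = limit_class (\<lambda>i. z i + w i)"
    if "F \<in> limit_class z" "G \<in> limit_class w" for F G
    using cauchy_class_eq_limit_class[OF Z.add_closed[OF assms] limit_class_combine[OF assms that]]
    by simp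
  then have "vadd (completion X) (limit_class z) (limit_class w) =
      (\<Union>F\<in>limit_class z. \<Union>G\<in>limit_class w. limit_class (\<lambda>i. z i + w i))"
    unfolding completion_def by simp
  moreover obtain F G where "F \<in> limit_class z" "G \<in> limit_class w"
    using limit_class_nonempty assms by metis
  ultimately show ?thesis by auto
qed

lemma completion_scale:
  assumes "z \<in> carrier Z"
  shows "vscale (completion X) c (limit_class z) = limit_class (\<lambda>i. c * z i)"
proof -
  have "cauchy_class X (filtermap (vscale X c) F) = limit_class (\<lambda>i. c * z i)"
    if "F \<in> limit_class z" for F
    using cauchy_class_eq_limit_class[OF Z.scale_closed[OF assms] limit_class_scale[OF assms that]]
    by simp
  then have "vscale (completion X) c (limit_class z) = (\<Union>F\<in>limit_class z. limit_class (\<lambda>i. c * z i))"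
    unfolding completion_def by simp
  moreover obtain F where "F \<in> limit_class z"
    using limit_class_nonempty assms by metis
  ultimately show ?thesis by auto
qed

lemma completion_diff:
  assumes "z \<in> carrier Z" "w \<in> carrier Z"
  shows "vdiff (completion X) (limit_class z) (limit_class w) = limit_class (\<lambda>i. z i - w i)"
  unfolding vdiff_def completion_scale[OF assms(2)]
  by (subst completion_add) (use assms Z.scale_closed[OF assms(2), of "-1"] in simp_all)

abbreviation extended_seminorm ::
    "(('i \<Rightarrow> complex) \<Rightarrow> real) \<Rightarrow> ('i \<Rightarrow> complex) filter set \<Rightarrow> real" where
  "extended_seminorm p A \<equiv> THE l. \<forall>F\<in>A. (p \<longlongrightarrow> l) F"

text \<open>A seminorm is a contraction with respect to the distance it defines. Hence it maps a Cauchy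
  filter to a convergent one, and asymptotic filters yield the same limit. Therefore the definite
  description in the seminorms of the completion denotes this limit.\<close>

lemma extended_seminorm_tendsto:
  assumes p: "p \<in> seminorms X" and z: "z \<in> carrier Z" and F: "F \<in> limit_class z"
  shows "(p \<longlongrightarrow> extended_seminorm p (limit_class z)) F"
proof -
  have sp: "is_seminorm X p" using p by (rule X.seminorms_are_seminorms)
  have Fc: "\<forall>\<^sub>F x in F. x \<in> carrier X" and nb: "F \<noteq> bot"
    using F limit_class_cauchy cauchy_filter_carrier cauchy_filter_nonbot by blast+
  have "cauchy_filter (filtermap p F)"
    unfolding cauchy_filter_metric_filtermap
  proof safe
    fix e :: real assume e: "0 < e"
    have "((\<lambda>(x, y). p (vdiff X x y)) \<longlongrightarrow> 0) (F \<times>\<^sub>F F)"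
      using limit_class_asymptotic[OF z F F] p by (simp add: asymptotic_def)
    then have "\<forall>\<^sub>F u in F \<times>\<^sub>F F. (case u of (x, y) \<Rightarrow> p (vdiff X x y)) < e"
      using e by (rule order_tendstoD)
    then have "\<forall>\<^sub>F u in F \<times>\<^sub>F F. case u of (x, y) \<Rightarrow> dist (p x) (p y) < e"
      using eventually_pair_carrier[OF Fc Fc]
    proof eventually_elim
      case (elim u)
      then show ?case
        using X.seminorm_diff_bound[OF sp, of "fst u" "snd u"]
        by (simp add: dist_real_def case_prod_unfold)
    qed
    then obtain Pf Pg where P: "eventually Pf F" "eventually Pg F"
      "\<And>x y. Pf x \<Longrightarrow> Pg y \<Longrightarrow> dist (p x) (p y) < e"
      unfolding eventually_prod_filter by auto
    show "\<exists>P. eventually P F \<and> (\<forall>x y. P x \<and> P y \<longrightarrow> dist (p x) (p y) < e)"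
      using P by (intro exI[of _ "\<lambda>x. Pf x \<and> Pg x"]) (auto intro: eventually_conj)
  qed
  moreover have "filtermap p F \<noteq> bot" using nb by (simp add: filtermap_bot_iff)
  ultimately obtain l where l: "(p \<longlongrightarrow> l) F"
    using complete_UNIV[where 'a=real] unfolding complete_uniform filterlim_def by auto
  have all: "\<forall>G\<in>limit_class z. (p \<longlongrightarrow> l) G"
  proof
    fix G assume G: "G \<in> limit_class z"
    have Gc: "\<forall>\<^sub>F x in G. x \<in> carrier X"
      using G limit_class_cauchy cauchy_filter_carrier by blast
    have "((\<lambda>(x, y). p (vdiff X x y)) \<longlongrightarrow> 0) (F \<times>\<^sub>F G)"
      using limit_class_asymptotic[OF z F G] p by (simp add: asymptotic_def)
    then have "((\<lambda>u. p (snd u) - p (fst u)) \<longlongrightarrow> 0) (F \<times>\<^sub>F G)"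
    proof (rule Lim_null_comparison[rotated])
      show "\<forall>\<^sub>F u in F \<times>\<^sub>F G. norm (p (snd u) - p (fst u)) \<le> (case u of (x, y) \<Rightarrow> p (vdiff X x y))"
        using eventually_pair_carrier[OF Fc Gc]
      proof eventually_elim
        case (elim u)
        then show ?case
          using X.seminorm_diff_bound[OF sp, of "fst u" "snd u"] by (simp add: case_prod_unfold abs_minus_commute)
      qed
    qed
    from tendsto_add[OF this tendsto_prod_filter_fst[OF l, of G]]
    have "((\<lambda>(x, y). p y) \<longlongrightarrow> l) (F \<times>\<^sub>F G)" by (simp add: case_prod_unfold)
    then show "(p \<longlongrightarrow> l) G" using nb by (rule tendsto_prod_filter_snd_rev)
  qed
  have "l' = l" if "\<forall>G\<in>limit_class z. (p \<longlongrightarrow> l') G" for l'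
    by (rule tendsto_unique[OF nb bspec[OF that F] l])
  with all have "extended_seminorm p (limit_class z) = l" by (rule the_equality)
  with l show ?thesis by simp
qed

lemma tendsto_image_seminorm:
  assumes "z \<in> carrier Z" "F \<in> limit_class z" "q \<in> seminorms Z"
  shows "((\<lambda>x. q (T x)) \<longlongrightarrow> q z) F"
proof (rule Z.tendsto_seminorm_limit[OF _ assms(1) Z.seminorms_are_seminorms[OF assms(3)]
      limit_class_tendsto[OF assms(2,3)]])
  show "\<forall>\<^sub>F x in F. T x \<in> carrier Z"
    using cauchy_filter_carrier[OF limit_class_cauchy[OF assms(2)]] by eventually_elim (rule T_closed)
qed

lemma extended_seminorm_bound:
  assumes p: "p \<in> seminorms X"
  obtains Q C where "finite Q" "Q \<subseteq> seminorms Z" "0 \<le> C"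
    "\<And>z. z \<in> carrier Z \<Longrightarrow> extended_seminorm p (limit_class z) \<le> C * (\<Sum>q\<in>Q. q z)"
proof -
  obtain Q C where Q: "finite Q" "Q \<subseteq> seminorms Z" "0 \<le> C"
    "\<And>x. x \<in> carrier X \<Longrightarrow> p x \<le> C * (\<Sum>q\<in>Q. q (T x))"
    using embedding[OF p] by auto
  have "extended_seminorm p (limit_class z) \<le> C * (\<Sum>q\<in>Q. q z)" if z: "z \<in> carrier Z" for z
  proof -
    obtain F where F: "F \<in> limit_class z" using limit_class_nonempty[OF z] .
    have c: "lcs_cauchy_filter X F" using F by (rule limit_class_cauchy)
    show ?thesis
    proof (rule tendsto_le[OF cauchy_filter_nonbot[OF c] _ extended_seminorm_tendsto[OF p z F]])
      show "((\<lambda>x. C * (\<Sum>q\<in>Q. q (T x))) \<longlongrightarrow> C * (\<Sum>q\<in>Q. q z)) F"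
        using Q(2) by (intro tendsto_intros tendsto_image_seminorm[OF z F]) auto
      show "\<forall>\<^sub>F x in F. p x \<le> C * (\<Sum>q\<in>Q. q (T x))"
        using cauchy_filter_carrier[OF c] by eventually_elim (rule Q(4))
    qed
  qed
  with Q show thesis by (intro that) auto
qed

text \<open>This estimate and the preceding one are the estimates relating \<open>X\<close> and \<open>Z\<close>, passed to the limit
  along a filter.\<close>

lemma bound_by_extended_seminorms:
  assumes q: "q \<in> seminorms Z"
  obtains P C where "finite P" "P \<subseteq> seminorms X" "0 \<le> C"
    "\<And>z. z \<in> carrier Z \<Longrightarrow> q z \<le> C * (\<Sum>p\<in>P. extended_seminorm p (limit_class z))"
proof -
  obtain P C where P: "finite P" "P \<subseteq> seminorms X" "0 \<le> C"
    "\<And>x. x \<in> carrier X \<Longrightarrow> q (T x) \<le> C * (\<Sum>p\<in>P. p x)"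
    using bounded[OF q] by auto
  have "q z \<le> C * (\<Sum>p\<in>P. extended_seminorm p (limit_class z))" if z: "z \<in> carrier Z" for z
  proof -
    obtain F where F: "F \<in> limit_class z" using limit_class_nonempty[OF z] .
    have c: "lcs_cauchy_filter X F" using F by (rule limit_class_cauchy)
    show ?thesis
    proof (rule tendsto_le[OF cauchy_filter_nonbot[OF c] _ tendsto_image_seminorm[OF z F q]])
      show "((\<lambda>x. C * (\<Sum>p\<in>P. p x)) \<longlongrightarrow> C * (\<Sum>p\<in>P. extended_seminorm p (limit_class z))) F"
        using P(2) by (intro tendsto_mult_left tendsto_sum extended_seminorm_tendsto[OF _ z F]) auto
      show "\<forall>\<^sub>F x in F. q (T x) \<le> C * (\<Sum>p\<in>P. p x)"
        using cauchy_filter_carrier[OF c] by eventually_elim (rule P(4))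
    qed
  qed
  with P show thesis by (intro that) auto
qed

lemma extended_seminorm_nonneg:
  assumes p: "p \<in> seminorms X" and z: "z \<in> carrier Z"
  shows "0 \<le> extended_seminorm p (limit_class z)"
proof -
  obtain F where F: "F \<in> limit_class z" using limit_class_nonempty[OF z] .
  have c: "lcs_cauchy_filter X F" using F by (rule limit_class_cauchy)
  have "\<forall>\<^sub>F x in F. 0 \<le> p x"
    using cauchy_filter_carrier[OF c]
    by eventually_elim (rule X.seminorm_nonneg[OF X.seminorms_are_seminorms[OF p]])
  then show ?thesis
    using tendsto_lowerbound[OF extended_seminorm_tendsto[OF p z F]] cauchy_filter_nonbot[OF c] by blast
qed

lemma extended_seminorm_add:
  assumes p: "p \<in> seminorms X" and z: "z \<in> carrier Z" and w: "w \<in> carrier Z"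
  shows "extended_seminorm p (limit_class (\<lambda>i. z i + w i)) \<le>
    extended_seminorm p (limit_class z) + extended_seminorm p (limit_class w)"
proof -
  have sp: "is_seminorm X p" using p by (rule X.seminorms_are_seminorms)
  obtain F where F: "F \<in> limit_class z" using limit_class_nonempty[OF z] .
  obtain G where G: "G \<in> limit_class w" using limit_class_nonempty[OF w] .
  have c: "\<forall>\<^sub>F x in F. x \<in> carrier X" "\<forall>\<^sub>F x in G. x \<in> carrier X" and nb: "F \<noteq> bot" "G \<noteq> bot"
    using F G cauchy_filter_carrier cauchy_filter_nonbot limit_class_cauchy by blast+
  have 1: "((\<lambda>u. p (\<lambda>i. fst u i + snd u i)) \<longlongrightarrow> extended_seminorm p (limit_class (\<lambda>i. z i + w i))) (F \<times>\<^sub>F G)"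
    using extended_seminorm_tendsto[OF p Z.add_closed[OF z w] limit_class_combine[OF z w F G]]
    by (simp add: filterlim_filtermap case_prod_unfold)
  have 2: "((\<lambda>u. p (fst u) + p (snd u)) \<longlongrightarrow>
      extended_seminorm p (limit_class z) + extended_seminorm p (limit_class w)) (F \<times>\<^sub>F G)"
    using tendsto_add[OF tendsto_prod_filter_fst[OF extended_seminorm_tendsto[OF p z F]]
        tendsto_prod_filter_snd[OF extended_seminorm_tendsto[OF p w G]]]
    by (simp add: case_prod_unfold)
  have "\<forall>\<^sub>F u in F \<times>\<^sub>F G. p (\<lambda>i. fst u i + snd u i) \<le> p (fst u) + p (snd u)"
    using eventually_pair_carrier[OF c] by eventually_elim (auto intro: X.seminorm_add[OF sp])
  then show ?thesis
    using tendsto_le[OF _ 2 1] nb by (simp add: prod_filter_eq_bot)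
qed

lemma seminorms_completion: "seminorms (completion X) = (\<lambda>p. extended_seminorm p) ` seminorms X"
  by (simp add: completion_def)

lemma completion_distance: "seminorm_distance (completion X)"
proof
  fix r A assume "r \<in> seminorms (completion X)" "A \<in> carrier (completion X)"
  then obtain p z where pz: "p \<in> seminorms X" "r = extended_seminorm p" "z \<in> carrier Z" "A = limit_class z"
    by (auto simp: seminorms_completion carrier_completion)
  obtain Q C where Q: "finite Q" "Q \<subseteq> seminorms Z" "0 \<le> C"
    "\<And>z. z \<in> carrier Z \<Longrightarrow> extended_seminorm p (limit_class z) \<le> C * (\<Sum>q\<in>Q. q z)"
    using extended_seminorm_bound[OF pz(1)] by blast
  have "(\<Sum>q\<in>Q. q (\<lambda>i. 0)) = 0"
    using Q(2) Z.seminorm_zero Z.seminorms_are_seminorms by (intro sum.neutral) auto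
  then have "extended_seminorm p (limit_class (\<lambda>i. 0)) = 0"
    using Q(4)[OF Z.zero_closed] extended_seminorm_nonneg[OF pz(1) Z.zero_closed] by simp
  then show "r (vdiff (completion X) A A) = 0"
    using pz completion_diff[of z z] by simp
next
  fix r A B C assume "r \<in> seminorms (completion X)" "A \<in> carrier (completion X)"
    "B \<in> carrier (completion X)" "C \<in> carrier (completion X)"
  then obtain p a b c where *: "p \<in> seminorms X" "r = extended_seminorm p"
    "a \<in> carrier Z" "A = limit_class a" "b \<in> carrier Z" "B = limit_class b" "c \<in> carrier Z" "C = limit_class c"
    by (auto simp: seminorms_completion carrier_completion)
  show "r (vdiff (completion X) A C) \<le> r (vdiff (completion X) A B) + r (vdiff (completion X) B C)"
    using extended_seminorm_add[OF *(1) Z.diff_closed[OF *(3,5)] Z.diff_closed[OF *(5,7)]] *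
    by (simp add: completion_diff)
qed

theorem completion_isomorphism:
  "\<exists>\<Phi>. lcs_isomorphism (completion X) Z \<Phi> \<and> (\<forall>x\<in>carrier X. \<Phi> (to_completion X x) = T x)"
proof -
  define \<Phi> where "\<Phi> = inv_into (carrier Z) limit_class"
  have inj: "inj_on limit_class (carrier Z)"
  proof (rule inj_onI)
    fix z w assume zw: "z \<in> carrier Z" "w \<in> carrier Z" "limit_class z = limit_class w"
    obtain F where "F \<in> limit_class z" using limit_class_nonempty[OF zw(1)] .
    then show "z = w" using limit_class_unique[OF zw(1,2)] zw(3) by simp
  qed
  have \<Phi>: "\<Phi> (limit_class z) = z" if "z \<in> carrier Z" for z
    unfolding \<Phi>_def using inj that by (rule inv_into_f_f)
  have "linear_map (completion X) Z \<Phi>"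
    unfolding linear_map_def carrier_completion
    using \<Phi> by (auto simp: completion_add completion_scale Z.add_closed Z.scale_closed)
  moreover have "homeomorphic_map (lcs_topology (completion X)) (lcs_topology Z) \<Phi>"
  proof (rule dominated_inverse_homeomorphic[OF completion_distance Z.seminorm_distance_axioms])
    show "dominated_map (completion X) Z \<Phi>"
      unfolding dominated_map_def carrier_completion
    proof (intro conjI ballI)
      show "\<Phi> \<in> limit_class ` carrier Z \<rightarrow> carrier Z" using \<Phi> by auto
      fix q assume q: "q \<in> seminorms Z"
      obtain P C where P: "finite P" "P \<subseteq> seminorms X" "0 \<le> C"
        "\<And>z. z \<in> carrier Z \<Longrightarrow> q z \<le> C * (\<Sum>p\<in>P. extended_seminorm p (limit_class z))"
        using bound_by_extended_seminorms[OF q] by blast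
      \<comment> \<open>distinct seminorms may have the same extension, so that each class of the finite
        family \<open>P\<close> is counted with the cardinality of \<open>P\<close> as its multiplicity\<close>
      let ?P = "extended_seminorm ` P"
      have "q (\<lambda>i. z i - w i) \<le> (C * card P) * (\<Sum>r\<in>?P. r (limit_class (\<lambda>i. z i - w i)))"
        if zw: "z \<in> carrier Z" "w \<in> carrier Z" for z w
      proof -
        let ?u = "\<lambda>i. z i - w i"
        have u: "?u \<in> carrier Z" by (rule Z.diff_closed[OF zw])
        have "extended_seminorm p (limit_class ?u) \<le> (\<Sum>r\<in>?P. r (limit_class ?u))" if "p \<in> P" for p
          using that P(1,2) extended_seminorm_nonneg[OF _ u]
          by (intro member_le_sum[of "extended_seminorm p" ?P "\<lambda>r. r (limit_class ?u)"]) auto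
        then have "(\<Sum>p\<in>P. extended_seminorm p (limit_class ?u)) \<le> card P * (\<Sum>r\<in>?P. r (limit_class ?u))"
          by (intro sum_bounded_above) auto
        then show ?thesis
          using P(4)[OF u] P(3) by (smt (verit) mult.assoc mult_left_mono)
      qed
      then show "\<exists>P C. finite P \<and> P \<subseteq> seminorms (completion X) \<and> 0 \<le> C \<and>
          (\<forall>x\<in>limit_class ` carrier Z. \<forall>y\<in>limit_class ` carrier Z.
            q (vdiff Z (\<Phi> x) (\<Phi> y)) \<le> C * (\<Sum>p\<in>P. p (vdiff (completion X) x y)))"
        using P(1,2,3)
        by (intro exI[of _ ?P] exI[of _ "C * card P"]) (auto simp: \<Phi> completion_diff seminorms_completion)
    qed
    show "dominated_map Z (completion X) limit_class"
      unfolding dominated_map_def carrier_completion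
    proof (intro conjI ballI)
      show "limit_class \<in> carrier Z \<rightarrow> limit_class ` carrier Z" by auto
      fix r assume "r \<in> seminorms (completion X)"
      then obtain p where p: "p \<in> seminorms X" "r = extended_seminorm p"
        by (auto simp: seminorms_completion)
      obtain Q C where Q: "finite Q" "Q \<subseteq> seminorms Z" "0 \<le> C"
        "\<And>z. z \<in> carrier Z \<Longrightarrow> extended_seminorm p (limit_class z) \<le> C * (\<Sum>q\<in>Q. q z)"
        using extended_seminorm_bound[OF p(1)] by blast
      then show "\<exists>P C. finite P \<and> P \<subseteq> seminorms Z \<and> 0 \<le> C \<and>
          (\<forall>x\<in>carrier Z. \<forall>y\<in>carrier Z.
            r (vdiff (completion X) (limit_class x) (limit_class y)) \<le> C * (\<Sum>p\<in>P. p (vdiff Z x y)))"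
        by (intro exI[of _ Q] exI[of _ C]) (auto simp: p(2) completion_diff Z.diff_closed)
    qed
  qed (auto simp: \<Phi> carrier_completion)
  ultimately show ?thesis
    using \<Phi> to_completion_eq T_closed
    by (intro exI[of _ \<Phi>]) (auto simp: lcs_isomorphism_def)
qed

end

section \<open>Projective seminorms on tensor products of function spaces\<close>

locale tensor_factors = X: function_lcs X + Y: function_lcs Y
  for X :: "('i \<Rightarrow> complex) lcs" and Y :: "('j \<Rightarrow> complex) lcs"
begin

lemma tensor_add_left:
  "x \<in> carrier X \<Longrightarrow> x' \<in> carrier X \<Longrightarrow> y \<in> carrier Y \<Longrightarrow>
    tensor X Y (\<lambda>i. x i + x' i) y = (\<lambda>B. tensor X Y x y B + tensor X Y x' y B)"
  by (auto simp: tensor_def bilinear_form_def fun_eq_iff)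

lemma tensor_add_right:
  "x \<in> carrier X \<Longrightarrow> y \<in> carrier Y \<Longrightarrow> y' \<in> carrier Y \<Longrightarrow>
    tensor X Y x (\<lambda>i. y i + y' i) = (\<lambda>B. tensor X Y x y B + tensor X Y x y' B)"
  by (auto simp: tensor_def bilinear_form_def fun_eq_iff)

lemma tensor_scale_left:
  "x \<in> carrier X \<Longrightarrow> y \<in> carrier Y \<Longrightarrow>
    tensor X Y (\<lambda>i. c * x i) y = (\<lambda>B. c * tensor X Y x y B)"
  by (auto simp: tensor_def bilinear_form_def fun_eq_iff)

lemma tensor_scale_right:
  "x \<in> carrier X \<Longrightarrow> y \<in> carrier Y \<Longrightarrow>
    tensor X Y x (\<lambda>i. c * y i) = (\<lambda>B. c * tensor X Y x y B)"
  by (auto simp: tensor_def bilinear_form_def fun_eq_iff)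

lemma tensor_diff_left:
  assumes "x \<in> carrier X" "x' \<in> carrier X" "y \<in> carrier Y"
  shows "tensor X Y (\<lambda>i. x i - x' i) y = (\<lambda>B. tensor X Y x y B - tensor X Y x' y B)"
  using tensor_add_left[OF assms(1) X.scale_closed[OF assms(2), of "-1"] assms(3)]
    tensor_scale_left[OF assms(2,3), of "-1"] by simp

lemma tensor_diff_right:
  assumes "x \<in> carrier X" "y \<in> carrier Y" "y' \<in> carrier Y"
  shows "tensor X Y x (\<lambda>i. y i - y' i) = (\<lambda>B. tensor X Y x y B - tensor X Y x y' B)"
  using tensor_add_right[OF assms(1,2) Y.scale_closed[OF assms(3), of "-1"]]
    tensor_scale_right[OF assms(1,3), of "-1"] by simp

lemma tensor_sum_left:
  assumes "\<And>k. k \<in> K \<Longrightarrow> a k \<in> carrier X" "y \<in> carrier Y"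
  shows "tensor X Y (\<lambda>i. \<Sum>k\<in>K. c k * a k i) y = (\<lambda>B. \<Sum>k\<in>K. c k * tensor X Y (a k) y B)"
  using assms(1)
proof (induction K rule: infinite_finite_induct)
  case (insert k K)
  have "(\<lambda>i. \<Sum>k\<in>K. c k * a k i) \<in> carrier X"
    using insert.prems by (intro X.sum_closed X.scale_closed) auto
  then show ?case
    using insert X.scale_closed[of "a k" "c k"] assms(2)
    by (simp add: tensor_add_left tensor_scale_left)
qed (use tensor_scale_left[OF X.zero_closed assms(2), of 0] in simp_all)

lemma tensor_sum_right:
  assumes "x \<in> carrier X" "\<And>k. k \<in> K \<Longrightarrow> a k \<in> carrier Y"
  shows "tensor X Y x (\<lambda>i. \<Sum>k\<in>K. c k * a k i) = (\<lambda>B. \<Sum>k\<in>K. c k * tensor X Y x (a k) B)"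
  using assms(2)
proof (induction K rule: infinite_finite_induct)
  case (insert k K)
  have "(\<lambda>i. \<Sum>k\<in>K. c k * a k i) \<in> carrier Y"
    using insert.prems by (intro Y.sum_closed Y.scale_closed) auto
  then show ?case
    using insert Y.scale_closed[of "a k" "c k"] assms(1)
    by (simp add: tensor_add_right tensor_scale_right)
qed (use tensor_scale_right[OF assms(1) Y.zero_closed, of 0] in simp_all)

lemma tensor_sum_append:
  "tensor_sum X Y (xys @ uvs) = (\<lambda>B. tensor_sum X Y xys B + tensor_sum X Y uvs B)"
  by (simp add: tensor_sum_def)

lemma tensor_sum_scale:
  assumes "xys \<in> lists (carrier X \<times> carrier Y)"
  shows "tensor_sum X Y (map (\<lambda>(x, y). (\<lambda>i. c * x i, y)) xys) = (\<lambda>B. c * tensor_sum X Y xys B)"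
  using assms
  by (induction xys) (auto simp: tensor_sum_def tensor_scale_left distrib_left fun_eq_iff)

lemma scaled_pairs_in_lists:
  "xys \<in> lists (carrier X \<times> carrier Y) \<Longrightarrow>
    map (\<lambda>(x, y). (\<lambda>i. c * x i, y)) xys \<in> lists (carrier X \<times> carrier Y)"
  by (induction xys) (auto simp: X.scale_closed)

lemma carrier_projective_tensor:
  "u \<in> carrier (projective_tensor X Y) \<longleftrightarrow> (\<exists>xys\<in>lists (carrier X \<times> carrier Y). u = tensor_sum X Y xys)"
  by (auto simp: projective_tensor_def)

lemma tensor_in_carrier:
  "x \<in> carrier X \<Longrightarrow> y \<in> carrier Y \<Longrightarrow> tensor X Y x y \<in> carrier (projective_tensor X Y)"
  unfolding carrier_projective_tensor
  by (intro bexI[of _ "[(x, y)]"]) (auto simp: tensor_sum_def)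

context
  fixes p q
  assumes p: "is_seminorm X p" and q: "is_seminorm Y q"
begin

abbreviation "weight xys \<equiv> \<Sum>(x, y)\<leftarrow>xys. p x * q y"

lemma weight_nonneg: "xys \<in> lists (carrier X \<times> carrier Y) \<Longrightarrow> 0 \<le> weight xys"
  using X.seminorm_nonneg[OF p] Y.seminorm_nonneg[OF q] by (induction xys) auto

lemma weights_bdd_below:
  "bdd_below {weight xys | xys. xys \<in> lists (carrier X \<times> carrier Y) \<and> tensor_sum X Y xys = u}"
  using weight_nonneg by (intro bdd_belowI[of _ 0]) blast

lemma projective_seminorm_le:
  "xys \<in> lists (carrier X \<times> carrier Y) \<Longrightarrow> projective_seminorm X Y p q (tensor_sum X Y xys) \<le> weight xys"
  unfolding projective_seminorm_def by (rule cInf_lower[OF _ weights_bdd_below]) blast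

lemma projective_seminorm_greatest:
  assumes "u \<in> carrier (projective_tensor X Y)"
    and "\<And>xys. xys \<in> lists (carrier X \<times> carrier Y) \<Longrightarrow> tensor_sum X Y xys = u \<Longrightarrow> c \<le> weight xys"
  shows "c \<le> projective_seminorm X Y p q u"
  unfolding projective_seminorm_def
proof (rule cInf_greatest)
  obtain xys where "xys \<in> lists (carrier X \<times> carrier Y)" "u = tensor_sum X Y xys"
    using assms(1) carrier_projective_tensor by auto
  then show "{weight xys | xys. xys \<in> lists (carrier X \<times> carrier Y) \<and> tensor_sum X Y xys = u} \<noteq> {}"
    by auto
qed (use assms(2) in auto)

lemma projective_seminorm_approx:
  assumes "u \<in> carrier (projective_tensor X Y)" "projective_seminorm X Y p q u < c"
  obtains xys where "xys \<in> lists (carrier X \<times> carrier Y)" "tensor_sum X Y xys = u" "weight xys < c"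
  using projective_seminorm_greatest[OF assms(1), of c] assms(2) by force

lemma projective_seminorm_tensor:
  "x \<in> carrier X \<Longrightarrow> y \<in> carrier Y \<Longrightarrow> projective_seminorm X Y p q (tensor X Y x y) \<le> p x * q y"
  using projective_seminorm_le[of "[(x, y)]"] by (simp add: tensor_sum_def)

lemma projective_seminorm_nonneg:
  "u \<in> carrier (projective_tensor X Y) \<Longrightarrow> 0 \<le> projective_seminorm X Y p q u"
  by (rule projective_seminorm_greatest) (auto intro: weight_nonneg)

lemma projective_seminorm_add:
  assumes u: "u \<in> carrier (projective_tensor X Y)" and v: "v \<in> carrier (projective_tensor X Y)"
  shows "projective_seminorm X Y p q (\<lambda>B. u B + v B)
    \<le> projective_seminorm X Y p q u + projective_seminorm X Y p q v"
proof (rule field_le_epsilon)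
  fix e :: real assume e: "0 < e"
  obtain xs where xs: "xs \<in> lists (carrier X \<times> carrier Y)" "tensor_sum X Y xs = u"
    "weight xs < projective_seminorm X Y p q u + e / 2"
    by (rule projective_seminorm_approx[OF u, of "projective_seminorm X Y p q u + e / 2"]) (use e in auto)
  obtain ys where ys: "ys \<in> lists (carrier X \<times> carrier Y)" "tensor_sum X Y ys = v"
    "weight ys < projective_seminorm X Y p q v + e / 2"
    by (rule projective_seminorm_approx[OF v, of "projective_seminorm X Y p q v + e / 2"]) (use e in auto)
  have "projective_seminorm X Y p q (tensor_sum X Y (xs @ ys)) \<le> weight (xs @ ys)"
    using xs ys by (intro projective_seminorm_le) auto
  then show "projective_seminorm X Y p q (\<lambda>B. u B + v B)
      \<le> projective_seminorm X Y p q u + projective_seminorm X Y p q v + e"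
    using xs ys by (simp add: tensor_sum_append)
qed

text \<open>Scaling the left factors of a representation of \<open>u\<close> represents the multiple of \<open>u\<close>. Equality
  follows later by applying this inequality also to the inverse scalar.\<close>

lemma projective_seminorm_scale_le:
  assumes u: "u \<in> carrier (projective_tensor X Y)"
  shows "projective_seminorm X Y p q (\<lambda>B. c * u B) \<le> cmod c * projective_seminorm X Y p q u"
proof (rule field_le_epsilon)
  fix e :: real assume e: "0 < e"
  define d where "d = e / (cmod c + 1)"
  have d: "0 < d" "cmod c * d \<le> e" using e by (auto simp: d_def field_simps add_pos_nonneg)
  obtain xs where xs: "xs \<in> lists (carrier X \<times> carrier Y)" "tensor_sum X Y xs = u"
    "weight xs < projective_seminorm X Y p q u + d"
    by (rule projective_seminorm_approx[OF u, of "projective_seminorm X Y p q u + d"]) (use d in auto)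
  let ?ys = "map (\<lambda>(x, y). (\<lambda>i. c * x i, y)) xs"
  have "weight ?ys = cmod c * weight xs"
    using xs(1) by (induction xs) (auto simp: X.seminorm_scale[OF p] algebra_simps)
  also have "\<dots> \<le> cmod c * (projective_seminorm X Y p q u + d)"
    using xs(3) by (intro mult_left_mono) auto
  also have "\<dots> \<le> cmod c * projective_seminorm X Y p q u + e"
    using d(2) by (simp add: distrib_left)
  finally show "projective_seminorm X Y p q (\<lambda>B. c * u B) \<le> cmod c * projective_seminorm X Y p q u + e"
    using projective_seminorm_le[OF scaled_pairs_in_lists[OF xs(1), of c]]
    by (simp add: tensor_sum_scale[OF xs(1)] xs(2))
qed

end

lemma carrier_projective_tensor_add:
  assumes "u \<in> carrier (projective_tensor X Y)" "v \<in> carrier (projective_tensor X Y)"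
  shows "(\<lambda>B. u B + v B) \<in> carrier (projective_tensor X Y)"
proof -
  obtain xs ys where xs: "xs \<in> lists (carrier X \<times> carrier Y)" "u = tensor_sum X Y xs"
    and ys: "ys \<in> lists (carrier X \<times> carrier Y)" "v = tensor_sum X Y ys"
    using assms unfolding carrier_projective_tensor by blast
  show ?thesis
    unfolding carrier_projective_tensor xs(2) ys(2)
    using xs(1) ys(1) by (intro bexI[of _ "xs @ ys"]) (simp_all add: tensor_sum_append)
qed

lemma carrier_projective_tensor_scale:
  assumes "u \<in> carrier (projective_tensor X Y)"
  shows "(\<lambda>B. c * u B) \<in> carrier (projective_tensor X Y)"
proof -
  obtain xs where xs: "xs \<in> lists (carrier X \<times> carrier Y)" "u = tensor_sum X Y xs"
    using assms unfolding carrier_projective_tensor by blast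
  then show ?thesis
    unfolding carrier_projective_tensor
    using scaled_pairs_in_lists[OF xs(1)] tensor_sum_scale[OF xs(1)] by metis
qed

lemma projective_seminorm_is_seminorm:
  assumes p: "is_seminorm X p" and q: "is_seminorm Y q"
  shows "is_seminorm (projective_tensor X Y) (projective_seminorm X Y p q)"
proof -
  let ?r = "projective_seminorm X Y p q"
  have "?r (\<lambda>B. c * u B) = cmod c * ?r u" if u: "u \<in> carrier (projective_tensor X Y)" for c u
  proof (cases "c = 0")
    case True
    have "(\<lambda>B. 0) \<in> carrier (projective_tensor X Y)"
      using carrier_projective_tensor_scale[OF u, of 0] by simp
    then show ?thesis
      using projective_seminorm_scale_le[OF p q u, of 0] projective_seminorm_nonneg[OF p q] True
      by (simp add: order_antisym)
  next
    case False
    have "?r u \<le> cmod (inverse c) * ?r (\<lambda>B. c * u B)"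
      using projective_seminorm_scale_le[OF p q carrier_projective_tensor_scale[OF u, of c], of "inverse c"] False
      by (simp add: mult.assoc[symmetric])
    then have "cmod c * ?r u \<le> ?r (\<lambda>B. c * u B)"
      using mult_left_mono[of _ _ "cmod c"] False
      by (fastforce simp: norm_inverse mult.assoc[symmetric])
    with projective_seminorm_scale_le[OF p q u, of c] show ?thesis by simp
  qed
  then show ?thesis
    unfolding is_seminorm_def
    using projective_seminorm_nonneg[OF p q] projective_seminorm_add[OF p q]
    by (auto simp: projective_tensor_def)
qed

lemma projective_tensor_function_lcs: "function_lcs (projective_tensor X Y)"
proof
  show zero: "(\<lambda>B. 0) \<in> carrier (projective_tensor X Y)"
    using carrier_projective_tensor_scale[OF tensor_in_carrier[OF X.zero_closed Y.zero_closed], of 0] by simp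
  fix r assume "r \<in> seminorms (projective_tensor X Y)"
  then show "is_seminorm (projective_tensor X Y) r"
    using projective_seminorm_is_seminorm by (auto simp: projective_tensor_def continuous_seminorms_def)
qed (rule carrier_projective_tensor_add carrier_projective_tensor_scale, assumption+
  | simp add: projective_tensor_def)+

end

section \<open>Families of iterated derivatives, norms of integrable functions and averages over segments\<close>

text \<open>A function for each word of directions, such that differentiating in direction \<open>b\<close> prefixes \<open>b\<close>
  to the word. The members of such a family are the iterated derivatives of the member belonging to the
  empty word. To exhibit a family thus proves smoothness and computes all derivatives at once; sums,
  translates, averages, limits and products are treated in this way.\<close>

definition derivative_family :: "('a::euclidean_space list \<Rightarrow> 'a \<Rightarrow> complex) \<Rightarrow> bool" where
  "derivative_family J \<longleftrightarrow> (\<forall>bs\<in>lists Basis. \<forall>x.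
     (J bs has_derivative (\<lambda>h. \<Sum>b\<in>Basis. (h \<bullet> b) *\<^sub>R J (b # bs) x)) (at x))"

lemma derivative_familyD:
  "derivative_family J \<Longrightarrow> bs \<in> lists Basis \<Longrightarrow>
    (J bs has_derivative (\<lambda>h. \<Sum>b\<in>Basis. (h \<bullet> b) *\<^sub>R J (b # bs) x)) (at x)"
  by (simp add: derivative_family_def)

lemma has_derivative_translate:
  fixes f :: "'a::real_normed_vector \<Rightarrow> 'b::real_normed_vector"
  assumes "(f has_derivative D) (at (x - a))"
  shows "((\<lambda>x. f (x - a)) has_derivative D) (at x)"
proof -
  have "((\<lambda>x. x - a) has_derivative (\<lambda>h. h)) (at x)" by (auto intro!: derivative_eq_intros)
  then show ?thesis
    by (rule has_derivative_compose[where f = "\<lambda>x. x - a" and g = f]) (rule assms)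
qed

lemma sum_inner_Basis_scaleR:
  fixes F :: "'a::euclidean_space \<Rightarrow> 'b::real_vector"
  assumes "b \<in> Basis"
  shows "(\<Sum>c\<in>Basis. (b \<bullet> c) *\<^sub>R F c) = F b"
proof -
  have "(\<Sum>c\<in>Basis. (b \<bullet> c) *\<^sub>R F c) = (\<Sum>c\<in>Basis. if c = b then F c else 0)"
    using assms by (intro sum.cong) (auto simp: inner_Basis)
  then show ?thesis using assms by simp
qed

lemma partial_derivative_family:
  assumes J: "derivative_family J"
  shows "bs \<in> lists Basis \<Longrightarrow> partial_derivative bs (J []) = J bs"
proof (induction bs)
  case (Cons b bs)
  show ?case
  proof
    fix x
    have bs: "bs \<in> lists Basis" and b: "b \<in> Basis" using Cons.prems by auto
    have "frechet_derivative (J bs) (at x) = (\<lambda>h. \<Sum>c\<in>Basis. (h \<bullet> c) *\<^sub>R J (c # bs) x)"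
      using frechet_derivative_at[OF derivative_familyD[OF J bs]] by simp
    then show "partial_derivative (b # bs) (J []) x = J (b # bs) x"
      using Cons.IH bs sum_inner_Basis_scaleR[OF b, of "\<lambda>c. J (c # bs) x"] by simp
  qed
qed simp

lemma smooth_family:
  assumes "derivative_family J"
  shows "smooth (J [])"
  unfolding smooth_def differentiable_on_def
  using derivative_familyD[OF assms] partial_derivative_family[OF assms]
  by (auto simp: differentiable_def)

text \<open>A derivative is linear and hence determined by its values at the basis vectors.\<close>

lemma smooth_derivative_family:
  assumes "smooth f"
  shows "derivative_family (\<lambda>bs. partial_derivative bs f)"
  unfolding derivative_family_def
proof (intro ballI allI)
  fix bs x assume bs: "bs \<in> lists (Basis :: 'a set)"
  let ?g = "partial_derivative bs f"
  let ?D = "frechet_derivative ?g (at x)"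
  have "?g differentiable (at x)"
    using assms bs unfolding smooth_def differentiable_on_def by simp
  then have D: "(?g has_derivative ?D) (at x)" by (simp add: frechet_derivative_works)
  have "?D h = (\<Sum>b\<in>Basis. (h \<bullet> b) *\<^sub>R partial_derivative (b # bs) f x)" for h
  proof -
    have "?D h = ?D (\<Sum>b\<in>Basis. (h \<bullet> b) *\<^sub>R b)" by (simp add: euclidean_representation)
    also have "\<dots> = (\<Sum>b\<in>Basis. ?D ((h \<bullet> b) *\<^sub>R b))"
      using has_derivative_linear[OF D] by (rule linear_sum)
    also have "\<dots> = (\<Sum>b\<in>Basis. (h \<bullet> b) *\<^sub>R partial_derivative (b # bs) f x)"
      using linear_cmul[OF has_derivative_linear[OF D]] by simp
    finally show ?thesis .
  qed
  then have eq: "?D = (\<lambda>h. \<Sum>b\<in>Basis. (h \<bullet> b) *\<^sub>R partial_derivative (b # bs) f x)" ..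
  show "(?g has_derivative (\<lambda>h. \<Sum>b\<in>Basis. (h \<bullet> b) *\<^sub>R partial_derivative (b # bs) f x)) (at x)"
    using D unfolding eq .
qed

lemma partial_derivative_append:
  "partial_derivative bs (partial_derivative cs f) = partial_derivative (bs @ cs) f"
  by (induction bs) simp_all

definition l1_norm :: "('a::euclidean_space \<Rightarrow> complex) \<Rightarrow> real" where
  "l1_norm f = (LINT x|lborel. cmod (f x))"

lemma l1_norm_nonneg: "0 \<le> l1_norm f"
  by (simp add: l1_norm_def)

lemma nn_integral_l1_norm:
  "integrable lborel f \<Longrightarrow> (\<integral>\<^sup>+x. ennreal (cmod (f x)) \<partial>lborel) = ennreal (l1_norm f)"
  unfolding l1_norm_def by (intro nn_integral_eq_integral) auto

lemma l1_norm_boundI: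
  assumes f: "f \<in> borel_measurable borel" and c: "0 \<le> c"
    and "(\<integral>\<^sup>+x. ennreal (cmod (f x)) \<partial>lborel) \<le> ennreal c"
  shows "integrable lborel f" "l1_norm f \<le> c"
proof -
  have "(\<integral>\<^sup>+x. ennreal (cmod (f x)) \<partial>lborel) < \<infinity>"
    using assms(3) by (rule order_le_less_trans) simp
  then show i: "integrable lborel f" using f by (intro integrableI_bounded) auto
  show "l1_norm f \<le> c"
    using assms(3) c unfolding nn_integral_l1_norm[OF i] by simp
qed

lemma l1_norm_triangle:
  assumes "integrable lborel f" "integrable lborel g"
  shows "l1_norm (\<lambda>x. f x + g x) \<le> l1_norm f + l1_norm g"
proof -
  have "l1_norm (\<lambda>x. f x + g x) \<le> (LINT x|lborel. cmod (f x) + cmod (g x))"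
    unfolding l1_norm_def using assms by (intro integral_mono) (auto intro: norm_triangle_ineq)
  also have "\<dots> = l1_norm f + l1_norm g"
    unfolding l1_norm_def using assms by (intro Bochner_Integration.integral_add) auto
  finally show ?thesis .
qed

lemma l1_norm_scale: "l1_norm (\<lambda>x. c * f x) = cmod c * l1_norm f"
  by (simp add: l1_norm_def norm_mult)

lemma l1_norm_minus: "l1_norm (\<lambda>x. - f x) = l1_norm f"
  by (simp add: l1_norm_def)

lemma l1_norm_triangle_diff:
  assumes "integrable lborel f" "integrable lborel g"
  shows "l1_norm (\<lambda>x. f x - g x) \<le> l1_norm f + l1_norm g"
  using l1_norm_triangle[OF assms(1), of "\<lambda>x. - g x"] assms(2) by (simp add: l1_norm_minus)

lemma l1_norm_sum:
  assumes "\<And>k. k \<in> K \<Longrightarrow> integrable lborel (f k)"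
  shows "l1_norm (\<lambda>x. \<Sum>k\<in>K. f k x) \<le> (\<Sum>k\<in>K. l1_norm (f k))"
  using assms
proof (induction K rule: infinite_finite_induct)
  case (insert k K)
  then show ?case
    using l1_norm_triangle[of "f k" "\<lambda>x. \<Sum>k\<in>K. f k x"] by fastforce
qed (simp_all add: l1_norm_def)

lemma lborel_distr_reflect: "distr lborel borel (\<lambda>s. a - s) = (lborel :: 'a::euclidean_space measure)"
  using lborel_affine[of "-1" a] by (simp add: density_1)

lemma lborel_distr_translate: "distr lborel borel (\<lambda>s. s - a) = (lborel :: 'a::euclidean_space measure)"
proof -
  have "(+) (- a) = (\<lambda>s. s - a)" by auto
  then show ?thesis using lborel_distr_plus[of "- a"] by simp
qed

lemma nn_integral_lborel_translate:
  fixes f :: "'a::euclidean_space \<Rightarrow> ennreal"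
  assumes "f \<in> borel_measurable borel"
  shows "(\<integral>\<^sup>+x. f (x - a) \<partial>lborel) = (\<integral>\<^sup>+x. f x \<partial>lborel)"
  using nn_integral_distr[of "\<lambda>s. s - a" lborel borel f] assms by (simp add: lborel_distr_translate)

lemma integral_lborel_reflect:
  fixes f :: "'a::euclidean_space \<Rightarrow> 'b::{banach, second_countable_topology}"
  assumes "f \<in> borel_measurable borel"
  shows "(LINT x|lborel. f (a - x)) = (LINT x|lborel. f x)"
  using integral_distr[of "\<lambda>s. a - s" lborel borel f] assms by (simp add: lborel_distr_reflect)

lemma integrable_lborel_reflect:
  fixes f :: "'a::euclidean_space \<Rightarrow> 'b::{banach, second_countable_topology}"
  assumes "integrable lborel f"
  shows "integrable lborel (\<lambda>x. f (a - x))"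
  using integrable_distr[of "\<lambda>s. a - s" lborel borel f] assms by (simp add: lborel_distr_reflect)

lemma integrable_lborel_translate:
  fixes f :: "'a::euclidean_space \<Rightarrow> 'b::{banach, second_countable_topology}"
  assumes "integrable lborel f"
  shows "integrable lborel (\<lambda>x. f (x - a))"
  using integrable_distr[of "\<lambda>s. s - a" lborel borel f] assms by (simp add: lborel_distr_translate)

lemma integral_lborel_translate:
  fixes f :: "'a::euclidean_space \<Rightarrow> 'b::{banach, second_countable_topology}"
  assumes "f \<in> borel_measurable borel"
  shows "(LINT x|lborel. f (x - a)) = (LINT x|lborel. f x)"
  using integral_distr[of "\<lambda>s. s - a" lborel borel f] assms by (simp add: lborel_distr_translate)

lemma l1_norm_translate:
  assumes "f \<in> borel_measurable borel"
  shows "l1_norm (\<lambda>x. f (x - a)) = l1_norm f"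
  unfolding l1_norm_def using assms by (intro integral_lborel_translate) auto

text \<open>Minkowski's inequality, a consequence of Tonelli's theorem.\<close>

lemma minkowski_integral:
  fixes K :: "'a::euclidean_space \<Rightarrow> 'b \<Rightarrow> complex"
  assumes M: "sigma_finite_measure M"
    and K: "(\<lambda>(x, s). K x s) \<in> borel_measurable (lborel \<Otimes>\<^sub>M M)"
  shows "(\<integral>\<^sup>+x. ennreal (cmod (LINT s|M. K x s)) \<partial>lborel) \<le> (\<integral>\<^sup>+s. \<integral>\<^sup>+x. ennreal (cmod (K x s)) \<partial>lborel \<partial>M)"
proof -
  interpret M: sigma_finite_measure M by fact
  interpret P: pair_sigma_finite "lborel :: 'a measure" M ..
  have "ennreal (cmod (LINT s|M. K x s)) \<le> (\<integral>\<^sup>+s. ennreal (cmod (K x s)) \<partial>M)" for x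
    by (cases "integrable M (K x)")
      (simp_all add: integral_norm_bound_ennreal not_integrable_integral_eq)
  then have "(\<integral>\<^sup>+x. ennreal (cmod (LINT s|M. K x s)) \<partial>lborel) \<le> (\<integral>\<^sup>+x. \<integral>\<^sup>+s. ennreal (cmod (K x s)) \<partial>M \<partial>lborel)"
    by (intro nn_integral_mono)
  also have "\<dots> = (\<integral>\<^sup>+s. \<integral>\<^sup>+x. ennreal (cmod (K x s)) \<partial>lborel \<partial>M)"
    using K by (intro P.Fubini'[symmetric]) (auto simp: case_prod_unfold)
  finally show ?thesis .
qed

text \<open>Convolution with a density \<open>w\<close> on the segment from \<open>0\<close> to \<open>v\<close>. Such an average \<open>B\<close> with the weight
  \<open>1\<close> and \<open>A\<close> with the weight \<open>1 - t\<close> satisfy \<open>f = \<partial>\<^sub>v (A f) + B f\<close>. As the segment is compact, no decay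
  of \<open>f\<close> at infinity enters.\<close>

definition segment_average ::
    "(real \<Rightarrow> real) \<Rightarrow> 'a::euclidean_space \<Rightarrow> ('a \<Rightarrow> complex) \<Rightarrow> 'a \<Rightarrow> complex" where
  "segment_average w v f x = integral {0..1} (\<lambda>t. w t *\<^sub>R f (x - t *\<^sub>R v))"

lemma segment_average_integrable_on:
  fixes f :: "'a::euclidean_space \<Rightarrow> complex"
  assumes f: "continuous_on UNIV f" and w: "continuous_on {0..1} w"
  shows "(\<lambda>t. w t *\<^sub>R f (x - t *\<^sub>R v)) integrable_on {0..1}"
proof (rule integrable_continuous_real)
  have "continuous_on {0..1} (\<lambda>t. f (x - t *\<^sub>R v))"
    by (rule continuous_on_compose2[OF f]) (auto intro!: continuous_intros)
  then show "continuous_on {0..1} (\<lambda>t. w t *\<^sub>R f (x - t *\<^sub>R v))"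
    using w by (intro continuous_intros)
qed

lemma segment_average_lebesgue:
  fixes f :: "'a::euclidean_space \<Rightarrow> complex"
  assumes f: "continuous_on UNIV f" and w: "continuous_on {0..1} w"
  shows "segment_average w v f x = (LINT t|lborel. indicator {0..1} t *\<^sub>R w t *\<^sub>R f (x - t *\<^sub>R v))"
proof -
  have "continuous_on {0..1} (\<lambda>t. f (x - t *\<^sub>R v))"
    by (rule continuous_on_compose2[OF f]) (auto intro!: continuous_intros)
  then have "continuous_on {0..1} (\<lambda>t. w t *\<^sub>R f (x - t *\<^sub>R v))"
    using w by (intro continuous_intros)
  then have "set_integrable lborel {0..1} (\<lambda>t. w t *\<^sub>R f (x - t *\<^sub>R v))"
    by (rule borel_integrable_atLeastAtMost')
  from set_borel_integral_eq_integral(2)[OF this] show ?thesis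
    by (simp add: segment_average_def set_lebesgue_integral_def)
qed

lemma segment_average_l1:
  fixes f :: "'a::euclidean_space \<Rightarrow> complex"
  assumes f: "continuous_on UNIV f" and fi: "integrable lborel f"
    and w: "continuous_on UNIV w" and w1: "\<And>t. t \<in> {0..1} \<Longrightarrow> \<bar>w t\<bar> \<le> 1"
    and S: "segment_average w v f \<in> borel_measurable borel"
  shows "integrable lborel (segment_average w v f)" "l1_norm (segment_average w v f) \<le> l1_norm f"
proof -
  have [measurable]: "f \<in> borel_measurable borel" "w \<in> borel_measurable borel"
    using f w by (auto intro: borel_measurable_continuous_onI)
  let ?K = "\<lambda>x t. indicator {0..1} t *\<^sub>R w t *\<^sub>R f (x - t *\<^sub>R v)"
  have "(\<integral>\<^sup>+x. ennreal (cmod (segment_average w v f x)) \<partial>lborel) =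
      (\<integral>\<^sup>+x. ennreal (cmod (LINT t|lborel. ?K x t)) \<partial>lborel)"
    by (simp add: segment_average_lebesgue[OF f continuous_on_subset[OF w]])
  also have "\<dots> \<le> (\<integral>\<^sup>+t. \<integral>\<^sup>+x. ennreal (cmod (?K x t)) \<partial>lborel \<partial>lborel)"
    by (rule minkowski_integral) (auto simp: case_prod_unfold sigma_finite_lborel)
  also have "\<dots> \<le> (\<integral>\<^sup>+t. indicator {0..1} t * ennreal (l1_norm f) \<partial>(lborel :: real measure))"
  proof (rule nn_integral_mono)
    fix t :: real
    have "(\<integral>\<^sup>+x. ennreal (cmod (?K x t)) \<partial>lborel) \<le> (\<integral>\<^sup>+x. indicator {0..1} t * ennreal (cmod (f (x - t *\<^sub>R v))) \<partial>lborel)"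
      using w1[of t] by (intro nn_integral_mono) (auto simp: indicator_def mult_left_le_one_le intro!: ennreal_leI)
    also have "\<dots> = indicator {0..1} t * ennreal (l1_norm f)"
      by (simp add: nn_integral_cmult nn_integral_lborel_translate[of "\<lambda>x. ennreal (cmod (f x))"]
          nn_integral_l1_norm[OF fi])
    finally show "(\<integral>\<^sup>+x. ennreal (cmod (?K x t)) \<partial>lborel) \<le> indicator {0..1} t * ennreal (l1_norm f)" .
  qed
  also have "\<dots> = ennreal (l1_norm f)"
    by (simp add: nn_integral_multc)
  finally have "(\<integral>\<^sup>+x. ennreal (cmod (segment_average w v f x)) \<partial>lborel) \<le> ennreal (l1_norm f)" .
  from l1_norm_boundI[OF S l1_norm_nonneg this]
  show "integrable lborel (segment_average w v f)" "l1_norm (segment_average w v f) \<le> l1_norm f" .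
qed

text \<open>Differentiation under the integral sign: averages commute with derivatives.\<close>

lemma segment_average_has_derivative:
  fixes f :: "'a::euclidean_space \<Rightarrow> complex"
  assumes f: "\<And>x. (f has_derivative (\<lambda>h. \<Sum>b\<in>Basis. (h \<bullet> b) *\<^sub>R D b x)) (at x)"
    and D: "\<And>b. b \<in> Basis \<Longrightarrow> continuous_on UNIV (D b)"
    and w: "continuous_on {0..1} w"
  shows "(segment_average w v f has_derivative
    (\<lambda>h. \<Sum>b\<in>Basis. (h \<bullet> b) *\<^sub>R segment_average w v (D b) x)) (at x)"
proof -
  define fx where "fx x t = (\<Sum>b\<in>Basis. blinfun_scaleR_left (w t *\<^sub>R D b (x - t *\<^sub>R v)) o\<^sub>L blinfun_inner_left b)"
    for x t
  have fx: "blinfun_apply (fx x t) h = (\<Sum>b\<in>Basis. (h \<bullet> b) *\<^sub>R w t *\<^sub>R D b (x - t *\<^sub>R v))" for x t h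
    by (simp add: fx_def blinfun.sum_left)
  have fc: "continuous_on UNIV f"
    using f by (meson continuous_at_imp_continuous_on has_derivative_continuous)
  have cont: "continuous_on (UNIV \<times> cbox 0 1) (\<lambda>(x, t). fx x t)"
    unfolding fx_def case_prod_unfold
  proof (rule continuous_on_sum)
    fix b :: 'a assume b: "b \<in> Basis"
    have "continuous_on (UNIV \<times> cbox 0 1) (\<lambda>p. w (snd p))"
      by (rule continuous_on_compose2[OF w]) (auto intro!: continuous_intros)
    moreover have "continuous_on (UNIV \<times> cbox 0 1) (\<lambda>p. D b (fst p - snd p *\<^sub>R v))"
      by (rule continuous_on_compose2[OF D[OF b]]) (auto intro!: continuous_intros)
    ultimately have "continuous_on (UNIV \<times> cbox 0 1) (\<lambda>p. w (snd p) *\<^sub>R D b (fst p - snd p *\<^sub>R v))"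
      by (intro continuous_intros)
    then show "continuous_on (UNIV \<times> cbox 0 1) (\<lambda>p. blinfun_scaleR_left
        (w (snd p) *\<^sub>R D b (fst p - snd p *\<^sub>R v)) o\<^sub>L blinfun_inner_left b)"
      by (intro bounded_bilinear.continuous_on[OF bounded_bilinear_blinfun_compose] continuous_on_const
          bounded_linear.continuous_on[OF bounded_linear_blinfun_scaleR_left])
  qed
  have "((\<lambda>x. integral (cbox 0 1) (\<lambda>t. w t *\<^sub>R f (x - t *\<^sub>R v))) has_derivative
      blinfun_apply (integral (cbox 0 1) (fx x))) (at x within UNIV)"
  proof (rule leibniz_rule[OF _ _ cont])
    fix x :: 'a and t :: real
    have "((\<lambda>x. f (x - t *\<^sub>R v)) has_derivative (\<lambda>h. \<Sum>b\<in>Basis. (h \<bullet> b) *\<^sub>R D b (x - t *\<^sub>R v))) (at x)"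
      by (rule has_derivative_translate[OF f])
    from has_derivative_scaleR_right[OF this, of "w t"]
    show "((\<lambda>x. w t *\<^sub>R f (x - t *\<^sub>R v)) has_derivative blinfun_apply (fx x t)) (at x within UNIV)"
      by (simp add: fx[abs_def] scaleR_sum_right mult.commute)
    show "(\<lambda>t. w t *\<^sub>R f (x - t *\<^sub>R v)) integrable_on cbox 0 1"
      using segment_average_integrable_on[OF fc w] by simp
  qed auto
  moreover have "blinfun_apply (integral (cbox 0 1) (fx x)) h =
      (\<Sum>b\<in>Basis. (h \<bullet> b) *\<^sub>R segment_average w v (D b) x)" for h
  proof -
    have "continuous_on (cbox 0 1) (\<lambda>t. (\<lambda>(x, t). fx x t) (x, t))"
      by (rule continuous_on_compose2[OF cont]) (auto intro!: continuous_on_Pair continuous_on_id continuous_on_const)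
    then have "continuous_on (cbox 0 1) (fx x)" by simp
    then have "blinfun_apply (integral (cbox 0 1) (fx x)) h = integral {0..1} (\<lambda>t. blinfun_apply (fx x t) h)"
      by (subst blinfun_apply_integral) (auto intro: integrable_continuous_real)
    also have "\<dots> = (\<Sum>b\<in>Basis. integral {0..1} (\<lambda>t. (h \<bullet> b) *\<^sub>R w t *\<^sub>R D b (x - t *\<^sub>R v)))"
      unfolding fx by (intro integral_sum integrable_cmul segment_average_integrable_on D w) auto
    also have "\<dots> = (\<Sum>b\<in>Basis. (h \<bullet> b) *\<^sub>R segment_average w v (D b) x)"
      unfolding segment_average_def by (intro sum.cong integral_cmul refl)
    finally show ?thesis .
  qed
  then have "blinfun_apply (integral (cbox 0 1) (fx x)) =
      (\<lambda>h. \<Sum>b\<in>Basis. (h \<bullet> b) *\<^sub>R segment_average w v (D b) x)" ..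
  ultimately show ?thesis
    by (simp add: segment_average_def[abs_def])
qed

lemma segment_average_family:
  assumes J: "derivative_family J" and w: "continuous_on {0..1} w"
  shows "derivative_family (\<lambda>bs. segment_average w v (J bs))"
  unfolding derivative_family_def
proof (intro ballI allI)
  fix bs x assume bs: "bs \<in> lists (Basis :: 'a set)"
  show "(segment_average w v (J bs) has_derivative
      (\<lambda>h. \<Sum>b\<in>Basis. (h \<bullet> b) *\<^sub>R segment_average w v (J (b # bs)) x)) (at x)"
  proof (rule segment_average_has_derivative[OF derivative_familyD[OF J bs] _ w])
    fix b :: 'a assume "b \<in> Basis"
    then have "b # bs \<in> lists Basis" using bs by simp
    then show "continuous_on UNIV (J (b # bs))"
      using derivative_familyD[OF J] by (meson continuous_at_imp_continuous_on has_derivative_continuous)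
  qed
qed

text \<open>The fundamental theorem of calculus, applied on the segment to \<open>f (x - t v)\<close> and to
  \<open>(1 - t) f (x - t v)\<close>.\<close>

lemma segment_average_directional:
  fixes f :: "'a::euclidean_space \<Rightarrow> complex"
  assumes f: "\<And>x. (f has_derivative D x) (at x)" and D: "continuous_on UNIV (\<lambda>x. D x v)"
  shows "segment_average (\<lambda>t. 1) v (\<lambda>x. D x v) x = f x - f (x - v)"
    and "segment_average (\<lambda>t. 1 - t) v (\<lambda>x. D x v) x = f x - segment_average (\<lambda>t. 1) v f x"
proof -
  have vd: "((\<lambda>t. f (x - t *\<^sub>R v)) has_vector_derivative - D (x - t *\<^sub>R v) v) (at t within {0..1})" for t
  proof -
    have "((\<lambda>t. f (x - t *\<^sub>R v)) has_derivative (\<lambda>h. D (x - t *\<^sub>R v) (- h *\<^sub>R v))) (at t within {0..1})"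
      by (rule has_derivative_compose[OF _ f, of "\<lambda>t. x - t *\<^sub>R v"]) (auto intro!: derivative_eq_intros)
    then show ?thesis
      using linear_cmul[OF has_derivative_linear[OF f]] linear_neg[OF has_derivative_linear[OF f]]
      by (simp add: has_vector_derivative_def)
  qed
  have "((\<lambda>t. D (x - t *\<^sub>R v) v) has_integral (- f (x - 1 *\<^sub>R v) - - f (x - 0 *\<^sub>R v))) {0..1}"
    by (rule fundamental_theorem_of_calculus) (use has_vector_derivative_minus[OF vd] in auto)
  then show "segment_average (\<lambda>t. 1) v (\<lambda>x. D x v) x = f x - f (x - v)"
    by (simp add: segment_average_def integral_unique)
  have fc: "continuous_on UNIV f"
    using f by (meson continuous_at_imp_continuous_on has_derivative_continuous)
  have "((\<lambda>t. (1 - t) *\<^sub>R D (x - t *\<^sub>R v) v + f (x - t *\<^sub>R v)) has_integral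
      ((- (1 - 1) *\<^sub>R f (x - 1 *\<^sub>R v)) - (- (1 - 0) *\<^sub>R f (x - 0 *\<^sub>R v)))) {0..1}"
  proof (rule fundamental_theorem_of_calculus)
    fix t :: real assume "t \<in> {0..1}"
    show "((\<lambda>t. - (1 - t) *\<^sub>R f (x - t *\<^sub>R v)) has_vector_derivative
        (1 - t) *\<^sub>R D (x - t *\<^sub>R v) v + f (x - t *\<^sub>R v)) (at t within {0..1})"
      by (rule has_vector_derivative_eq_rhs, rule has_vector_derivative_scaleR[OF _ vd])
        (auto intro!: derivative_eq_intros simp: algebra_simps)
  qed simp
  then have "integral {0..1} (\<lambda>t. (1 - t) *\<^sub>R D (x - t *\<^sub>R v) v + f (x - t *\<^sub>R v)) = f x"
    by (simp add: integral_unique)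
  moreover have "integral {0..1} (\<lambda>t. (1 - t) *\<^sub>R D (x - t *\<^sub>R v) v + f (x - t *\<^sub>R v)) =
      segment_average (\<lambda>t. 1 - t) v (\<lambda>x. D x v) x + segment_average (\<lambda>t. 1) v f x"
    unfolding segment_average_def
    using segment_average_integrable_on[OF D, of "\<lambda>t. 1 - t" x v]
      segment_average_integrable_on[OF fc, of "\<lambda>t. 1" x v]
    by (simp add: Henstock_Kurzweil_Integration.integral_add continuous_intros)
  ultimately show "segment_average (\<lambda>t. 1 - t) v (\<lambda>x. D x v) x = f x - segment_average (\<lambda>t. 1) v f x"
    by (simp add: algebra_simps)
qed

section \<open>The space of integrable smooth functions: closure properties, Sobolev inequality, integration by parts\<close>

lemma DL1_I:
  assumes "derivative_family J" "\<And>bs. bs \<in> lists Basis \<Longrightarrow> integrable lborel (J bs)"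
  shows "J [] \<in> carrier DL1"
  unfolding DL1_def using smooth_family[OF assms(1)] assms(2)
  by (simp add: partial_derivative_family[OF assms(1)])

lemma DL1_smooth: "f \<in> carrier DL1 \<Longrightarrow> smooth f"
  by (simp add: DL1_def)

lemma DL1_family: "f \<in> carrier DL1 \<Longrightarrow> derivative_family (\<lambda>bs. partial_derivative bs f)"
  by (rule smooth_derivative_family[OF DL1_smooth])

lemma DL1_integrable:
  "f \<in> carrier DL1 \<Longrightarrow> bs \<in> lists Basis \<Longrightarrow> integrable lborel (partial_derivative bs f)"
  by (simp add: DL1_def)

lemma derivative_family_continuous:
  "derivative_family J \<Longrightarrow> bs \<in> lists Basis \<Longrightarrow> continuous_on UNIV (J bs)"
  by (meson continuous_at_imp_continuous_on has_derivative_continuous derivative_familyD)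

lemma smooth_continuous:
  "smooth f \<Longrightarrow> bs \<in> lists Basis \<Longrightarrow> continuous_on UNIV (partial_derivative bs f)"
  using derivative_family_continuous[OF smooth_derivative_family] .

lemma smooth_measurable:
  "smooth f \<Longrightarrow> bs \<in> lists Basis \<Longrightarrow> partial_derivative bs f \<in> borel_measurable borel"
  by (intro borel_measurable_continuous_onI smooth_continuous)

lemma smooth_has_derivative:
  "smooth f \<Longrightarrow> bs \<in> lists Basis \<Longrightarrow> (partial_derivative bs f has_derivative
    (\<lambda>h. \<Sum>b\<in>Basis. (h \<bullet> b) *\<^sub>R partial_derivative (b # bs) f x)) (at x)"
  using derivative_familyD[OF smooth_derivative_family] .

lemma derivative_family_add:
  assumes "derivative_family J" "derivative_family K"
  shows "derivative_family (\<lambda>bs x. J bs x + K bs x)"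
  unfolding derivative_family_def
proof (intro ballI allI)
  fix bs x assume bs: "bs \<in> lists (Basis :: 'a set)"
  show "((\<lambda>x. J bs x + K bs x) has_derivative
      (\<lambda>h. \<Sum>b\<in>Basis. (h \<bullet> b) *\<^sub>R (J (b # bs) x + K (b # bs) x))) (at x)"
    using has_derivative_add[OF derivative_familyD[OF assms(1) bs] derivative_familyD[OF assms(2) bs]]
    by (simp add: scaleR_add_right sum.distrib)
qed

lemma derivative_family_scale:
  assumes "derivative_family J"
  shows "derivative_family (\<lambda>bs x. c * J bs x)"
  unfolding derivative_family_def
proof (intro ballI allI)
  fix bs x assume bs: "bs \<in> lists (Basis :: 'a set)"
  show "((\<lambda>x. c * J bs x) has_derivative (\<lambda>h. \<Sum>b\<in>Basis. (h \<bullet> b) *\<^sub>R (c * J (b # bs) x))) (at x)"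
    using has_derivative_mult_right[OF derivative_familyD[OF assms bs], of c]
    by (simp add: sum_distrib_left)
qed

lemma derivative_family_translate:
  assumes "derivative_family J"
  shows "derivative_family (\<lambda>bs x. J bs (x - a))"
  unfolding derivative_family_def
  using has_derivative_translate[OF derivative_familyD[OF assms]] by blast

lemma derivative_family_shift:
  assumes "derivative_family J" "cs \<in> lists Basis"
  shows "derivative_family (\<lambda>bs. J (bs @ cs))"
  unfolding derivative_family_def
  using derivative_familyD[OF assms(1)] assms(2) by simp

lemma DL1_add:
  assumes "f \<in> carrier DL1" "g \<in> carrier DL1"
  shows "(\<lambda>x. f x + g x) \<in> carrier DL1"
    and "bs \<in> lists Basis \<Longrightarrow> partial_derivative bs (\<lambda>x. f x + g x) =
      (\<lambda>x. partial_derivative bs f x + partial_derivative bs g x)"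
  using DL1_I[OF derivative_family_add[OF DL1_family[OF assms(1)] DL1_family[OF assms(2)]]]
    partial_derivative_family[OF derivative_family_add[OF DL1_family[OF assms(1)] DL1_family[OF assms(2)]]]
  by (simp_all add: DL1_integrable assms)

lemma DL1_scale:
  assumes "f \<in> carrier DL1"
  shows "(\<lambda>x. c * f x) \<in> carrier DL1"
    and "bs \<in> lists Basis \<Longrightarrow> partial_derivative bs (\<lambda>x. c * f x) =
      (\<lambda>x. c * partial_derivative bs f x)"
  using DL1_I[OF derivative_family_scale[OF DL1_family[OF assms(1)]]]
    partial_derivative_family[OF derivative_family_scale[OF DL1_family[OF assms(1)]]]
  by (simp_all add: DL1_integrable assms)

lemma DL1_translate:
  assumes "f \<in> carrier DL1"
  shows "(\<lambda>x. f (x - a)) \<in> carrier DL1"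
    and "bs \<in> lists Basis \<Longrightarrow> partial_derivative bs (\<lambda>x. f (x - a)) = (\<lambda>x. partial_derivative bs f (x - a))"
  using DL1_I[OF derivative_family_translate[OF DL1_family[OF assms(1)]]]
    partial_derivative_family[OF derivative_family_translate[OF DL1_family[OF assms(1)]]]
  by (simp_all add: DL1_integrable assms integrable_lborel_translate)

lemma DL1_partial_derivative:
  assumes "f \<in> carrier DL1" "bs \<in> lists Basis"
  shows "partial_derivative bs f \<in> carrier DL1"
  using DL1_I[OF derivative_family_shift[OF DL1_family[OF assms(1)] assms(2)]] assms
  by (simp add: DL1_integrable)

lemma DL1_zero: "(\<lambda>x. 0) \<in> carrier DL1"
  using DL1_I[of "\<lambda>bs x. 0"] by (simp add: derivative_family_def)

lemma DL1_seminorms: "seminorms DL1 = (\<lambda>bs f. l1_norm (partial_derivative bs f)) ` lists Basis"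
  by (simp add: DL1_def l1_norm_def)

lemma DL1_operations:
  "vzero DL1 = (\<lambda>x. 0)" "vadd DL1 = (\<lambda>f g x. f x + g x)" "vscale DL1 = (\<lambda>c f x. c * f x)"
  by (simp_all add: DL1_def)

lemma DL1_is_seminorm:
  assumes "bs \<in> lists Basis"
  shows "is_seminorm DL1 (\<lambda>f. l1_norm (partial_derivative bs f))"
  unfolding is_seminorm_def DL1_operations
  using l1_norm_triangle[OF DL1_integrable[OF _ assms] DL1_integrable[OF _ assms]]
  by (simp add: l1_norm_nonneg DL1_add(2)[OF _ _ assms] DL1_scale(2)[OF _ assms] l1_norm_scale)

interpretation DL1: function_lcs "DL1 :: ('a::euclidean_space \<Rightarrow> complex) lcs"
proof
  fix p :: "('a \<Rightarrow> complex) \<Rightarrow> real" assume "p \<in> seminorms DL1"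
  then show "is_seminorm DL1 p" using DL1_is_seminorm by (auto simp: DL1_seminorms)
qed (simp_all add: DL1_operations DL1_zero DL1_add(1) DL1_scale(1))

lemma DL1_diff:
  assumes "f \<in> carrier DL1" "g \<in> carrier DL1" "bs \<in> lists Basis"
  shows "partial_derivative bs (\<lambda>x. f x - g x) =
      (\<lambda>x. partial_derivative bs f x - partial_derivative bs g x)"
  using DL1_add(2)[OF assms(1) DL1_scale(1)[OF assms(2), of "-1"] assms(3)]
    DL1_scale(2)[OF assms(2,3), of "-1"] by simp

lemma DL1_sum:
  assumes "\<And>k. k \<in> K \<Longrightarrow> f k \<in> carrier DL1" "bs \<in> lists Basis"
  shows "partial_derivative bs (\<lambda>x. \<Sum>k\<in>K. f k x) = (\<lambda>x. \<Sum>k\<in>K. partial_derivative bs (f k) x)"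
  using assms(1)
proof (induction K rule: infinite_finite_induct)
  case (insert k K)
  have "(\<lambda>x. \<Sum>k\<in>K. f k x) \<in> carrier DL1" using insert.prems by (intro DL1.sum_closed) auto
  with insert DL1_add(2)[OF _ _ assms(2), of "f k" "\<lambda>x. \<Sum>k\<in>K. f k x"] show ?case by simp
qed (use DL1_scale(2)[OF DL1_zero assms(2), of 0] in simp_all)

context
  fixes w :: "real \<Rightarrow> real"
  assumes w: "continuous_on UNIV w" and w1: "\<forall>t\<in>{0..1}. \<bar>w t\<bar> \<le> 1"
begin

lemma DL1_segment_average_derivative:
  assumes "f \<in> carrier DL1" "bs \<in> lists Basis"
  shows "partial_derivative bs (segment_average w v f) = segment_average w v (partial_derivative bs f)"
  using partial_derivative_family[OF segment_average_family[OF DL1_family[OF assms(1)]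
        continuous_on_subset[OF w]] assms(2)] by simp

lemma segment_average_smooth_l1:
  assumes f: "f \<in> carrier DL1" and bs: "bs \<in> lists Basis"
  shows "integrable lborel (segment_average w v (partial_derivative bs f))"
    and "l1_norm (segment_average w v (partial_derivative bs f)) \<le> l1_norm (partial_derivative bs f)"
proof -
  have "continuous_on UNIV (segment_average w v (partial_derivative bs f))"
    by (rule derivative_family_continuous[OF segment_average_family[OF DL1_family[OF f]
        continuous_on_subset[OF w]] bs]) simp
  then have "segment_average w v (partial_derivative bs f) \<in> borel_measurable borel"
    by (rule borel_measurable_continuous_onI)
  from segment_average_l1[OF smooth_continuous[OF DL1_smooth[OF f] bs] DL1_integrable[OF f bs] w _ this] w1
  show "integrable lborel (segment_average w v (partial_derivative bs f))"
    and "l1_norm (segment_average w v (partial_derivative bs f)) \<le> l1_norm (partial_derivative bs f)"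
    by blast+
qed

lemma DL1_segment_average:
  assumes "f \<in> carrier DL1"
  shows "segment_average w v f \<in> carrier DL1"
  using DL1_I[OF segment_average_family[OF DL1_family[OF assms] continuous_on_subset[OF w]]]
    segment_average_smooth_l1(1)[OF assms] by simp

end

text \<open>The difference \<open>f x - f (x - v)\<close> is the average of the derivative in direction \<open>v\<close> over the segment,
  and averaging does not increase the norm.\<close>

lemma l1_norm_diff_translate:
  assumes f: "f \<in> carrier DL1"
  shows "l1_norm (\<lambda>x. f x - f (x - v)) \<le> (\<Sum>b\<in>Basis. \<bar>v \<bullet> b\<bar> * l1_norm (partial_derivative [b] f))"
proof -
  define D where "D x h = (\<Sum>b\<in>Basis. (h \<bullet> b) *\<^sub>R partial_derivative [b] f x)" for x h
  have D: "(f has_derivative D x) (at x)" for x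
    unfolding D_def[abs_def] using smooth_has_derivative[OF DL1_smooth[OF f], of "[]"] by simp
  have Dc: "continuous_on UNIV (\<lambda>x. D x v)"
    unfolding D_def by (intro continuous_intros smooth_continuous[OF DL1_smooth[OF f]]) auto
  have Di: "integrable lborel (\<lambda>x. D x v)"
    unfolding D_def by (intro Bochner_Integration.integrable_sum integrable_scaleR_right DL1_integrable[OF f]) auto
  have eq: "segment_average (\<lambda>t. 1) v (\<lambda>x. D x v) = (\<lambda>x. f x - f (x - v))"
    using segment_average_directional(1)[OF D Dc] by blast
  have [measurable]: "f \<in> borel_measurable borel"
    using smooth_measurable[OF DL1_smooth[OF f], of "[]"] by simp
  have "l1_norm (\<lambda>x. f x - f (x - v)) \<le> l1_norm (\<lambda>x. D x v)"
    using segment_average_l1(2)[OF Dc Di, of "\<lambda>t. 1" v] unfolding eq by simp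
  also have "\<dots> \<le> (\<Sum>b\<in>Basis. l1_norm (\<lambda>x. (v \<bullet> b) *\<^sub>R partial_derivative [b] f x))"
    unfolding D_def by (intro l1_norm_sum integrable_scaleR_right DL1_integrable[OF f]) auto
  also have "\<dots> = (\<Sum>b\<in>Basis. \<bar>v \<bullet> b\<bar> * l1_norm (partial_derivative [b] f))"
    by (simp add: scaleR_conv_of_real l1_norm_scale del: partial_derivative.simps)
  finally show ?thesis .
qed

lemma integral_segment_average:
  fixes g :: "'a::euclidean_space \<Rightarrow> complex"
  assumes g: "continuous_on UNIV g" and gi: "integrable lborel g"
  shows "(LINT x|lborel. segment_average (\<lambda>t. 1) v g x) = (LINT x|lborel. g x)"
proof -
  have [measurable]: "g \<in> borel_measurable borel" using g by (rule borel_measurable_continuous_onI)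
  let ?K = "\<lambda>(t, x). indicator {0..1::real} t *\<^sub>R g (x - t *\<^sub>R v)"
  have eq: "(LINT x|lborel. norm (?K (t, x))) = indicator {0..1} t * l1_norm g" for t
    using l1_norm_translate[of g "t *\<^sub>R v"] by (simp add: l1_norm_def indicator_def)
  have "integrable (lborel \<Otimes>\<^sub>M lborel) ?K"
  proof (rule lborel_pair.Fubini_integrable)
    show "integrable lborel (\<lambda>t. LINT x|lborel. norm (?K (t, x)))"
      unfolding eq by simp
    show "AE t in lborel. integrable lborel (\<lambda>x. ?K (t, x))"
      using integrable_lborel_translate[OF gi] by simp
  qed (simp add: case_prod_unfold)
  from lborel_pair.Fubini_integral[OF this]
  have "(LINT x|lborel. LINT t|lborel. indicator {0..1} t *\<^sub>R g (x - t *\<^sub>R v)) =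
      (LINT t|lborel. LINT x|lborel. indicator {0..1::real} t *\<^sub>R g (x - t *\<^sub>R v))" .
  also have "\<dots> = (LINT t|lborel. indicator {0..1::real} t *\<^sub>R (LINT x|lborel. g x))"
    by (simp add: integral_lborel_translate)
  also have "\<dots> = (LINT x|lborel. g x)" by simp
  finally show ?thesis by (simp add: segment_average_lebesgue[OF g])
qed

text \<open>Averaging preserves the integral, and the average of the derivative is the difference of \<open>f\<close> and a
  translate of \<open>f\<close>, whose integral vanishes.\<close>

lemma integral_directional_derivative_eq_0:
  fixes f :: "'a::euclidean_space \<Rightarrow> complex"
  assumes f: "\<And>x. (f has_derivative D x) (at x)" and fi: "integrable lborel f"
    and D: "continuous_on UNIV (\<lambda>x. D x v)" and Di: "integrable lborel (\<lambda>x. D x v)"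
  shows "(LINT x|lborel. D x v) = 0"
proof -
  have [measurable]: "f \<in> borel_measurable borel" using fi by auto
  have "(LINT x|lborel. D x v) = (LINT x|lborel. f x - f (x - v))"
    using integral_segment_average[OF D Di, of v] segment_average_directional(1)[OF f D] by simp
  also have "\<dots> = 0"
    using integrable_lborel_translate[OF fi, of v] fi by (simp add: integral_lborel_translate)
  finally show ?thesis .
qed

lemma segment_average_bound:
  fixes f :: "'a::euclidean_space \<Rightarrow> complex"
  assumes f: "continuous_on UNIV f" and w: "continuous_on UNIV w" and w1: "\<And>t. t \<in> {0..1} \<Longrightarrow> \<bar>w t\<bar> \<le> 1"
  shows "ennreal (cmod (segment_average w v f x)) \<le> (\<integral>\<^sup>+t. ennreal (cmod (f (x - t *\<^sub>R v))) \<partial>lborel)"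
proof -
  let ?K = "\<lambda>t. indicator {0..1} t *\<^sub>R w t *\<^sub>R f (x - t *\<^sub>R v)"
  have "ennreal (cmod (LINT t|lborel. ?K t)) \<le> (\<integral>\<^sup>+t. ennreal (cmod (?K t)) \<partial>lborel)"
  proof (cases "integrable lborel ?K")
    case True
    then show ?thesis by (rule integral_norm_bound_ennreal)
  qed (simp add: not_integrable_integral_eq)
  also have "\<dots> \<le> (\<integral>\<^sup>+t. ennreal (cmod (f (x - t *\<^sub>R v))) \<partial>lborel)"
    using w1 by (intro nn_integral_mono ennreal_leI) (auto simp: indicator_def mult_left_le_one_le)
  finally show ?thesis
    by (simp add: segment_average_lebesgue[OF f continuous_on_subset[OF w]])
qed

text \<open>The identity \<open>f = A (\<partial>\<^sub>b f) + B f\<close> bounds a value of \<open>f\<close> by integrals over the line in direction \<open>b\<close>.\<close>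

lemma smooth_line_bound:
  fixes f :: "'a::euclidean_space \<Rightarrow> complex"
  assumes f: "smooth f" and bs: "bs \<in> lists Basis" and b: "b \<in> Basis"
  shows "ennreal (cmod (partial_derivative bs f x)) \<le>
    (\<integral>\<^sup>+t. ennreal (cmod (partial_derivative (b # bs) f (x - t *\<^sub>R b))) \<partial>lborel) +
    (\<integral>\<^sup>+t. ennreal (cmod (partial_derivative bs f (x - t *\<^sub>R b))) \<partial>lborel)"
proof -
  let ?g = "partial_derivative bs f" and ?h = "partial_derivative (b # bs) f"
  define D where "D x h = (\<Sum>b\<in>Basis. (h \<bullet> b) *\<^sub>R partial_derivative (b # bs) f x)" for x h
  have D: "(?g has_derivative D x) (at x)" for x
    unfolding D_def[abs_def] by (rule smooth_has_derivative[OF f bs])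
  have Db: "(\<lambda>x. D x b) = ?h"
    unfolding D_def by (rule ext) (rule sum_inner_Basis_scaleR[OF b])
  have bbs: "b # bs \<in> lists Basis" using b bs by simp
  have hc: "continuous_on UNIV ?h" and gc: "continuous_on UNIV ?g"
    by (rule smooth_continuous[OF f bbs], rule smooth_continuous[OF f bs])
  have "segment_average (\<lambda>t. 1 - t) b ?h x = ?g x - segment_average (\<lambda>t. 1) b ?g x"
    using segment_average_directional(2)[OF D, of b x] hc unfolding Db by (rule meta_mp)
  then have "?g x = segment_average (\<lambda>t. 1 - t) b ?h x + segment_average (\<lambda>t. 1) b ?g x"
    by (simp del: partial_derivative.simps)
  then have "ennreal (cmod (?g x)) \<le> ennreal (cmod (segment_average (\<lambda>t. 1 - t) b ?h x) +
      cmod (segment_average (\<lambda>t. 1) b ?g x))"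
    by (metis ennreal_leI norm_triangle_ineq)
  also have "\<dots> = ennreal (cmod (segment_average (\<lambda>t. 1 - t) b ?h x)) +
      ennreal (cmod (segment_average (\<lambda>t. 1) b ?g x))"
    by (rule ennreal_plus) auto
  also have "\<dots> \<le> (\<integral>\<^sup>+t. ennreal (cmod (?h (x - t *\<^sub>R b))) \<partial>lborel) +
    (\<integral>\<^sup>+t. ennreal (cmod (?g (x - t *\<^sub>R b))) \<partial>lborel)"
    by (intro add_mono segment_average_bound hc gc) (auto intro!: continuous_intros)
  finally show ?thesis .
qed

text \<open>Each application of the bound on lines adds one more direction over which is integrated. Words
  are collected in a list, so that equal terms are counted with multiplicity.\<close>

lemma sobolev_partial:
  fixes B :: "'a::euclidean_space set"
  assumes "finite B" "B \<subseteq> Basis"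
  shows "\<exists>as. set as \<subseteq> lists Basis \<and> (\<forall>f x. smooth f \<longrightarrow> ennreal (cmod (f x)) \<le>
    (\<Sum>a\<leftarrow>as. \<integral>\<^sup>+t. ennreal (cmod (partial_derivative a f (x - (\<Sum>b\<in>B. t b *\<^sub>R b)))) \<partial>(\<Pi>\<^sub>M b\<in>B. lborel)))"
  using assms
proof (induction B)
  case empty
  interpret product_sigma_finite "\<lambda>_::'a. lborel :: real measure" ..
  show ?case
    by (intro exI[of _ "[[]]"]) (simp add: PiM_empty)
next
  case (insert c B)
  interpret product_sigma_finite "\<lambda>_::'a. lborel :: real measure" ..
  have c: "c \<in> Basis" using insert.prems by simp
  obtain as where as: "set as \<subseteq> lists Basis" "\<And>f x. smooth f \<Longrightarrow> ennreal (cmod (f x)) \<le>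
    (\<Sum>a\<leftarrow>as. \<integral>\<^sup>+t. ennreal (cmod (partial_derivative a f (x - (\<Sum>b\<in>B. t b *\<^sub>R b)))) \<partial>(\<Pi>\<^sub>M b\<in>B. lborel))"
    using insert by auto
  let ?I = "\<lambda>C a f x. \<integral>\<^sup>+t. ennreal (cmod (partial_derivative a f (x - (\<Sum>b\<in>C. t b *\<^sub>R b)))) \<partial>(\<Pi>\<^sub>M b\<in>C. lborel)"
  have step: "?I B a f x \<le> ?I (insert c B) (c # a) f x + ?I (insert c B) a f x"
    if f: "smooth f" and a: "a \<in> lists Basis" for f x a
  proof -
    have ca: "c # a \<in> lists Basis" using c a by simp
    have [measurable]: "partial_derivative a f \<in> borel_measurable borel"
      "partial_derivative (c # a) f \<in> borel_measurable borel"
      by (rule smooth_measurable[OF f a], rule smooth_measurable[OF f ca])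
    have meas: "(\<lambda>t. ennreal (cmod (partial_derivative d f (x - (\<Sum>b\<in>insert c B. t b *\<^sub>R b)))))
        \<in> borel_measurable (\<Pi>\<^sub>M b\<in>insert c B. lborel)"
      if [measurable]: "partial_derivative d f \<in> borel_measurable borel" for d
      by measurable
    have ins: "?I (insert c B) d f x = (\<integral>\<^sup>+t. \<integral>\<^sup>+s. ennreal (cmod (partial_derivative d f
        (x - (\<Sum>b\<in>B. t b *\<^sub>R b) - s *\<^sub>R c))) \<partial>lborel \<partial>(\<Pi>\<^sub>M b\<in>B. lborel))"
      if d: "partial_derivative d f \<in> borel_measurable borel" for d
    proof -
      have *: "(\<Sum>b\<in>insert c B. (t(c := s)) b *\<^sub>R b) = s *\<^sub>R c + (\<Sum>b\<in>B. t b *\<^sub>R b)" for t s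
      proof -
        have "(\<Sum>b\<in>B. (t(c := s)) b *\<^sub>R b) = (\<Sum>b\<in>B. t b *\<^sub>R b)"
          using insert.hyps by (intro sum.cong) auto
        then show ?thesis using insert.hyps by simp
      qed
      show ?thesis
        using product_nn_integral_insert[OF insert.hyps meas[OF d]] unfolding *
        by (simp add: diff_diff_eq add.commute del: partial_derivative.simps)
    qed
    have "?I B a f x \<le> (\<integral>\<^sup>+t.
        (\<integral>\<^sup>+s. ennreal (cmod (partial_derivative (c # a) f (x - (\<Sum>b\<in>B. t b *\<^sub>R b) - s *\<^sub>R c))) \<partial>lborel) +
        (\<integral>\<^sup>+s. ennreal (cmod (partial_derivative a f (x - (\<Sum>b\<in>B. t b *\<^sub>R b) - s *\<^sub>R c))) \<partial>lborel)
        \<partial>(\<Pi>\<^sub>M b\<in>B. lborel))"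
      by (intro nn_integral_mono smooth_line_bound[OF f a c])
    also have "\<dots> = ?I (insert c B) (c # a) f x + ?I (insert c B) a f x"
      unfolding ins[OF \<open>partial_derivative a f \<in> borel_measurable borel\<close>]
        ins[OF \<open>partial_derivative (c # a) f \<in> borel_measurable borel\<close>]
      by (rule nn_integral_add) measurable
    finally show ?thesis .
  qed
  show ?case
  proof (intro exI[of _ "map ((#) c) as @ as"] conjI allI impI)
    show "set (map ((#) c) as @ as) \<subseteq> lists Basis" using as(1) c by fastforce
    fix f :: "'a \<Rightarrow> complex" and x assume f: "smooth f"
    have "ennreal (cmod (f x)) \<le> (\<Sum>a\<leftarrow>as. ?I B a f x)" by (rule as(2)[OF f])
    also have "\<dots> \<le> (\<Sum>a\<leftarrow>as. ?I (insert c B) (c # a) f x + ?I (insert c B) a f x)"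
      using as(1) by (intro sum_list_mono step[OF f]) auto
    also have "\<dots> = (\<Sum>a\<leftarrow>map ((#) c) as @ as. ?I (insert c B) a f x)"
      by (simp add: sum_list_addf comp_def del: partial_derivative.simps)
    finally show "ennreal (cmod (f x)) \<le> (\<Sum>a\<leftarrow>map ((#) c) as @ as. ?I (insert c B) a f x)" .
  qed
qed

lemma sobolev_inequality:
  obtains as :: "'a::euclidean_space list list" where "set as \<subseteq> lists Basis"
    "\<And>f x. f \<in> carrier DL1 \<Longrightarrow> cmod (f x) \<le> (\<Sum>a\<leftarrow>as. l1_norm (partial_derivative a f))"
proof -
  obtain as :: "'a list list" where as: "set as \<subseteq> lists Basis"
    "\<And>f x. smooth f \<Longrightarrow> ennreal (cmod (f x)) \<le> (\<Sum>a\<leftarrow>as. \<integral>\<^sup>+t.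
      ennreal (cmod (partial_derivative a f (x - (\<Sum>b\<in>Basis. t b *\<^sub>R b)))) \<partial>(\<Pi>\<^sub>M b\<in>Basis. lborel))"
    using sobolev_partial[of "Basis :: 'a set"] by auto
  have "cmod (f x) \<le> (\<Sum>a\<leftarrow>as. l1_norm (partial_derivative a f))" if f: "f \<in> carrier DL1" for f x
  proof -
    have 1: "(\<integral>\<^sup>+t. ennreal (cmod (partial_derivative a f (x - (\<Sum>b\<in>Basis. t b *\<^sub>R b)))) \<partial>(\<Pi>\<^sub>M b\<in>Basis. lborel)) =
        ennreal (l1_norm (partial_derivative a f))" if a: "a \<in> set as" for a
    proof -
      have a': "a \<in> lists Basis" using as(1) a by blast
      have [measurable]: "partial_derivative a f \<in> borel_measurable borel"
        by (rule smooth_measurable[OF DL1_smooth[OF f] a'])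
      have "(\<integral>\<^sup>+t. ennreal (cmod (partial_derivative a f (x - (\<Sum>b\<in>Basis. t b *\<^sub>R b)))) \<partial>(\<Pi>\<^sub>M b\<in>Basis. lborel)) =
          (\<integral>\<^sup>+z. ennreal (cmod (partial_derivative a f (x - z))) \<partial>lborel)"
        by (subst lborel_eq[where 'a='a], subst nn_integral_distr) auto
      also have "\<dots> = ennreal (l1_norm (\<lambda>z. partial_derivative a f (x - z)))"
        by (intro nn_integral_l1_norm integrable_lborel_reflect DL1_integrable[OF f a'])
      also have "l1_norm (\<lambda>z. partial_derivative a f (x - z)) = l1_norm (partial_derivative a f)"
        unfolding l1_norm_def by (rule integral_lborel_reflect) simp
      finally show ?thesis .
    qed
    have "ennreal (cmod (f x)) \<le> (\<Sum>a\<leftarrow>as. ennreal (l1_norm (partial_derivative a f)))"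
      using as(2)[OF DL1_smooth[OF f], of x] 1 by (simp cong: map_cong)
    also have "\<dots> = ennreal (\<Sum>a\<leftarrow>as. l1_norm (partial_derivative a f))"
      by (rule sum_list_ennreal) (auto simp: l1_norm_nonneg)
    finally show ?thesis
      by (subst (asm) ennreal_le_iff) (auto intro!: sum_list_nonneg simp: l1_norm_nonneg)
  qed
  with as(1) show thesis by (rule that)
qed

lemma DL1_bounded:
  assumes "f \<in> carrier DL1"
  obtains M where "\<And>x. cmod (f x) \<le> M"
  using sobolev_inequality assms by metis

lemma integrable_mult_bounded:
  fixes f g :: "'a \<Rightarrow> complex"
  assumes "integrable M f" "g \<in> borel_measurable M" "\<And>x. cmod (g x) \<le> C"
  shows "integrable M (\<lambda>x. f x * g x)"
proof (rule Bochner_Integration.integrable_bound)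
  show "integrable M (\<lambda>x. C * cmod (f x))" using assms(1) by auto
  show "AE x in M. norm (f x * g x) \<le> norm (C * cmod (f x))"
  proof (rule AE_I2)
    fix x
    have "cmod (f x) * cmod (g x) \<le> cmod (f x) * C" using assms(3) by (intro mult_left_mono) auto
    then show "norm (f x * g x) \<le> norm (C * cmod (f x))"
      by (simp add: norm_mult abs_mult mult.commute) (smt (verit) assms(3) norm_ge_zero mult_right_mono)
  qed
qed (use assms in auto)

lemma integrable_convolution:
  assumes f: "f \<in> carrier DL1" and g: "g \<in> carrier DL1"
  shows "integrable lborel (\<lambda>s. f s * g (x - s))"
proof -
  obtain C where C: "\<And>x. cmod (g x) \<le> C" using DL1_bounded[OF g] by blast
  have [measurable]: "g \<in> borel_measurable borel"
    using smooth_measurable[OF DL1_smooth[OF g], of "[]"] by simp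
  show ?thesis
    by (rule integrable_mult_bounded[OF _ _ C]) (use DL1_integrable[OF f, of "[]"] in auto)
qed

lemma integration_by_parts_step:
  assumes f: "f \<in> carrier DL1" and g: "g \<in> carrier DL1" and b: "b \<in> Basis"
  shows "(LINT s|lborel. partial_derivative [b] f s * g (x - s)) =
    (LINT s|lborel. f s * partial_derivative [b] g (x - s))"
proof -
  define Df where "Df x h = (\<Sum>b\<in>Basis. (h \<bullet> b) *\<^sub>R partial_derivative [b] f x)" for x h
  define Dg where "Dg x h = (\<Sum>b\<in>Basis. (h \<bullet> b) *\<^sub>R partial_derivative [b] g x)" for x h
  have Df: "(f has_derivative Df x) (at x)" for x
    unfolding Df_def[abs_def] using smooth_has_derivative[OF DL1_smooth[OF f], of "[]"] by simp
  have Dg: "(g has_derivative Dg x) (at x)" for x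
    unfolding Dg_def[abs_def] using smooth_has_derivative[OF DL1_smooth[OF g], of "[]"] by simp
  have Dfb: "Df s b = partial_derivative [b] f s" and Dgb: "Dg s b = partial_derivative [b] g s" for s
    unfolding Df_def Dg_def
    by (rule sum_inner_Basis_scaleR[OF b, of "\<lambda>c. partial_derivative [c] _ s"])+
  have f': "partial_derivative [b] f \<in> carrier DL1" and g': "partial_derivative [b] g \<in> carrier DL1"
    using b by (intro DL1_partial_derivative f g, simp)+
  define D where "D s h = f s * Dg (x - s) (- h) + Df s h * g (x - s)" for s h
  have D: "((\<lambda>s. f s * g (x - s)) has_derivative D s) (at s)" for s
  proof -
    have "((\<lambda>s. g (x - s)) has_derivative (\<lambda>h. Dg (x - s) (- h))) (at s)"
      by (rule has_derivative_compose[where f = "\<lambda>s. x - s" and g = g, OF _ Dg])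
        (auto intro!: derivative_eq_intros)
    from has_derivative_mult[OF Df this] show ?thesis by (simp add: D_def[abs_def])
  qed
  have Db: "D s b = partial_derivative [b] f s * g (x - s) - f s * partial_derivative [b] g (x - s)" for s
  proof -
    have neg: "Dg (x - s) (- b) = - Dg (x - s) b"
      by (rule linear_neg[OF has_derivative_linear[OF Dg]])
    have "u * - v + w * z = w * z - u * v" for u v w z :: complex by simp
    then show ?thesis unfolding D_def neg Dfb Dgb .
  qed
  have cont: "continuous_on UNIV (\<lambda>s. h (x - s))" if "h \<in> carrier DL1" for h :: "'a \<Rightarrow> complex"
    by (rule continuous_on_compose2[of UNIV h])
      (use smooth_continuous[OF DL1_smooth[OF that], of "[]"] in \<open>auto intro!: continuous_intros\<close>)
  have cont': "continuous_on UNIV h" if "h \<in> carrier DL1" for h :: "'a \<Rightarrow> complex"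
    using smooth_continuous[OF DL1_smooth[OF that], of "[]"] by simp
  have "(LINT s|lborel. D s b) = 0"
  proof (rule integral_directional_derivative_eq_0[OF D])
    show "integrable lborel (\<lambda>s. f s * g (x - s))" by (rule integrable_convolution[OF f g])
    show "continuous_on UNIV (\<lambda>s. D s b)"
      unfolding Db by (intro continuous_intros cont cont' f g f' g')
    show "integrable lborel (\<lambda>s. D s b)"
      unfolding Db by (intro Bochner_Integration.integrable_diff integrable_convolution f g f' g')
  qed
  then show ?thesis
    unfolding Db Bochner_Integration.integral_diff[OF integrable_convolution[OF f' g] integrable_convolution[OF f g']]
    by (simp only: right_minus_eq)
qed

text \<open>The outermost derivative is the first to be moved and becomes the innermost one; this reverses the
  word.\<close>

lemma integration_by_parts:
  assumes f: "f \<in> carrier DL1" and "g \<in> carrier DL1" and "bs \<in> lists Basis"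
  shows "(LINT s|lborel. partial_derivative bs f s * g (x - s)) =
    (LINT s|lborel. f s * partial_derivative (rev bs) g (x - s))"
  using assms(2,3)
proof (induction bs arbitrary: g)
  case (Cons b bs)
  have bs: "bs \<in> lists Basis" and b: "b \<in> Basis" using Cons.prems by auto
  have "(LINT s|lborel. partial_derivative (b # bs) f s * g (x - s)) =
      (LINT s|lborel. partial_derivative bs f s * partial_derivative [b] g (x - s))"
    using integration_by_parts_step[OF DL1_partial_derivative[OF f bs] Cons.prems(1) b] by simp
  also have "\<dots> = (LINT s|lborel. f s * partial_derivative (rev bs) (partial_derivative [b] g) (x - s))"
    using b by (intro Cons.IH bs DL1_partial_derivative Cons.prems) auto
  finally show ?case by (simp add: partial_derivative_append del: partial_derivative.simps)
qed simp

section \<open>Completeness\<close>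

text \<open>Given countably many seminorms, a Cauchy filter admits a Cauchy sequence with \<open>f n\<close> chosen in the
  first \<open>n\<close> of a sequence of sets of the filter on which the seminorms vary little. The limit of the
  sequence is a limit of the filter.\<close>

lemma (in function_lcs) cauchy_filter_converges:
  assumes count: "countable (seminorms X)" and ne: "seminorms X \<noteq> {}"
    and seq: "\<And>f. (\<And>n::nat. f n \<in> carrier X) \<Longrightarrow>
      (\<And>p e. p \<in> seminorms X \<Longrightarrow> 0 < e \<Longrightarrow> \<exists>N. \<forall>m\<ge>N. \<forall>n\<ge>N. p (\<lambda>i. f m i - f n i) < e) \<Longrightarrow>
      \<exists>z\<in>carrier X. \<forall>p\<in>seminorms X. (\<lambda>n. p (\<lambda>i. f n i - z i)) \<longlonglongrightarrow> 0"
    and F: "lcs_cauchy_filter X F"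
  shows "\<exists>z\<in>carrier X. converges_in X F z"
proof -
  have nb: "F \<noteq> bot" and Fc: "\<forall>\<^sub>F x in F. x \<in> carrier X" and as: "asymptotic X F F"
    using F by (auto simp: lcs_cauchy_filter_def)
  define s where "s = from_nat_into (seminorms X)"
  have s: "s k \<in> seminorms X" for k unfolding s_def using ne by (rule from_nat_into)
  have s_ex: "\<exists>k. s k = p" if "p \<in> seminorms X" for p
    unfolding s_def using from_nat_into_surj[OF count that] by blast
  have "\<exists>P. eventually P F \<and> (\<forall>x y. P x \<and> P y \<longrightarrow> x \<in> carrier X \<and> (\<forall>k\<le>n. s k (\<lambda>i. x i - y i) < 1 / Suc n))"
    for n
  proof -
    have "\<forall>\<^sub>F u in F \<times>\<^sub>F F. \<forall>k\<in>{..n}. (case u of (x, y) \<Rightarrow> s k (vdiff X x y)) < 1 / Suc n"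
    proof (rule eventually_ball_finite)
      show "\<forall>k\<in>{..n}. \<forall>\<^sub>F u in F \<times>\<^sub>F F. (case u of (x, y) \<Rightarrow> s k (vdiff X x y)) < 1 / Suc n"
      proof
        fix k
        have "((\<lambda>(x, y). s k (vdiff X x y)) \<longlongrightarrow> 0) (F \<times>\<^sub>F F)"
          using as s unfolding asymptotic_def by blast
        then show "\<forall>\<^sub>F u in F \<times>\<^sub>F F. (case u of (x, y) \<Rightarrow> s k (vdiff X x y)) < 1 / Suc n"
          by (rule order_tendstoD) simp
      qed
    qed simp
    then obtain P Q where PQ: "eventually P F" "eventually Q F"
      "\<And>x y k. P x \<Longrightarrow> Q y \<Longrightarrow> k \<le> n \<Longrightarrow> s k (\<lambda>i. x i - y i) < 1 / Suc n"
      unfolding eventually_prod_filter by auto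
    show ?thesis
      using PQ Fc by (intro exI[of _ "\<lambda>x. P x \<and> Q x \<and> x \<in> carrier X"]) (auto intro: eventually_conj)
  qed
  then obtain P where P: "\<And>n. eventually (P n) F" "\<And>n x. P n x \<Longrightarrow> x \<in> carrier X"
    "\<And>n x y k. P n x \<Longrightarrow> P n y \<Longrightarrow> k \<le> n \<Longrightarrow> s k (\<lambda>i. x i - y i) < 1 / Suc n"
    by metis
  have "\<exists>x. \<forall>k\<in>{..n}. P k x" for n
  proof -
    have "\<forall>\<^sub>F x in F. \<forall>k\<in>{..n}. P k x"
      by (rule eventually_ball_finite) (use P(1) in auto)
    then show ?thesis using nb eventually_happens' by blast
  qed
  then obtain f where f: "\<And>n k. k \<le> n \<Longrightarrow> P k (f n)" by (metis atMost_iff)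
  have fc: "f n \<in> carrier X" for n using f P(2) by blast
  have small: "\<exists>N\<ge>k. 1 / Suc N < e" if "0 < e" for k and e :: real
  proof -
    obtain N where "1 / Suc N < e" using nat_approx_posE[OF \<open>0 < e\<close>] by blast
    then have "1 / real (Suc (max N k)) < e"
      by (rule order.strict_trans1[rotated]) (simp add: frac_le)
    then show ?thesis by (intro exI[of _ "max N k"]) auto
  qed
  have "\<exists>N. \<forall>m\<ge>N. \<forall>n\<ge>N. p (\<lambda>i. f m i - f n i) < e" if p: "p \<in> seminorms X" and e: "0 < e" for p e
  proof -
    obtain k where k: "p = s k" using s_ex[OF p] by blast
    obtain N where N: "N \<ge> k" "1 / Suc N < e" using small[OF e] by blast
    have "p (\<lambda>i. f m i - f n i) < e" if "m \<ge> N" "n \<ge> N" for m n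
      using P(3)[OF f[OF that(1)] f[OF that(2)] N(1)] N(2) k by simp
    then show ?thesis by blast
  qed
  from seq[of f, OF fc this] obtain z where z: "z \<in> carrier X"
    and lim: "\<And>p. p \<in> seminorms X \<Longrightarrow> (\<lambda>n. p (\<lambda>i. f n i - z i)) \<longlonglongrightarrow> 0" by blast
  have "((\<lambda>x. p (vdiff X x z)) \<longlongrightarrow> 0) F" if p: "p \<in> seminorms X" for p
  proof (rule tendstoI)
    fix e :: real assume e: "0 < e"
    have sp: "is_seminorm X p" using p by (rule seminorms_are_seminorms)
    obtain k where k: "p = s k" using s_ex[OF p] by blast
    obtain N where N: "N \<ge> k" "1 / Suc N < e / 2" using small[of "e / 2" k] e by auto
    have "\<forall>\<^sub>F n in sequentially. n \<ge> N \<and> p (\<lambda>i. f n i - z i) < e / 2"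
      using eventually_conj[OF eventually_ge_at_top order_tendstoD(2)[OF lim[OF p], of "e / 2"]] e by simp
    then obtain n where n: "n \<ge> N" "p (\<lambda>i. f n i - z i) < e / 2"
      using eventually_happens' sequentially_bot by blast
    show "\<forall>\<^sub>F x in F. dist (p (vdiff X x z)) 0 < e"
      using P(1)[of N]
    proof eventually_elim
      case (elim x)
      have "p (\<lambda>i. x i - f n i) < e / 2"
        using P(3)[OF elim f[OF n(1)] N(1)] N(2) k by simp
      then show ?case
        using seminorm_triangle[OF sp P(2)[OF elim] fc z, of n] n(2)
          seminorm_nonneg[OF sp diff_closed[OF P(2)[OF elim] z]] by simp
    qed
  qed
  then show ?thesis using z by (auto simp: converges_in_def)
qed

text \<open>The Sobolev inequality bounds the values of \<open>f\<close> by seminorms of \<open>f\<close>.\<close>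

lemma DL1_hausdorff:
  assumes "f \<in> carrier DL1" "\<And>q. q \<in> seminorms DL1 \<Longrightarrow> q f = 0"
  shows "f = (\<lambda>x. 0)"
proof
  fix x
  obtain as :: "'a list list" where as: "set as \<subseteq> lists Basis"
    "\<And>f x. f \<in> carrier DL1 \<Longrightarrow> cmod (f x) \<le> (\<Sum>a\<leftarrow>as. l1_norm (partial_derivative a f))"
    by (rule sobolev_inequality) blast
  have "l1_norm (partial_derivative a f) = 0" if "a \<in> set as" for a
    using assms(2)[of "\<lambda>f. l1_norm (partial_derivative a f)"] as(1) that by (auto simp: DL1_seminorms)
  then have "map (\<lambda>a. l1_norm (partial_derivative a f)) as = map (\<lambda>a. 0) as" by simp
  then have "(\<Sum>a\<leftarrow>as. l1_norm (partial_derivative a f)) = 0" by (simp only: sum_list_0)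
  then show "f x = 0" using as(2)[OF assms(1), of x] by simp
qed

text \<open>Fatou's lemma replaces the completeness of \<open>L\<^sup>1\<close>, since the pointwise limit is already known.\<close>

lemma l1_norm_limit:
  fixes g :: "nat \<Rightarrow> 'a::euclidean_space \<Rightarrow> complex"
  assumes g: "\<And>n. integrable lborel (g n)" and lim: "\<And>x. (\<lambda>n. g n x) \<longlonglongrightarrow> h x"
    and h: "h \<in> borel_measurable borel"
    and cauchy: "\<And>e. 0 < e \<Longrightarrow> \<exists>N. \<forall>m\<ge>N. \<forall>n\<ge>N. l1_norm (\<lambda>x. g m x - g n x) < e"
  shows "integrable lborel h" "(\<lambda>n. l1_norm (\<lambda>x. g n x - h x)) \<longlonglongrightarrow> 0"
proof -
  have [measurable]: "g n \<in> borel_measurable borel" "h \<in> borel_measurable borel" for n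
    using g h by auto
  have bound: "\<exists>N. \<forall>n\<ge>N. integrable lborel (\<lambda>x. g n x - h x) \<and> l1_norm (\<lambda>x. g n x - h x) \<le> e"
    if e: "0 < e" for e
  proof -
    obtain N where N: "\<And>m n. m \<ge> N \<Longrightarrow> n \<ge> N \<Longrightarrow> l1_norm (\<lambda>x. g m x - g n x) < e"
      using cauchy[OF e] by blast
    have "(\<integral>\<^sup>+x. ennreal (cmod (g n x - h x)) \<partial>lborel) \<le> ennreal e" if n: "n \<ge> N" for n
    proof -
      have "(\<lambda>m. ennreal (cmod (g n x - g m x))) \<longlonglongrightarrow> ennreal (cmod (g n x - h x))" for x
        using lim[of x] by (intro tendsto_intros)
      then have "liminf (\<lambda>m. ennreal (cmod (g n x - g m x))) = ennreal (cmod (g n x - h x))" for x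
        by (intro lim_imp_Liminf) auto
      then have "(\<integral>\<^sup>+x. ennreal (cmod (g n x - h x)) \<partial>lborel) =
          (\<integral>\<^sup>+x. liminf (\<lambda>m. ennreal (cmod (g n x - g m x))) \<partial>lborel)" by simp
      also have "\<dots> \<le> liminf (\<lambda>m. \<integral>\<^sup>+x. ennreal (cmod (g n x - g m x)) \<partial>lborel)"
        by (rule nn_integral_liminf) simp
      also have "\<dots> \<le> ennreal e"
      proof (rule Liminf_le)
        show "\<forall>\<^sub>F m in sequentially. (\<integral>\<^sup>+x. ennreal (cmod (g n x - g m x)) \<partial>lborel) \<le> ennreal e"
          using eventually_ge_at_top[of N]
        proof eventually_elim
          case (elim m)
          have "integrable lborel (\<lambda>x. g n x - g m x)" using g by auto
          then show ?case
            using N[OF n elim] by (simp add: nn_integral_l1_norm ennreal_leI)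
        qed
      qed simp
      finally show ?thesis .
    qed
    then show ?thesis
      using e by (intro exI[of _ N] allI impI conjI l1_norm_boundI[where c = e]) auto
  qed
  obtain n where "integrable lborel (\<lambda>x. g n x - h x)" using bound[of 1] by auto
  from Bochner_Integration.integrable_diff[OF g this, of n] show "integrable lborel h" by simp
  show "(\<lambda>n. l1_norm (\<lambda>x. g n x - h x)) \<longlonglongrightarrow> 0"
  proof (rule LIMSEQ_I)
    fix r :: real assume r: "0 < r"
    obtain N where "\<And>n. n \<ge> N \<Longrightarrow> l1_norm (\<lambda>x. g n x - h x) \<le> r / 2"
      using bound[of "r / 2"] r by auto
    then show "\<exists>no. \<forall>n\<ge>no. norm (l1_norm (\<lambda>x. g n x - h x) - 0) < r"
      using r by (intro exI[of _ N]) (force simp: l1_norm_nonneg)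
  qed
qed

lemma derivative_family_limit:
  fixes J :: "nat \<Rightarrow> 'a::euclidean_space list \<Rightarrow> 'a \<Rightarrow> complex"
  assumes J: "\<And>n. derivative_family (J n)"
    and lim: "\<And>bs. bs \<in> lists Basis \<Longrightarrow> uniform_limit UNIV (\<lambda>n. J n bs) (K bs) sequentially"
  shows "derivative_family K"
  unfolding derivative_family_def
proof (intro ballI allI)
  fix bs and x :: 'a assume bs: "bs \<in> lists (Basis :: 'a set)"
  have ptw: "(\<lambda>n. J n bs y) \<longlonglongrightarrow> K bs y" for y
    using tendsto_uniform_limitI[OF lim[OF bs]] by simp
  have "\<exists>g. \<forall>x\<in>UNIV. (\<lambda>n. J n bs x) \<longlonglongrightarrow> g x \<and>
      (g has_derivative (\<lambda>h. \<Sum>b\<in>Basis. (h \<bullet> b) *\<^sub>R K (b # bs) x)) (at x within UNIV)"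
  proof (rule has_derivative_sequence)
    fix n and y :: 'a
    show "(J n bs has_derivative (\<lambda>h. \<Sum>b\<in>Basis. (h \<bullet> b) *\<^sub>R J n (b # bs) y)) (at y within UNIV)"
      using derivative_familyD[OF J bs] by simp
  next
    fix e :: real assume e: "0 < e"
    define d where "d = e / DIM('a)"
    have d: "0 < d" using e by (simp add: d_def)
    have "\<forall>\<^sub>F n in sequentially. \<forall>b\<in>Basis. \<forall>y. dist (J n (b # bs) y) (K (b # bs) y) < d"
    proof (rule eventually_ball_finite)
      show "\<forall>b\<in>Basis. \<forall>\<^sub>F n in sequentially. \<forall>y. dist (J n (b # bs) y) (K (b # bs) y) < d"
        using lim bs d unfolding uniform_limit_iff by simp
    qed simp
    then show "\<forall>\<^sub>F n in sequentially. \<forall>y\<in>UNIV. \<forall>h.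
      norm ((\<Sum>b\<in>Basis. (h \<bullet> b) *\<^sub>R J n (b # bs) y) - (\<Sum>b\<in>Basis. (h \<bullet> b) *\<^sub>R K (b # bs) y)) \<le> e * norm h"
    proof (eventually_elim, intro ballI allI)
      fix n and y h :: 'a
      assume *: "\<forall>b\<in>Basis. \<forall>y. dist (J n (b # bs) y) (K (b # bs) y) < d"
      have "(\<Sum>b\<in>Basis. (h \<bullet> b) *\<^sub>R J n (b # bs) y) - (\<Sum>b\<in>Basis. (h \<bullet> b) *\<^sub>R K (b # bs) y) =
          (\<Sum>b\<in>Basis. (h \<bullet> b) *\<^sub>R (J n (b # bs) y - K (b # bs) y))"
        by (simp add: sum_subtractf scaleR_diff_right)
      also have "norm \<dots> \<le> (\<Sum>b\<in>(Basis :: 'a set). norm h * d)"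
      proof (rule sum_norm_le)
        fix b :: 'a assume b: "b \<in> Basis"
        have "\<bar>h \<bullet> b\<bar> * cmod (J n (b # bs) y - K (b # bs) y) \<le> norm h * d"
          using * b Basis_le_norm[OF b, of h] by (intro mult_mono) (auto simp: dist_norm less_imp_le)
        then show "norm ((h \<bullet> b) *\<^sub>R (J n (b # bs) y - K (b # bs) y)) \<le> norm h * d" by simp
      qed
      also have "\<dots> = e * norm h" by (simp add: d_def)
      finally show "norm ((\<Sum>b\<in>Basis. (h \<bullet> b) *\<^sub>R J n (b # bs) y) -
        (\<Sum>b\<in>Basis. (h \<bullet> b) *\<^sub>R K (b # bs) y)) \<le> e * norm h" .
    qed
  next
    show "(\<lambda>n. J n bs x) \<longlonglongrightarrow> K bs x" by (rule ptw)
  qed auto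
  then obtain g where g: "\<And>y. (\<lambda>n. J n bs y) \<longlonglongrightarrow> g y"
    "\<And>y. (g has_derivative (\<lambda>h. \<Sum>b\<in>Basis. (h \<bullet> b) *\<^sub>R K (b # bs) y)) (at y)" by auto
  have "g = K bs" using LIMSEQ_unique[OF g(1) ptw] by blast
  with g(2)[of x] show "(K bs has_derivative (\<lambda>h. \<Sum>b\<in>Basis. (h \<bullet> b) *\<^sub>R K (b # bs) x)) (at x)"
    by simp
qed

text \<open>By the Sobolev inequality, Cauchy sequences of \<open>DL1\<close> converge uniformly with all their derivatives.
  The limits of the derivatives form a derivative family, and they are limits in \<open>L\<^sup>1\<close> as well.\<close>

lemma DL1_sequentially_complete:
  fixes f :: "nat \<Rightarrow> 'a::euclidean_space \<Rightarrow> complex"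
  assumes f: "\<And>n. f n \<in> carrier DL1"
    and cauchy: "\<And>bs e. bs \<in> lists Basis \<Longrightarrow> 0 < e \<Longrightarrow>
      \<exists>N. \<forall>m\<ge>N. \<forall>n\<ge>N. l1_norm (partial_derivative bs (\<lambda>x. f m x - f n x)) < e"
  shows "\<exists>z\<in>carrier DL1. \<forall>bs\<in>lists Basis. (\<lambda>n. l1_norm (partial_derivative bs (\<lambda>x. f n x - z x))) \<longlonglongrightarrow> 0"
proof -
  let ?J = "\<lambda>n bs. partial_derivative bs (f n)"
  obtain as :: "'a list list" where as: "set as \<subseteq> lists Basis"
    "\<And>f x. f \<in> carrier DL1 \<Longrightarrow> cmod (f x) \<le> (\<Sum>a\<leftarrow>as. l1_norm (partial_derivative a f))"
    by (rule sobolev_inequality) blast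
  have "uniformly_Cauchy_on UNIV (\<lambda>n. ?J n bs)" if bs: "bs \<in> lists Basis" for bs
  proof (rule uniformly_Cauchy_onI)
    fix e :: real assume e: "0 < e"
    define d where "d = e / (length as + 1)"
    have d: "0 < d" using e by (simp add: d_def)
    have "\<forall>\<^sub>F N in sequentially. \<forall>a\<in>set as. \<forall>m\<ge>N. \<forall>n\<ge>N.
        l1_norm (partial_derivative (a @ bs) (\<lambda>x. f m x - f n x)) < d"
    proof (rule eventually_ball_finite)
      show "\<forall>a\<in>set as. \<forall>\<^sub>F N in sequentially. \<forall>m\<ge>N. \<forall>n\<ge>N.
          l1_norm (partial_derivative (a @ bs) (\<lambda>x. f m x - f n x)) < d"
      proof
        fix a assume "a \<in> set as"
        then have "a @ bs \<in> lists Basis" using as(1) bs by auto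
        from cauchy[OF this d] show "\<forall>\<^sub>F N in sequentially. \<forall>m\<ge>N. \<forall>n\<ge>N.
          l1_norm (partial_derivative (a @ bs) (\<lambda>x. f m x - f n x)) < d"
          unfolding eventually_sequentially by (meson order.trans)
      qed
    qed simp
    then obtain N where N: "\<And>a m n. a \<in> set as \<Longrightarrow> m \<ge> N \<Longrightarrow> n \<ge> N \<Longrightarrow>
        l1_norm (partial_derivative (a @ bs) (\<lambda>x. f m x - f n x)) < d"
      unfolding eventually_sequentially by blast
    have "dist (?J m bs x) (?J n bs x) < e" if "m \<ge> N" "n \<ge> N" for m n x
    proof -
      have "cmod (partial_derivative bs (\<lambda>x. f m x - f n x) x) \<le>
          (\<Sum>a\<leftarrow>as. l1_norm (partial_derivative (a @ bs) (\<lambda>x. f m x - f n x)))"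
        using as(2)[OF DL1_partial_derivative[OF DL1.diff_closed[OF f f] bs], of m n x]
        by (simp add: partial_derivative_append)
      also have "\<dots> \<le> (\<Sum>a\<leftarrow>as. d)"
        using N that by (intro sum_list_mono) (simp add: less_imp_le)
      also have "\<dots> < e" using e by (simp add: d_def sum_list_triv field_simps)
      finally show ?thesis by (simp add: DL1_diff[OF f f bs] dist_norm)
    qed
    then show "\<exists>M. \<forall>x\<in>UNIV. \<forall>m\<ge>M. \<forall>n\<ge>M. dist (?J m bs x) (?J n bs x) < e" by blast
  qed
  then have "\<forall>bs\<in>lists Basis. \<exists>l. uniform_limit UNIV (\<lambda>n. ?J n bs) l sequentially"
    using Cauchy_uniformly_convergent unfolding uniformly_convergent_on_def by blast
  then obtain K where K: "\<And>bs. bs \<in> lists Basis \<Longrightarrow> uniform_limit UNIV (\<lambda>n. ?J n bs) (K bs) sequentially"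
    by metis
  have Kf: "derivative_family K"
    by (rule derivative_family_limit[of ?J, OF DL1_family[OF f] K])
  have l1: "integrable lborel (K bs)" "(\<lambda>n. l1_norm (\<lambda>x. ?J n bs x - K bs x)) \<longlonglongrightarrow> 0"
    if bs: "bs \<in> lists Basis" for bs
  proof -
    have lim: "(\<lambda>n. ?J n bs x) \<longlonglongrightarrow> K bs x" for x
      using tendsto_uniform_limitI[OF K[OF bs]] by simp
    have Km: "K bs \<in> borel_measurable borel"
      by (rule borel_measurable_continuous_onI[OF derivative_family_continuous[OF Kf bs]])
    have "\<exists>N. \<forall>m\<ge>N. \<forall>n\<ge>N. l1_norm (\<lambda>x. ?J m bs x - ?J n bs x) < e" if "0 < e" for e
      using cauchy[OF bs that] by (simp add: DL1_diff[OF f f bs])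
    from l1_norm_limit[of "\<lambda>n. ?J n bs", OF DL1_integrable[OF f bs] lim Km this]
    show "integrable lborel (K bs)" "(\<lambda>n. l1_norm (\<lambda>x. ?J n bs x - K bs x)) \<longlonglongrightarrow> 0" by auto
  qed
  have z: "K [] \<in> carrier DL1" by (rule DL1_I[OF Kf l1(1)])
  then show ?thesis
    using l1(2) by (intro bexI[of _ "K []"]) (simp_all add: DL1_diff[OF f z] partial_derivative_family[OF Kf])
qed

lemma DL1_complete:
  fixes F :: "('a::euclidean_space \<Rightarrow> complex) filter"
  assumes "lcs_cauchy_filter DL1 F"
  shows "\<exists>z\<in>carrier DL1. converges_in DL1 F z"
proof (rule DL1.cauchy_filter_converges[OF _ _ _ assms])
  show "countable (seminorms (DL1 :: ('a \<Rightarrow> complex) lcs))"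
    unfolding DL1_seminorms by (intro countable_image countable_lists countable_finite) simp
  show "seminorms (DL1 :: ('a \<Rightarrow> complex) lcs) \<noteq> {}" by (auto simp: DL1_seminorms)
  fix f :: "nat \<Rightarrow> 'a \<Rightarrow> complex"
  assume f: "\<And>n. f n \<in> carrier DL1"
    and c: "\<And>p e. p \<in> seminorms DL1 \<Longrightarrow> 0 < e \<Longrightarrow> \<exists>N. \<forall>m\<ge>N. \<forall>n\<ge>N. p (\<lambda>i. f m i - f n i) < e"
  have "\<exists>N. \<forall>m\<ge>N. \<forall>n\<ge>N. l1_norm (partial_derivative bs (\<lambda>x. f m x - f n x)) < e"
    if "bs \<in> lists Basis" "0 < e" for bs e
    using c[of "\<lambda>f. l1_norm (partial_derivative bs f)" e] that unfolding DL1_seminorms by blast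
  from DL1_sequentially_complete[of f, OF f this]
  show "\<exists>z\<in>carrier DL1. \<forall>p\<in>seminorms DL1. (\<lambda>n. p (\<lambda>i. f n i - z i)) \<longlonglongrightarrow> 0"
    unfolding DL1_seminorms by blast
qed

section \<open>Gaussian mollifiers\<close>

text \<open>The polynomial factor of the \<open>k\<close>-th derivative of the normal density with standard deviation \<open>e\<close>: up
  to sign and scaling, a Hermite polynomial.\<close>

primrec hermite_poly :: "real \<Rightarrow> nat \<Rightarrow> real poly" where
  "hermite_poly e 0 = 1"
| "hermite_poly e (Suc k) = pderiv (hermite_poly e k) - smult (1 / e\<^sup>2) (pCons 0 (hermite_poly e k))"

definition normal_derivative :: "real \<Rightarrow> nat \<Rightarrow> real \<Rightarrow> real" where
  "normal_derivative e k t = poly (hermite_poly e k) t * normal_density 0 e t"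

lemma normal_derivative_0: "normal_derivative e 0 t = normal_density 0 e t"
  by (simp add: normal_derivative_def)

lemma DERIV_normal_derivative:
  assumes "0 < e"
  shows "(normal_derivative e k has_real_derivative normal_derivative e (Suc k) t) (at t)"
proof -
  have "((\<lambda>t. normal_density 0 e t) has_real_derivative - (t / e\<^sup>2) * normal_density 0 e t) (at t)"
    unfolding normal_density_def using assms
    by (auto intro!: derivative_eq_intros simp: field_simps power2_eq_square)
  from DERIV_mult[OF poly_DERIV this, of "hermite_poly e k"] show ?thesis
    by (simp add: normal_derivative_def[abs_def] algebra_simps)
qed

lemma integrable_normal_derivative:
  assumes "0 < e"
  shows "integrable lborel (normal_derivative e k)"
proof -
  have "integrable lborel (\<lambda>t. \<Sum>i\<le>degree (hermite_poly e k).
      coeff (hermite_poly e k) i * (normal_density 0 e t * (t - 0) ^ i))"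
    using assms by (intro Bochner_Integration.integrable_sum integrable_mult_right integrable_normal_moment)
  also have "(\<lambda>t. \<Sum>i\<le>degree (hermite_poly e k).
      coeff (hermite_poly e k) i * (normal_density 0 e t * (t - 0) ^ i)) = normal_derivative e k"
    unfolding normal_derivative_def[abs_def] poly_altdef sum_distrib_right
    by (intro ext sum.cong) auto
  finally show ?thesis .
qed

lemma measurable_normal_derivative [measurable]: "normal_derivative e k \<in> borel_measurable borel"
  unfolding normal_derivative_def[abs_def]
  by (intro borel_measurable_times borel_measurable_normal_density
      borel_measurable_continuous_onI[of "poly (hermite_poly e k)"] continuous_intros)

text \<open>The mollifier of width \<open>e\<close>. It is a product over the coordinates, so that its derivatives and its
  integrals reduce to one variable.\<close>

definition gaussian :: "real \<Rightarrow> 'a::euclidean_space \<Rightarrow> complex" where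
  "gaussian e x = of_real (\<Prod>b\<in>Basis. normal_density 0 e (x \<bullet> b))"

lemma gaussian_measurable [measurable]: "gaussian e \<in> borel_measurable borel"
  unfolding gaussian_def[abs_def] by measurable

lemma gaussian_derivative_family:
  assumes e: "0 < e"
  shows "derivative_family (\<lambda>bs x :: 'a::euclidean_space.
    complex_of_real (\<Prod>b\<in>Basis. normal_derivative e (count_list bs b) (x \<bullet> b)))"
  unfolding derivative_family_def
proof (intro ballI allI)
  fix bs and x :: 'a
  let ?N = "\<lambda>b k. normal_derivative e k (x \<bullet> b)"
  have "((\<lambda>x :: 'a. \<Prod>b\<in>Basis. normal_derivative e (count_list bs b) (x \<bullet> b)) has_derivative
      (\<lambda>h. \<Sum>b\<in>Basis. ((h \<bullet> b) * ?N b (Suc (count_list bs b))) *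
        (\<Prod>c\<in>Basis - {b}. ?N c (count_list bs c)))) (at x)"
  proof (rule has_derivative_prod)
    fix b :: 'a
    have "((\<lambda>x. x \<bullet> b) has_derivative (\<lambda>h. h \<bullet> b)) (at x)" by (auto intro!: derivative_eq_intros)
    from has_derivative_compose[OF this DERIV_normal_derivative[OF e, unfolded has_field_derivative_def]]
    show "((\<lambda>x. normal_derivative e (count_list bs b) (x \<bullet> b)) has_derivative
        (\<lambda>h. (h \<bullet> b) * ?N b (Suc (count_list bs b)))) (at x)"
      by (simp add: mult.commute)
  qed
  then have "((\<lambda>x :: 'a. complex_of_real (\<Prod>b\<in>Basis. normal_derivative e (count_list bs b) (x \<bullet> b))) has_derivative
      (\<lambda>h. complex_of_real (\<Sum>b\<in>Basis. ((h \<bullet> b) * ?N b (Suc (count_list bs b))) *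
        (\<Prod>c\<in>Basis - {b}. ?N c (count_list bs c))))) (at x)"
    by (rule has_derivative_of_real)
  moreover have "(\<Prod>c\<in>Basis. ?N c (count_list (b # bs) c)) =
      ?N b (Suc (count_list bs b)) * (\<Prod>c\<in>Basis - {b}. ?N c (count_list bs c))" if "b \<in> Basis" for b
  proof -
    have "(\<Prod>c\<in>Basis - {b}. ?N c (count_list (b # bs) c)) = (\<Prod>c\<in>Basis - {b}. ?N c (count_list bs c))"
      by (intro prod.cong) auto
    then show ?thesis using prod.remove[OF finite_Basis that, of "\<lambda>c. ?N c (count_list (b # bs) c)"] by simp
  qed
  ultimately show "((\<lambda>x. complex_of_real (\<Prod>b\<in>Basis. normal_derivative e (count_list bs b) (x \<bullet> b))) has_derivative
      (\<lambda>h. \<Sum>b\<in>Basis. (h \<bullet> b) *\<^sub>R complex_of_real (\<Prod>c\<in>Basis. ?N c (count_list (b # bs) c)))) (at x)"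
    by (simp add: scaleR_conv_of_real mult.assoc del: count_list.simps of_real_prod cong: sum.cong)
qed

lemma integrable_gaussian_derivatives:
  fixes k :: "'a::euclidean_space \<Rightarrow> nat"
  assumes e: "0 < e"
  shows "integrable lborel (\<lambda>x :: 'a. complex_of_real (\<Prod>b\<in>Basis. normal_derivative e (k b) (x \<bullet> b)))"
proof (rule integrableI_bounded)
  have "(\<integral>\<^sup>+x. ennreal (norm (complex_of_real (\<Prod>b\<in>Basis. normal_derivative e (k b) (x \<bullet> b)))) \<partial>(lborel :: 'a measure)) =
      (\<integral>\<^sup>+x. (\<Prod>b\<in>Basis. ennreal \<bar>normal_derivative e (k b) (x \<bullet> b)\<bar>) \<partial>(lborel :: 'a measure))"
    by (simp add: abs_prod prod_ennreal del: of_real_prod)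
  also have "\<dots> = (\<Prod>b\<in>(Basis :: 'a set). \<integral>\<^sup>+t. ennreal \<bar>normal_derivative e (k b) t\<bar> \<partial>lborel)"
    by (rule nn_integral_lborel_prod) auto
  also have "\<dots> = (\<Prod>b\<in>(Basis :: 'a set). ennreal (LINT t|lborel. \<bar>normal_derivative e (k b) t\<bar>))"
    using integrable_normal_derivative[OF e] by (intro prod.cong refl nn_integral_eq_integral) auto
  also have "\<dots> < \<infinity>" by (subst prod_ennreal) auto
  finally show "(\<integral>\<^sup>+x. ennreal (norm (complex_of_real (\<Prod>b\<in>Basis. normal_derivative e (k b) (x \<bullet> b)))) \<partial>(lborel :: 'a measure)) < \<infinity>" .
qed measurable

lemma gaussian_DL1:
  assumes "0 < e"
  shows "gaussian e \<in> carrier (DL1 :: ('a::euclidean_space \<Rightarrow> complex) lcs)"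
  using DL1_I[OF gaussian_derivative_family[OF assms] integrable_gaussian_derivatives[OF assms], where 'a='a]
  by (simp add: gaussian_def[abs_def] normal_derivative_0 del: of_real_prod)

text \<open>The derivatives of the Gaussian depend only on the number of occurrences of each direction. This
  makes up for the reversal of words in integrations by parts.\<close>

lemma gaussian_derivative_rev:
  fixes bs :: "'a::euclidean_space list"
  assumes "0 < e" "bs \<in> lists Basis"
  shows "partial_derivative (rev bs) (gaussian e) = partial_derivative bs (gaussian e)"
proof -
  have eq: "gaussian e = (\<lambda>x :: 'a. complex_of_real (\<Prod>b\<in>Basis. normal_derivative e (count_list [] b) (x \<bullet> b)))"
    by (simp add: gaussian_def[abs_def] normal_derivative_0)
  have "rev bs \<in> lists Basis" using assms(2) by auto
  then show ?thesis
    using partial_derivative_family[OF gaussian_derivative_family[OF assms(1)], of bs] assms(2)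
      partial_derivative_family[OF gaussian_derivative_family[OF assms(1)], of "rev bs"]
    unfolding eq by (simp add: count_list_rev)
qed

lemma norm_gaussian: "cmod (gaussian e x) = (\<Prod>b\<in>Basis. normal_density 0 e (x \<bullet> b))"
  by (simp add: gaussian_def prod_nonneg del: of_real_prod)

lemma nn_integral_gaussian_moment:
  fixes b :: "'a::euclidean_space"
  assumes e: "0 < e" and b: "b \<in> Basis"
  shows "(\<integral>\<^sup>+x. ennreal (\<bar>x \<bullet> b\<bar> * cmod (gaussian e x)) \<partial>lborel) = ennreal (e * sqrt (2 / pi))"
proof -
  let ?w = "\<lambda>c t. if c = b then ennreal (\<bar>t\<bar> * normal_density 0 e t) else ennreal (normal_density 0 e t)"
  have "ennreal (\<bar>x \<bullet> b\<bar> * cmod (gaussian e x)) = (\<Prod>c\<in>Basis. ?w c (x \<bullet> c))" for x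
  proof -
    have "(\<Prod>c\<in>Basis. ?w c (x \<bullet> c)) = ?w b (x \<bullet> b) * (\<Prod>c\<in>Basis - {b}. ?w c (x \<bullet> c))"
      using b by (intro prod.remove) auto
    also have "(\<Prod>c\<in>Basis - {b}. ?w c (x \<bullet> c)) = ennreal (\<Prod>c\<in>Basis - {b}. normal_density 0 e (x \<bullet> c))"
      by (subst prod_ennreal[symmetric]) (auto intro!: prod.cong)
    also have "?w b (x \<bullet> b) * ennreal (\<Prod>c\<in>Basis - {b}. normal_density 0 e (x \<bullet> c)) =
        ennreal (\<bar>x \<bullet> b\<bar> * (normal_density 0 e (x \<bullet> b) * (\<Prod>c\<in>Basis - {b}. normal_density 0 e (x \<bullet> c))))"
      by (simp add: ennreal_mult' mult.assoc prod_nonneg)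
    also have "normal_density 0 e (x \<bullet> b) * (\<Prod>c\<in>Basis - {b}. normal_density 0 e (x \<bullet> c)) = cmod (gaussian e x)"
      unfolding norm_gaussian using b by (subst prod.remove[of Basis b]) auto
    finally show ?thesis by simp
  qed
  then have "(\<integral>\<^sup>+x. ennreal (\<bar>x \<bullet> b\<bar> * cmod (gaussian e x)) \<partial>lborel) = (\<integral>\<^sup>+x. (\<Prod>c\<in>Basis. ?w c (x \<bullet> c)) \<partial>lborel)"
    by (rule nn_integral_cong)
  also have "\<dots> = (\<Prod>c\<in>Basis. \<integral>\<^sup>+t. ?w c t \<partial>lborel)"
    by (rule nn_integral_lborel_prod) auto
  also have "\<dots> = (\<integral>\<^sup>+t. ?w b t \<partial>lborel) * (\<Prod>c\<in>Basis - {b}. \<integral>\<^sup>+t. ?w c t \<partial>lborel)"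
    using b by (intro prod.remove) auto
  also have "(\<integral>\<^sup>+t. ?w b t \<partial>lborel) = ennreal (e * sqrt (2 / pi))"
    using nn_integral_eq_integral[of lborel "\<lambda>t. \<bar>t\<bar> * normal_density 0 e t"]
      integrable_normal_moment_abs[OF e, of 0 1] integral_normal_moment_abs_odd[OF e, of 0 0]
    by (simp add: mult.commute)
  also have "(\<Prod>c\<in>Basis - {b}. \<integral>\<^sup>+t. ?w c t \<partial>lborel) = 1"
  proof (intro prod.neutral ballI)
    fix c assume "c \<in> Basis - {b}"
    then have "c \<noteq> b" by simp
    have "(\<integral>\<^sup>+t. ennreal (normal_density 0 e t) \<partial>lborel) = 1"
      using e by (subst nn_integral_eq_integral) auto
    then show "(\<integral>\<^sup>+t. ?w c t \<partial>lborel) = 1" using \<open>c \<noteq> b\<close> by simp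
  qed
  finally show ?thesis by simp
qed

lemma integral_gaussian:
  assumes e: "0 < e"
  shows "l1_norm (gaussian e :: 'a::euclidean_space \<Rightarrow> complex) = 1"
    and "(LINT x|lborel. gaussian e (x :: 'a)) = 1"
proof -
  have "(\<integral>\<^sup>+x. ennreal (cmod (gaussian e x)) \<partial>(lborel :: 'a measure)) =
      (\<integral>\<^sup>+x. (\<Prod>b\<in>Basis. ennreal (normal_density 0 e (x \<bullet> b))) \<partial>(lborel :: 'a measure))"
    by (simp add: norm_gaussian prod_ennreal)
  also have "\<dots> = (\<Prod>b\<in>(Basis :: 'a set). \<integral>\<^sup>+t. ennreal (normal_density 0 e t) \<partial>lborel)"
    by (rule nn_integral_lborel_prod) auto
  also have "\<dots> = 1"
    using e by (subst nn_integral_eq_integral) auto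
  finally have "(\<integral>\<^sup>+x. ennreal (cmod (gaussian e x)) \<partial>(lborel :: 'a measure)) = 1" .
  moreover have "integrable lborel (gaussian e :: 'a \<Rightarrow> complex)"
    using DL1_integrable[OF gaussian_DL1[OF e], of "[]"] by simp
  ultimately show l1: "l1_norm (gaussian e :: 'a \<Rightarrow> complex) = 1"
    by (simp add: nn_integral_l1_norm)
  have "(LINT x|lborel. gaussian e (x :: 'a)) = of_real (LINT x|lborel. (\<Prod>b\<in>Basis. normal_density 0 e ((x :: 'a) \<bullet> b)))"
    unfolding gaussian_def by (rule integral_complex_of_real)
  also have "\<dots> = 1" using l1 by (simp add: l1_norm_def norm_gaussian)
  finally show "(LINT x|lborel. gaussian e (x :: 'a)) = 1" .
qed

text \<open>Mollifiers on a product space are elementary tensors, which is what makes the range of the kernel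
  map dense.\<close>

lemma gaussian_prod: "gaussian e (x, y) = gaussian e x * gaussian e y"
proof -
  have "(\<Prod>b\<in>Basis. normal_density 0 e ((x, y) \<bullet> b)) =
    (\<Prod>b\<in>Basis. normal_density 0 e (x \<bullet> b)) * (\<Prod>b\<in>Basis. normal_density 0 e (y \<bullet> b))"
    unfolding Basis_prod_def
    by (subst prod.union_disjoint) (auto simp: prod.reindex inj_on_def)
  then show ?thesis by (simp add: gaussian_def del: of_real_prod)
qed

text \<open>Translating \<open>g\<close> by \<open>s\<close> costs at most the sum of \<open>\<bar>s \<bullet> b\<bar>\<close> times the norm of \<open>\<partial>\<^sub>b g\<close>, and the mean of
  \<open>\<bar>s \<bullet> b\<bar>\<close> under the Gaussian is \<open>e * sqrt (2 / pi)\<close>, which is at most \<open>e\<close>.\<close>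

lemma mollification_error:
  assumes g: "g \<in> carrier DL1" and e: "0 < e"
  shows "integrable lborel (\<lambda>x. g x - (LINT s|lborel. g s * gaussian e (x - s)))"
    and "l1_norm (\<lambda>x. g x - (LINT s|lborel. g s * gaussian e (x - s))) \<le>
      e * (\<Sum>b\<in>Basis. l1_norm (partial_derivative [b] g))"
proof -
  let ?E = "\<lambda>x. g x - (LINT s|lborel. g s * gaussian e (x - s))"
  have gi: "integrable lborel g" using DL1_integrable[OF g, of "[]"] by simp
  have [measurable]: "g \<in> borel_measurable borel" using gi by auto
  have gs: "integrable lborel (gaussian e :: 'a \<Rightarrow> complex)"
    using DL1_integrable[OF gaussian_DL1[OF e], of "[]"] by simp
  have E: "?E x = (LINT s|lborel. (g x - g (x - s)) * gaussian e s)" for x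
  proof -
    have "(LINT s|lborel. g s * gaussian e (x - s)) = (LINT s|lborel. g (x - s) * gaussian e (x - (x - s)))"
      by (rule integral_lborel_reflect[symmetric]) measurable
    moreover have "integrable lborel (\<lambda>s. g (x - s) * gaussian e s)"
      using integrable_convolution[OF gaussian_DL1[OF e] g, of x] by (simp add: mult.commute)
    moreover have "(LINT s|lborel. g x * gaussian e s) = g x"
      by (simp add: integral_gaussian(2)[OF e])
    ultimately show ?thesis
      using gs by (simp add: left_diff_distrib)
  qed
  define c where "c = (\<Sum>b\<in>Basis. l1_norm (partial_derivative [b] g) * (e * sqrt (2 / pi)))"
  have "(\<integral>\<^sup>+x. ennreal (cmod (?E x)) \<partial>lborel) \<le>
      (\<integral>\<^sup>+s. \<integral>\<^sup>+x. ennreal (cmod ((g x - g (x - s)) * gaussian e s)) \<partial>lborel \<partial>lborel)"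
    unfolding E by (rule minkowski_integral) (auto simp: case_prod_unfold sigma_finite_lborel)
  also have "\<dots> \<le> (\<integral>\<^sup>+s. (\<Sum>b\<in>Basis. ennreal (l1_norm (partial_derivative [b] g)) *
      ennreal (\<bar>s \<bullet> b\<bar> * cmod (gaussian e s))) \<partial>lborel)"
  proof (rule nn_integral_mono)
    fix s :: 'a
    have "(\<integral>\<^sup>+x. ennreal (cmod ((g x - g (x - s)) * gaussian e s)) \<partial>lborel) =
        (\<integral>\<^sup>+x. ennreal (cmod (g x - g (x - s))) * ennreal (cmod (gaussian e s)) \<partial>lborel)"
      by (simp add: norm_mult ennreal_mult)
    also have "\<dots> = ennreal (l1_norm (\<lambda>x. g x - g (x - s))) * ennreal (cmod (gaussian e s))"
      using gi integrable_lborel_translate[OF gi, of s] by (simp add: nn_integral_multc nn_integral_l1_norm)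
    also have "\<dots> \<le> ennreal (\<Sum>b\<in>Basis. \<bar>s \<bullet> b\<bar> * l1_norm (partial_derivative [b] g)) * ennreal (cmod (gaussian e s))"
      by (intro mult_right_mono ennreal_leI l1_norm_diff_translate[OF g]) simp
    also have "\<dots> = ennreal (\<Sum>b\<in>Basis. l1_norm (partial_derivative [b] g) * (\<bar>s \<bullet> b\<bar> * cmod (gaussian e s)))"
      by (simp add: l1_norm_nonneg sum_nonneg sum_distrib_left mult_ac flip: ennreal_mult del: partial_derivative.simps)
    also have "\<dots> = (\<Sum>b\<in>Basis. ennreal (l1_norm (partial_derivative [b] g)) *
        ennreal (\<bar>s \<bullet> b\<bar> * cmod (gaussian e s)))"
      by (simp add: l1_norm_nonneg ennreal_mult flip: sum_ennreal del: partial_derivative.simps)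
    finally show "(\<integral>\<^sup>+x. ennreal (cmod ((g x - g (x - s)) * gaussian e s)) \<partial>lborel) \<le>
        (\<Sum>b\<in>Basis. ennreal (l1_norm (partial_derivative [b] g)) * ennreal (\<bar>s \<bullet> b\<bar> * cmod (gaussian e s)))" .
  qed
  also have "\<dots> = (\<Sum>b\<in>Basis. ennreal (l1_norm (partial_derivative [b] g)) *
      (\<integral>\<^sup>+s. ennreal (\<bar>s \<bullet> b\<bar> * cmod (gaussian e s)) \<partial>lborel))"
    by (simp add: nn_integral_sum nn_integral_cmult)
  also have "\<dots> = (\<Sum>b\<in>Basis. ennreal (l1_norm (partial_derivative [b] g)) * ennreal (e * sqrt (2 / pi)))"
    by (intro sum.cong refl) (simp only: nn_integral_gaussian_moment[OF e])
  also have "\<dots> = ennreal c"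
    unfolding c_def using e by (simp add: l1_norm_nonneg flip: sum_ennreal ennreal_mult del: partial_derivative.simps)
  finally have bound: "(\<integral>\<^sup>+x. ennreal (cmod (?E x)) \<partial>lborel) \<le> ennreal c" .
  have meas: "?E \<in> borel_measurable borel" by measurable
  have c0: "0 \<le> c" unfolding c_def using e by (intro sum_nonneg mult_nonneg_nonneg) (auto simp: l1_norm_nonneg)
  show "integrable lborel ?E" by (rule l1_norm_boundI(1)[OF meas c0 bound])
  have "l1_norm ?E \<le> c" by (rule l1_norm_boundI(2)[OF meas c0 bound])
  also have "c = (e * sqrt (2 / pi)) * (\<Sum>b\<in>Basis. l1_norm (partial_derivative [b] g))"
    unfolding c_def by (simp add: sum_distrib_left mult.commute del: partial_derivative.simps)
  also have "\<dots> \<le> (e * 1) * (\<Sum>b\<in>Basis. l1_norm (partial_derivative [b] g))"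
    using e pi_ge_two by (intro mult_right_mono mult_left_mono sum_nonneg l1_norm_nonneg) (auto simp: real_sqrt_le_1_iff)
  finally show "l1_norm ?E \<le> e * (\<Sum>b\<in>Basis. l1_norm (partial_derivative [b] g))" by simp
qed

section \<open>Decomposition into derivatives and discretisation of convolutions\<close>

lemma one_minus_weight: "continuous_on UNIV (\<lambda>t::real. 1 - t)" "\<forall>t\<in>{0..1::real}. \<bar>1 - t\<bar> \<le> 1"
  by (auto intro!: continuous_intros)

lemma one_weight: "continuous_on UNIV (\<lambda>t::real. 1::real)" "\<forall>t\<in>{0..1::real}. \<bar>1::real\<bar> \<le> 1"
  by auto

lemma DL1_segment_average_basis:
  assumes f: "f \<in> carrier DL1" and b: "b \<in> Basis"
  shows "partial_derivative [b] (segment_average (\<lambda>t. 1) b f) = (\<lambda>x. f x - f (x - b))"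
    and "partial_derivative [b] (segment_average (\<lambda>t. 1 - t) b f) = (\<lambda>x. f x - segment_average (\<lambda>t. 1) b f x)"
proof -
  define D where "D x h = (\<Sum>b\<in>Basis. (h \<bullet> b) *\<^sub>R partial_derivative [b] f x)" for x h
  have D: "(f has_derivative D x) (at x)" for x
    unfolding D_def[abs_def] using smooth_has_derivative[OF DL1_smooth[OF f], of "[]"] by simp
  have Db: "(\<lambda>x. D x b) = partial_derivative [b] f"
    unfolding D_def by (rule ext) (rule sum_inner_Basis_scaleR[OF b])
  have bl: "[b] \<in> lists Basis" using b by simp
  have cont: "continuous_on UNIV (\<lambda>x. D x b)"
    unfolding Db by (rule smooth_continuous[OF DL1_smooth[OF f] bl])
  show "partial_derivative [b] (segment_average (\<lambda>t. 1) b f) = (\<lambda>x. f x - f (x - b))"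
    unfolding DL1_segment_average_derivative[OF one_weight f bl] Db[symmetric]
    by (rule ext) (rule segment_average_directional(1)[OF D cont])
  show "partial_derivative [b] (segment_average (\<lambda>t. 1 - t) b f) = (\<lambda>x. f x - segment_average (\<lambda>t. 1) b f x)"
    unfolding DL1_segment_average_derivative[OF one_minus_weight f bl] Db[symmetric]
    by (rule ext) (rule segment_average_directional(2)[OF D cont])
qed

text \<open>Averages gain one derivative in the direction of the segment.\<close>

lemma l1_norm_derivative_segment_average:
  assumes f: "f \<in> carrier DL1" and b: "b \<in> Basis"
  shows "l1_norm (partial_derivative [b] (segment_average (\<lambda>t. 1) b f)) \<le> 2 * l1_norm f"
    and "l1_norm (partial_derivative [b] (segment_average (\<lambda>t. 1 - t) b f)) \<le> 2 * l1_norm f"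
proof -
  have fi: "integrable lborel f" using DL1_integrable[OF f, of "[]"] by simp
  have "l1_norm (\<lambda>x. f x - f (x - b)) \<le> l1_norm f + l1_norm (\<lambda>x. f (x - b))"
    by (rule l1_norm_triangle_diff[OF fi integrable_lborel_translate[OF fi]])
  then show "l1_norm (partial_derivative [b] (segment_average (\<lambda>t. 1) b f)) \<le> 2 * l1_norm f"
    using fi by (simp only: DL1_segment_average_basis[OF f b]) (simp add: l1_norm_translate)
  have Si: "integrable lborel (segment_average (\<lambda>t. 1) b f)"
    "l1_norm (segment_average (\<lambda>t. 1) b f) \<le> l1_norm f"
    using segment_average_smooth_l1[OF one_weight f, where bs = "[]" and v = b] by simp_all
  have "l1_norm (\<lambda>x. f x - segment_average (\<lambda>t. 1) b f x) \<le> l1_norm f + l1_norm (segment_average (\<lambda>t. 1) b f)"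
    by (rule l1_norm_triangle_diff[OF fi Si(1)])
  then show "l1_norm (partial_derivative [b] (segment_average (\<lambda>t. 1 - t) b f)) \<le> 2 * l1_norm f"
    using Si(2) by (simp only: DL1_segment_average_basis[OF f b])
qed

lemma subseq_ConsE:
  assumes "subseq a (b # bs)"
  obtains "subseq a bs" | a' where "a = b # a'" "subseq a' bs"
  using assms by (cases rule: list_emb.cases) auto

text \<open>Iterating \<open>f = \<partial>\<^sub>b (A f) + B f\<close> over the directions \<open>b\<close> of the word \<open>bs\<close> writes \<open>f\<close> as a sum of
  derivatives of \<open>K f\<close>, where every \<open>K\<close> is a composition of averages. Since averages commute with
  derivatives and each of them gains one derivative in its direction, \<open>K f\<close> has derivatives along all
  subsequences of \<open>bs\<close> which are bounded by the norm of \<open>f\<close> alone. The operators do not depend on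
  \<open>f\<close>, so that the bound is uniform, and the decomposition is compatible with further derivatives \<open>a\<close>.\<close>

lemma derivative_decomposition:
  fixes bs :: "'a::euclidean_space list"
  assumes "bs \<in> lists Basis"
  shows "\<exists>Ks C. 0 \<le> C \<and>
    (\<forall>(w, K)\<in>set Ks. w \<in> lists Basis \<and> (\<forall>f\<in>carrier DL1. K f \<in> carrier DL1 \<and>
      (\<forall>a\<in>lists Basis. subseq a bs \<longrightarrow> l1_norm (partial_derivative a (K f)) \<le> C * l1_norm f))) \<and>
    (\<forall>f\<in>carrier DL1. \<forall>a\<in>lists Basis. \<forall>x.
      partial_derivative a f x = (\<Sum>(w, K)\<leftarrow>Ks. partial_derivative w (partial_derivative a (K f)) x))"
  using assms
proof (induction bs)
  case Nil
  show ?case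
    by (intro exI[of _ "[([], \<lambda>f. f)]"] exI[of _ 1]) (auto dest: list_emb_Nil2)
next
  case (Cons b bs)
  then have b: "b \<in> Basis" and bl: "[b] \<in> lists Basis" and bs: "bs \<in> lists Basis" by auto
  from Cons.IH obtain Ks C where C: "0 \<le> C"
    and Ks: "\<forall>(w, K)\<in>set Ks. w \<in> lists Basis \<and> (\<forall>f\<in>carrier DL1. K f \<in> carrier DL1 \<and>
      (\<forall>a\<in>lists Basis. subseq a bs \<longrightarrow> l1_norm (partial_derivative a (K f)) \<le> C * l1_norm f))"
    and dec: "\<forall>f\<in>carrier DL1. \<forall>a\<in>lists Basis. \<forall>x.
      partial_derivative a f x = (\<Sum>(w, K)\<leftarrow>Ks. partial_derivative w (partial_derivative a (K f)) x)"
    by (elim exE conjE) iprover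
  have w: "w \<in> lists Basis" and K: "f \<in> carrier DL1 \<Longrightarrow> K f \<in> carrier DL1"
    and bound: "f \<in> carrier DL1 \<Longrightarrow> a \<in> lists Basis \<Longrightarrow> subseq a bs \<Longrightarrow>
      l1_norm (partial_derivative a (K f)) \<le> C * l1_norm f"
    if "(w, K) \<in> set Ks" for w K f a
    using bspec[OF Ks that] by auto
  let ?A = "segment_average (\<lambda>t. 1 - t) b" and ?B = "segment_average (\<lambda>t. 1) b"
  note A = DL1_segment_average[OF one_minus_weight, where v = b]
    and A' = DL1_segment_average_derivative[OF one_minus_weight, where v = b]
    and B = DL1_segment_average[OF one_weight, where v = b]
    and B' = DL1_segment_average_derivative[OF one_weight, where v = b]
  let ?Ks = "map (\<lambda>(w, K). (w @ [b], ?A \<circ> K)) Ks @ map (\<lambda>(w, K). (w, ?B \<circ> K)) Ks"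
  \<comment> \<open>the identity \<open>f = \<partial>\<^sub>b (A f) + B f\<close> for derivatives of \<open>f\<close>, with the averages moved inside\<close>
  have split: "partial_derivative a f =
      (\<lambda>x. partial_derivative [b] (partial_derivative a (?A f)) x + partial_derivative a (?B f) x)"
    if f: "f \<in> carrier DL1" and a: "a \<in> lists Basis" for f a
    using DL1_segment_average_basis(2)[OF DL1_partial_derivative[OF f a] b]
    unfolding A'[OF f a] B'[OF f a] by simp
  have gain: "l1_norm (partial_derivative a (S (K f))) \<le> (2 * C) * l1_norm f"
    if wK: "(w, K) \<in> set Ks" and f: "f \<in> carrier DL1" and a: "a \<in> lists Basis" and sub: "subseq a (b # bs)"
      and S': "\<And>g c. g \<in> carrier DL1 \<Longrightarrow> c \<in> lists Basis \<Longrightarrow>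
        partial_derivative c (S g) = S (partial_derivative c g)"
      and S1: "\<And>g. g \<in> carrier DL1 \<Longrightarrow> l1_norm (S g) \<le> l1_norm g"
      and S2: "\<And>g. g \<in> carrier DL1 \<Longrightarrow> l1_norm (partial_derivative [b] (S g)) \<le> 2 * l1_norm g"
    for w K f a S
    using sub
  proof (cases rule: subseq_ConsE)
    case 1
    have "l1_norm (partial_derivative a (S (K f))) \<le> l1_norm (partial_derivative a (K f))"
      unfolding S'[OF K[OF wK f] a] by (intro S1 DL1_partial_derivative K[OF wK f] a)
    also have "\<dots> \<le> C * l1_norm f" by (rule bound[OF wK f a 1])
    finally show ?thesis using mult_nonneg_nonneg[OF C l1_norm_nonneg[of f]] by simp
  next
    case (2 a')
    have a': "a' \<in> lists Basis" using a 2 by simp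
    have "partial_derivative a (S (K f)) = partial_derivative [b] (S (partial_derivative a' (K f)))"
      using S'[OF K[OF wK f] a'] by (simp add: 2)
    then have "l1_norm (partial_derivative a (S (K f))) \<le> 2 * l1_norm (partial_derivative a' (K f))"
      using S2[OF DL1_partial_derivative[OF K[OF wK f] a']] by simp
    also have "\<dots> \<le> 2 * (C * l1_norm f)"
      using bound[OF wK f a' 2(2)] by simp
    finally show ?thesis by simp
  qed
  have "\<forall>(w, K)\<in>set ?Ks. w \<in> lists Basis \<and> (\<forall>f\<in>carrier DL1. K f \<in> carrier DL1 \<and>
      (\<forall>a\<in>lists Basis. subseq a (b # bs) \<longrightarrow> l1_norm (partial_derivative a (K f)) \<le> (2 * C) * l1_norm f))"
  proof (intro ballI, clarify)
    fix w' K' assume "(w', K') \<in> set ?Ks"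
    then consider (A) w K where "(w, K) \<in> set Ks" "w' = w @ [b]" "K' = ?A \<circ> K"
      | (B) w K where "(w, K) \<in> set Ks" "w' = w" "K' = ?B \<circ> K" by auto
    then show "w' \<in> lists Basis \<and> (\<forall>f\<in>carrier DL1. K' f \<in> carrier DL1 \<and>
      (\<forall>a\<in>lists Basis. subseq a (b # bs) \<longrightarrow> l1_norm (partial_derivative a (K' f)) \<le> (2 * C) * l1_norm f))"
    proof cases
      case A
      have "l1_norm (?A g) \<le> l1_norm g" if "g \<in> carrier DL1" for g
        using segment_average_smooth_l1(2)[OF one_minus_weight that, where bs = "[]" and v = b] by simp
      then show ?thesis
        using A w[OF A(1)] b K[OF A(1)] \<open>\<And>f. f \<in> carrier DL1 \<Longrightarrow> ?A f \<in> carrier DL1\<close>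
          gain[OF A(1) _ _ _ A' _ l1_norm_derivative_segment_average(2)[OF _ b]] by auto
    next
      case B
      have "l1_norm (?B g) \<le> l1_norm g" if "g \<in> carrier DL1" for g
        using segment_average_smooth_l1(2)[OF one_weight that, where bs = "[]" and v = b] by simp
      then show ?thesis
        using B w[OF B(1)] K[OF B(1)] \<open>\<And>f. f \<in> carrier DL1 \<Longrightarrow> ?B f \<in> carrier DL1\<close>
          gain[OF B(1) _ _ _ B' _ l1_norm_derivative_segment_average(1)[OF _ b]] by auto
    qed
  qed
  moreover have "partial_derivative a f x =
      (\<Sum>(w, K)\<leftarrow>?Ks. partial_derivative w (partial_derivative a (K f)) x)"
    if f: "f \<in> carrier DL1" and a: "a \<in> lists Basis" for f a x
  proof -
    have *: "partial_derivative w (partial_derivative a (K f)) x =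
        partial_derivative (w @ [b]) (partial_derivative a (?A (K f))) x +
        partial_derivative w (partial_derivative a (?B (K f))) x"
      if wK: "(w, K) \<in> set Ks" for w K
    proof -
      note Kf = K[OF wK f]
      have "partial_derivative w (partial_derivative a (K f)) =
          (\<lambda>x. partial_derivative w (partial_derivative [b] (partial_derivative a (?A (K f)))) x +
            partial_derivative w (partial_derivative a (?B (K f))) x)"
        by (subst split[OF Kf a], rule DL1_add(2))
          (intro DL1_partial_derivative A B Kf a bl w[OF wK])+
      then show ?thesis by (simp add: partial_derivative_append del: partial_derivative.simps)
    qed
    have "partial_derivative a f x = (\<Sum>(w, K)\<leftarrow>Ks. partial_derivative w (partial_derivative a (K f)) x)"
      using dec f a by blast
    also have "\<dots> = (\<Sum>(w, K)\<leftarrow>Ks. partial_derivative (w @ [b]) (partial_derivative a (?A (K f))) x +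
        partial_derivative w (partial_derivative a (?B (K f))) x)"
      using * by (intro arg_cong[of _ _ sum_list] map_cong) auto
    also have "\<dots> = (\<Sum>(w, K)\<leftarrow>?Ks. partial_derivative w (partial_derivative a (K f)) x)"
      by (simp add: case_prod_unfold sum_list_addf comp_def)
    finally show ?thesis .
  qed
  ultimately show ?case using C by (intro exI[of _ ?Ks] exI[of _ "2 * C"]) simp
qed

lemma subseq_concat: "a \<in> set as \<Longrightarrow> subseq a (concat as)"
  by (induction as) (auto intro: list_emb_append2 list_emb_prefix)

text \<open>The error is at most the integral of \<open>cmod (f s)\<close> times the norm of the difference of two translates
  of \<open>g\<close>. This norm tends to \<open>0\<close> by \<open>l1_norm_diff_translate\<close> and is at most twice the norm of \<open>g\<close>, so that
  dominated convergence applies.\<close>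

lemma discretisation_error:
  fixes f g :: "'a::euclidean_space \<Rightarrow> complex" and \<tau> :: "nat \<Rightarrow> 'a \<Rightarrow> 'a"
  assumes f: "integrable lborel f" and g: "g \<in> carrier DL1"
    and \<tau>: "\<And>n. \<tau> n \<in> borel_measurable borel" and lim: "\<And>s. (\<lambda>n. \<tau> n s) \<longlonglongrightarrow> s"
  shows "integrable lborel (\<lambda>x. LINT s|lborel. f s * (g (x - s) - g (x - \<tau> n s)))"
    and "(\<lambda>n. l1_norm (\<lambda>x. LINT s|lborel. f s * (g (x - s) - g (x - \<tau> n s)))) \<longlonglongrightarrow> 0"
proof -
  have [measurable]: "f \<in> borel_measurable borel" "\<And>n. \<tau> n \<in> borel_measurable borel"
    using f \<tau> by auto
  have gi: "integrable lborel g" using DL1_integrable[OF g, of "[]"] by simp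
  have [measurable]: "g \<in> borel_measurable borel" using gi by auto
  let ?E = "\<lambda>n x. LINT s|lborel. f s * (g (x - s) - g (x - \<tau> n s))"
  \<comment> \<open>a bound for the norm of the difference of the two translates, both small and dominated\<close>
  define \<beta> where "\<beta> n s = min (\<Sum>b\<in>Basis. \<bar>(\<tau> n s - s) \<bullet> b\<bar> * l1_norm (partial_derivative [b] g)) (2 * l1_norm g)" for n s
  have \<beta>0: "0 \<le> \<beta> n s" for n s
    unfolding \<beta>_def using l1_norm_nonneg by (auto intro!: sum_nonneg simp del: partial_derivative.simps)
  have \<beta>2: "\<beta> n s \<le> 2 * l1_norm g" for n s unfolding \<beta>_def by simp
  have [measurable]: "\<beta> n \<in> borel_measurable borel" for n unfolding \<beta>_def by measurable
  have shift: "l1_norm (\<lambda>x. g (x - s) - g (x - \<tau> n s)) \<le> \<beta> n s" for n s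
  proof -
    let ?h = "\<lambda>x. g x - g (x - (\<tau> n s - s))"
    have "l1_norm (\<lambda>x. g (x - s) - g (x - \<tau> n s)) = l1_norm (\<lambda>x. ?h (x - s))" by simp
    also have "\<dots> = l1_norm ?h" by (rule l1_norm_translate) measurable
    finally have eq: "l1_norm (\<lambda>x. g (x - s) - g (x - \<tau> n s)) = l1_norm ?h" .
    have "l1_norm ?h \<le> l1_norm g + l1_norm (\<lambda>x. g (x - (\<tau> n s - s)))"
      by (rule l1_norm_triangle_diff[OF gi integrable_lborel_translate[OF gi]])
    then have "l1_norm ?h \<le> 2 * l1_norm g" by (simp add: l1_norm_translate)
    then show ?thesis
      unfolding eq \<beta>_def using l1_norm_diff_translate[OF g, of "\<tau> n s - s"] by (simp del: partial_derivative.simps)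
  qed
  have \<beta>i: "integrable lborel (\<lambda>s. cmod (f s) * \<beta> n s)" for n
  proof (rule Bochner_Integration.integrable_bound)
    show "integrable lborel (\<lambda>s. cmod (f s) * (2 * l1_norm g))" using f by auto
    show "AE s in lborel. norm (cmod (f s) * \<beta> n s) \<le> norm (cmod (f s) * (2 * l1_norm g))"
    proof (rule AE_I2)
      fix s
      have "cmod (f s) * \<beta> n s \<le> cmod (f s) * (2 * l1_norm g)"
        by (rule mult_left_mono[OF \<beta>2]) simp
      then show "norm (cmod (f s) * \<beta> n s) \<le> norm (cmod (f s) * (2 * l1_norm g))"
        using \<beta>0[of n s] l1_norm_nonneg[of g] by (simp add: abs_mult)
    qed
  qed measurable
  have bound: "(\<integral>\<^sup>+x. ennreal (cmod (?E n x)) \<partial>lborel) \<le> ennreal (LINT s|lborel. cmod (f s) * \<beta> n s)" for n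
  proof -
    have "(\<integral>\<^sup>+x. ennreal (cmod (?E n x)) \<partial>lborel) \<le>
        (\<integral>\<^sup>+s. \<integral>\<^sup>+x. ennreal (cmod (f s * (g (x - s) - g (x - \<tau> n s)))) \<partial>lborel \<partial>lborel)"
      by (rule minkowski_integral) (auto simp: case_prod_unfold sigma_finite_lborel)
    also have "\<dots> \<le> (\<integral>\<^sup>+s. ennreal (cmod (f s) * \<beta> n s) \<partial>lborel)"
    proof (rule nn_integral_mono)
      fix s
      have "(\<integral>\<^sup>+x. ennreal (cmod (f s * (g (x - s) - g (x - \<tau> n s)))) \<partial>lborel) =
          (\<integral>\<^sup>+x. ennreal (cmod (f s)) * ennreal (cmod (g (x - s) - g (x - \<tau> n s))) \<partial>lborel)"
        by (simp add: norm_mult ennreal_mult)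
      also have "\<dots> = ennreal (cmod (f s)) * ennreal (l1_norm (\<lambda>x. g (x - s) - g (x - \<tau> n s)))"
        using integrable_lborel_translate[OF gi, of s] integrable_lborel_translate[OF gi, of "\<tau> n s"]
        by (simp add: nn_integral_cmult nn_integral_l1_norm)
      also have "\<dots> \<le> ennreal (cmod (f s)) * ennreal (\<beta> n s)"
        by (intro mult_left_mono ennreal_leI shift) simp
      finally show "(\<integral>\<^sup>+x. ennreal (cmod (f s * (g (x - s) - g (x - \<tau> n s)))) \<partial>lborel) \<le> ennreal (cmod (f s) * \<beta> n s)"
        by (simp add: ennreal_mult \<beta>0)
    qed
    also have "\<dots> = ennreal (LINT s|lborel. cmod (f s) * \<beta> n s)"
      by (rule nn_integral_eq_integral[OF \<beta>i]) (simp add: \<beta>0)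
    finally show ?thesis .
  qed
  have meas: "?E n \<in> borel_measurable borel" for n by measurable
  have nonneg: "0 \<le> (LINT s|lborel. cmod (f s) * \<beta> n s)" for n
    by (rule Bochner_Integration.integral_nonneg) (simp add: \<beta>0)
  note E = l1_norm_boundI[OF meas nonneg bound]
  show "integrable lborel (?E n)" by (rule E(1))
  have "(\<lambda>n. LINT s|lborel. cmod (f s) * \<beta> n s) \<longlonglongrightarrow> (LINT s|(lborel :: 'a measure). (0::real))"
  proof (rule integral_dominated_convergence[where w = "\<lambda>s. cmod (f s) * (2 * l1_norm g)"])
    show "integrable lborel (\<lambda>s. cmod (f s) * (2 * l1_norm g))" using f by auto
    show "AE s in lborel. (\<lambda>n. cmod (f s) * \<beta> n s) \<longlonglongrightarrow> 0"
    proof (rule AE_I2)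
      fix s
      have "(\<lambda>n. min (\<Sum>b\<in>Basis. \<bar>(\<tau> n s - s) \<bullet> b\<bar> * l1_norm (partial_derivative [b] g)) (2 * l1_norm g)) \<longlonglongrightarrow>
          min (\<Sum>b\<in>Basis. \<bar>(s - s) \<bullet> b\<bar> * l1_norm (partial_derivative [b] g)) (2 * l1_norm g)"
        by (intro tendsto_intros lim)
      then have "(\<lambda>n. \<beta> n s) \<longlonglongrightarrow> 0" by (simp add: \<beta>_def l1_norm_nonneg del: partial_derivative.simps)
      from tendsto_mult_right_zero[OF this] show "(\<lambda>n. cmod (f s) * \<beta> n s) \<longlonglongrightarrow> 0" .
    qed
    show "AE s in lborel. norm (cmod (f s) * \<beta> n s) \<le> cmod (f s) * (2 * l1_norm g)" for n
      by (rule AE_I2) (simp add: abs_mult \<beta>0 mult_left_mono[OF \<beta>2])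
  qed auto
  then have lim0: "(\<lambda>n. LINT s|lborel. cmod (f s) * \<beta> n s) \<longlonglongrightarrow> 0" by simp
  show "(\<lambda>n. l1_norm (?E n)) \<longlonglongrightarrow> 0"
    by (rule tendsto_sandwich[OF _ _ tendsto_const lim0]) (auto simp: l1_norm_nonneg E(2))
qed

text \<open>Discretised convolutions are finite combinations of translates of \<open>g\<close>, with integrals of \<open>f\<close> over
  the cells on which \<open>\<tau>\<close> is constant as coefficients.\<close>

lemma integral_finite_range:
  fixes f g :: "'a::euclidean_space \<Rightarrow> complex"
  assumes f: "integrable lborel f" and \<tau>: "\<tau> \<in> borel_measurable borel" and fin: "finite (range \<tau>)"
  shows "(LINT s|lborel. f s * g (x - \<tau> s)) =
    (\<Sum>v\<in>range \<tau>. (LINT s:(\<tau> -` {v})|lborel. f s) * g (x - v))"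
proof -
  have sets: "\<tau> -` {v} \<in> sets lborel" for v
    using measurable_sets[OF \<tau>, of "{v}"] by simp
  have i: "integrable lborel (\<lambda>s. indicator (\<tau> -` {v}) s *\<^sub>R f s)" for v
    using integrable_mult_indicator[OF sets f] by simp
  have "f s * g (x - \<tau> s) = (\<Sum>v\<in>range \<tau>. (indicator (\<tau> -` {v}) s *\<^sub>R f s) * g (x - v))" for s
  proof -
    have "(\<Sum>v\<in>range \<tau>. (indicator (\<tau> -` {v}) s *\<^sub>R f s) * g (x - v)) =
        (\<Sum>v\<in>range \<tau>. if v = \<tau> s then f s * g (x - v) else 0)"
      by (intro sum.cong) (auto simp: indicator_def)
    then show ?thesis using fin by simp
  qed
  then have "(LINT s|lborel. f s * g (x - \<tau> s)) =
      (LINT s|lborel. (\<Sum>v\<in>range \<tau>. (indicator (\<tau> -` {v}) s *\<^sub>R f s) * g (x - v)))" by simp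
  also have "\<dots> = (\<Sum>v\<in>range \<tau>. LINT s|lborel. (indicator (\<tau> -` {v}) s *\<^sub>R f s) * g (x - v))"
    by (intro Bochner_Integration.integral_sum integrable_mult_left i)
  also have "\<dots> = (\<Sum>v\<in>range \<tau>. (LINT s:(\<tau> -` {v})|lborel. f s) * g (x - v))"
    unfolding set_lebesgue_integral_def by (intro sum.cong refl Bochner_Integration.integral_mult_left i)
  finally show ?thesis .
qed

lemma simple_approximations_of_identity:
  obtains \<tau> :: "nat \<Rightarrow> 'a::euclidean_space \<Rightarrow> 'a" where "\<And>n. \<tau> n \<in> borel_measurable borel"
    "\<And>n. finite (range (\<tau> n))" "\<And>s. (\<lambda>n. \<tau> n s) \<longlonglongrightarrow> s"
proof -
  obtain F :: "nat \<Rightarrow> 'a \<Rightarrow> 'a" where "\<And>n. simple_function borel (F n)" "\<And>x. (\<lambda>n. F n x) \<longlonglongrightarrow> x"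
    using borel_measurable_implies_sequence_metric[of "\<lambda>x :: 'a. x" borel 0] by auto
  moreover have "finite (range (F n))" for n
    using simple_functionD(1)[OF \<open>\<And>n. simple_function borel (F n)\<close>, of n] by simp
  ultimately show thesis
    by (intro that[of F]) (auto intro: borel_measurable_simple_function)
qed

section \<open>Approximation by operators of finite rank\<close>

lemma translate_combination:
  assumes f: "f \<in> carrier DL1" and a: "a \<in> lists Basis" and \<psi>: "\<And>j v. \<psi> j v \<in> carrier DL1"
  shows "partial_derivative a (\<lambda>x. f x - (\<Sum>(j, v)\<in>J. c j v * \<psi> j v x)) =
    (\<lambda>x. partial_derivative a f x - (\<Sum>(j, v)\<in>J. c j v * partial_derivative a (\<psi> j v) x))"
proof -
  have k: "(\<lambda>x. case k of (j, v) \<Rightarrow> c j v * \<psi> j v x) \<in> carrier DL1" for k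
    using DL1.scale_closed[OF \<psi>] by (cases k) simp
  have "partial_derivative a (\<lambda>x. \<Sum>k\<in>J. case k of (j, v) \<Rightarrow> c j v * \<psi> j v x) =
      (\<lambda>x. \<Sum>k\<in>J. partial_derivative a (\<lambda>x. case k of (j, v) \<Rightarrow> c j v * \<psi> j v x) x)"
    by (rule DL1_sum[OF k a])
  also have "\<dots> = (\<lambda>x. \<Sum>(j, v)\<in>J. c j v * partial_derivative a (\<psi> j v) x)"
    by (intro ext sum.cong) (auto simp: DL1_scale(2)[OF \<psi> a])
  finally show ?thesis
    using DL1_diff[OF f DL1.sum_closed[of J "\<lambda>k x. case k of (j, v) \<Rightarrow> c j v * \<psi> j v x", OF k] a] by simp
qed

text \<open>The convolution of \<open>f\<close> with the mollifier equals the sum over \<open>j\<close> of the convolutions of derivatives of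
  \<open>f\<close> with \<open>\<psi> j\<close>. The error thus consists of the error of mollification, which the width \<open>e\<close> controls, and
  of errors of discretisation, which vanish in the limit.\<close>

lemma translate_approximation:
  fixes f :: "'a::euclidean_space \<Rightarrow> complex" and \<psi> :: "nat \<Rightarrow> 'a \<Rightarrow> complex"
  assumes f: "f \<in> carrier DL1" and a: "a \<in> lists Basis" and e: "0 < e" and d: "0 < d"
    and w: "\<And>j. j < m \<Longrightarrow> w j \<in> lists Basis" and \<psi>: "\<And>j. \<psi> j \<in> carrier DL1"
    and dec: "\<And>x. partial_derivative a (gaussian e) x =
      (\<Sum>j<m. partial_derivative (w j) (partial_derivative a (\<psi> j)) x)"
    and \<tau>: "\<And>n. \<tau> n \<in> borel_measurable borel" "\<And>n. finite (range (\<tau> n))" "\<And>s. (\<lambda>n. \<tau> n s) \<longlonglongrightarrow> s"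
  shows "\<forall>\<^sub>F n in sequentially. l1_norm (partial_derivative a (\<lambda>x. f x -
      (\<Sum>(j, v)\<in>{..<m} \<times> range (\<tau> n). (LINT s:(\<tau> n -` {v})|lborel. partial_derivative (rev (w j)) f s) * \<psi> j (x - v))))
    < e * (\<Sum>b\<in>Basis. l1_norm (partial_derivative (b # a) f)) + d"
proof -
  let ?F = "\<lambda>j. partial_derivative (rev (w j)) f" and ?G = "\<lambda>j. partial_derivative a (\<psi> j)"
  let ?R = "\<lambda>n x. f x - (\<Sum>(j, v)\<in>{..<m} \<times> range (\<tau> n). (LINT s:(\<tau> n -` {v})|lborel. ?F j s) * \<psi> j (x - v))"
  let ?M = "\<lambda>x. partial_derivative a f x - (LINT s|lborel. partial_derivative a f s * gaussian e (x - s))"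
  let ?E = "\<lambda>n j x. LINT s|lborel. ?F j s * (?G j (x - s) - ?G j (x - \<tau> n s))"
  have rw: "rev (w j) \<in> lists Basis" if "j < m" for j using w[OF that] by auto
  have F: "?F j \<in> carrier DL1" if "j < m" for j by (rule DL1_partial_derivative[OF f rw[OF that]])
  have G: "?G j \<in> carrier DL1" for j by (rule DL1_partial_derivative[OF \<psi> a])
  have af: "partial_derivative a f \<in> carrier DL1" by (rule DL1_partial_derivative[OF f a])
  have Fi: "integrable lborel (?F j)" if "j < m" for j by (rule DL1_integrable[OF f rw[OF that]])
  \<comment> \<open>all derivatives are moved from the mollifier to \<open>f\<close>\<close>
  have parts: "(LINT s|lborel. partial_derivative a f s * gaussian e (x - s)) =
      (\<Sum>j<m. LINT s|lborel. ?F j s * ?G j (x - s))" for x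
  proof -
    have "(LINT s|lborel. partial_derivative a f s * gaussian e (x - s)) =
        (LINT s|lborel. f s * partial_derivative a (gaussian e) (x - s))"
      using integration_by_parts[OF f gaussian_DL1[OF e] a] gaussian_derivative_rev[OF e a] by simp
    also have "\<dots> = (LINT s|lborel. (\<Sum>j<m. f s * partial_derivative (w j) (?G j) (x - s)))"
      by (simp add: dec sum_distrib_left)
    also have "\<dots> = (\<Sum>j<m. LINT s|lborel. f s * partial_derivative (w j) (?G j) (x - s))"
      by (intro Bochner_Integration.integral_sum integrable_convolution f DL1_partial_derivative G w) simp
    also have "\<dots> = (\<Sum>j<m. LINT s|lborel. ?F j s * ?G j (x - s))"
    proof (rule sum.cong)
      fix j assume "j \<in> {..<m}"
      then show "(LINT s|lborel. f s * partial_derivative (w j) (?G j) (x - s)) =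
          (LINT s|lborel. ?F j s * ?G j (x - s))"
        using integration_by_parts[OF f G[of j] rw[of j], where x = x] by simp
    qed simp
    finally show ?thesis .
  qed
  have eq: "partial_derivative a (?R n) = (\<lambda>x. ?M x + (\<Sum>j<m. ?E n j x))" for n
  proof
    fix x
    have G_range: "(LINT s|lborel. ?F j s * ?G j (x - \<tau> n s)) =
        (\<Sum>v\<in>range (\<tau> n). (LINT s:(\<tau> n -` {v})|lborel. ?F j s) * ?G j (x - v))" if "j < m" for j
      by (rule integral_finite_range[OF Fi[OF that] \<tau>(1,2)])
    have "partial_derivative a (?R n) x = partial_derivative a f x -
        (\<Sum>(j, v)\<in>{..<m} \<times> range (\<tau> n). (LINT s:(\<tau> n -` {v})|lborel. ?F j s) * ?G j (x - v))"
      by (subst translate_combination[OF f a DL1_translate(1)[OF \<psi>], where c = "\<lambda>j v. LINT s:(\<tau> n -` {v})|lborel. ?F j s"])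
        (simp add: DL1_translate(2)[OF \<psi> a])
    also have "\<dots> = partial_derivative a f x - (\<Sum>j<m. LINT s|lborel. ?F j s * ?G j (x - \<tau> n s))"
      by (simp add: G_range flip: sum.cartesian_product)
    also have "\<dots> = ?M x + (\<Sum>j<m. (LINT s|lborel. ?F j s * ?G j (x - s)) - (LINT s|lborel. ?F j s * ?G j (x - \<tau> n s)))"
      by (simp add: parts sum_subtractf)
    also have "(\<Sum>j<m. (LINT s|lborel. ?F j s * ?G j (x - s)) - (LINT s|lborel. ?F j s * ?G j (x - \<tau> n s))) =
        (\<Sum>j<m. ?E n j x)"
    proof (rule sum.cong)
      fix j assume "j \<in> {..<m}"
      then have j: "j < m" by simp
      obtain B where B: "\<And>x. cmod (?G j x) \<le> B" using DL1_bounded[OF G] by blast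
      have [measurable]: "?G j \<in> borel_measurable borel" "\<tau> n \<in> borel_measurable borel"
        using smooth_measurable[OF DL1_smooth[OF \<psi>] a] \<tau>(1) by auto
      have "integrable lborel (\<lambda>s. ?F j s * ?G j (x - \<tau> n s))"
        by (rule integrable_mult_bounded[OF Fi[OF j] _ B]) measurable
      then show "(LINT s|lborel. ?F j s * ?G j (x - s)) - (LINT s|lborel. ?F j s * ?G j (x - \<tau> n s)) = ?E n j x"
        using integrable_convolution[OF F[OF j] G[of j], of x] by (simp add: right_diff_distrib)
    qed simp
    finally show "partial_derivative a (?R n) x = ?M x + (\<Sum>j<m. ?E n j x)" .
  qed
  have Ei: "integrable lborel (?E n j)" and El: "(\<lambda>n. l1_norm (?E n j)) \<longlonglongrightarrow> 0" if "j < m" for n j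
    by (rule discretisation_error[OF Fi[OF that] G \<tau>(1,3)])+
  have "(\<lambda>n. \<Sum>j<m. l1_norm (?E n j)) \<longlonglongrightarrow> (\<Sum>j<m. 0)"
    by (intro tendsto_sum El) simp
  then have "\<forall>\<^sub>F n in sequentially. (\<Sum>j<m. l1_norm (?E n j)) < d"
    using d by (intro order_tendstoD) auto
  then show ?thesis
  proof eventually_elim
    case (elim n)
    have "l1_norm (partial_derivative a (?R n)) \<le> l1_norm ?M + l1_norm (\<lambda>x. \<Sum>j<m. ?E n j x)"
      unfolding eq by (intro l1_norm_triangle mollification_error(1)[OF af e] Bochner_Integration.integrable_sum Ei) simp
    also have "l1_norm ?M \<le> e * (\<Sum>b\<in>Basis. l1_norm (partial_derivative (b # a) f))"
      using mollification_error(2)[OF af e] by simp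
    also have "l1_norm (\<lambda>x. \<Sum>j<m. ?E n j x) \<le> (\<Sum>j<m. l1_norm (?E n j))"
      by (intro l1_norm_sum Ei) simp
    finally show ?case using elim by linarith
  qed
qed

lemma DL1_continuous_seminorm_bound:
  assumes "p \<in> continuous_seminorms (DL1 :: ('a::euclidean_space \<Rightarrow> complex) lcs)"
  obtains A :: "'a::euclidean_space list set" and C where "finite A" "A \<subseteq> lists Basis" "0 \<le> C"
    "\<And>f. f \<in> carrier DL1 \<Longrightarrow> p f \<le> C * (\<Sum>a\<in>A. l1_norm (partial_derivative a f))"
proof -
  obtain Q C where Q: "finite Q" "Q \<subseteq> seminorms (DL1 :: ('a \<Rightarrow> complex) lcs)" "0 \<le> C"
    "\<And>f. f \<in> carrier DL1 \<Longrightarrow> p f \<le> C * (\<Sum>q\<in>Q. q f)"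
    using DL1.continuous_seminorm_bound[OF assms] by blast
  obtain A where A: "A \<subseteq> lists Basis" "finite A" "Q = (\<lambda>bs f. l1_norm (partial_derivative bs f)) ` A"
    using finite_subset_image[OF Q(1), of "\<lambda>bs f. l1_norm (partial_derivative bs f)" "lists Basis"] Q(2)
    unfolding DL1_seminorms by blast
  have "p f \<le> C * (\<Sum>a\<in>A. l1_norm (partial_derivative a f))" if f: "f \<in> carrier DL1" for f
  proof -
    have "(\<Sum>q\<in>Q. q f) \<le> (\<Sum>a\<in>A. l1_norm (partial_derivative a f))"
      unfolding A(3) using sum_image_le[OF A(2), of "\<lambda>q. q f" "\<lambda>bs f. l1_norm (partial_derivative bs f)"]
      by (simp add: l1_norm_nonneg comp_def)
    then show ?thesis using Q(4)[OF f] Q(3) by (meson mult_left_mono order_trans)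
  qed
  with A(1,2) Q(3) show thesis by (intro that) auto
qed

text \<open>The operators of finite rank approximate the identity on finitely many functions, while the vectors
  \<open>\<psi> j v\<close> spanning their range have seminorms bounded by a constant fixed before these functions and the accuracy. Their
  coefficients are integrals of derivatives over the cells of a partition; it is this form that
  matches \<open>L\<^sup>1\<close> norms of kernels.\<close>

lemma finite_rank_approximation:
  assumes "p \<in> continuous_seminorms (DL1 :: ('a::euclidean_space \<Rightarrow> complex) lcs)"
  obtains m and w :: "nat \<Rightarrow> 'a::euclidean_space list" and C where
    "0 \<le> C" "\<And>j. w j \<in> lists Basis"
    "\<And>F \<eta>. finite F \<Longrightarrow> F \<subseteq> carrier DL1 \<Longrightarrow> 0 < \<eta> \<Longrightarrow>
      \<exists>(\<tau> :: 'a \<Rightarrow> 'a) \<psi>. \<tau> \<in> borel_measurable borel \<and> finite (range \<tau>) \<and>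
        (\<forall>j v. \<psi> j v \<in> carrier DL1 \<and> p (\<psi> j v) \<le> C) \<and>
        (\<forall>f\<in>F. p (\<lambda>x. f x - (\<Sum>(j, v)\<in>{..<m} \<times> range \<tau>.
          (LINT s:(\<tau> -` {v})|lborel. partial_derivative (w j) f s) * \<psi> j v x)) < \<eta>)"
proof -
  obtain A :: "'a list set" and C where A: "finite A" "A \<subseteq> lists Basis" and C: "0 \<le> C"
    and p: "\<And>f. f \<in> carrier DL1 \<Longrightarrow> p f \<le> C * (\<Sum>a\<in>A. l1_norm (partial_derivative a f))"
    using DL1_continuous_seminorm_bound[OF assms] by blast
  obtain as where as: "set as = A" using finite_list[OF A(1)] by blast
  have "concat as \<in> lists Basis" using as A(2) by fastforce
  from derivative_decomposition[OF this] obtain Ks B where B: "0 \<le> B"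
    and Ks: "\<forall>(w, K)\<in>set Ks. w \<in> lists Basis \<and> (\<forall>f\<in>carrier DL1. K f \<in> carrier DL1 \<and>
      (\<forall>a\<in>lists Basis. subseq a (concat as) \<longrightarrow> l1_norm (partial_derivative a (K f)) \<le> B * l1_norm f))"
    and dec: "\<forall>f\<in>carrier DL1. \<forall>a\<in>lists Basis. \<forall>x.
      partial_derivative a f x = (\<Sum>(w, K)\<leftarrow>Ks. partial_derivative w (partial_derivative a (K f)) x)"
    by (elim exE conjE) iprover
  define m where "m = length Ks"
  \<comment> \<open>beyond the length of the list both families are continued by dummy values\<close>
  define w where "w j = (if j < m then fst (Ks ! j) else [])" for j
  define K where "K j = (if j < m then snd (Ks ! j) else (\<lambda>f x. 0))" for j
  have w: "w j \<in> lists Basis" for j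
    using bspec[OF Ks nth_mem[of j Ks]] by (simp add: w_def m_def case_prod_unfold)
  have K: "K j f \<in> carrier DL1" and Kb: "a \<in> A \<Longrightarrow> l1_norm (partial_derivative a (K j f)) \<le> B * l1_norm f"
    if f: "f \<in> carrier DL1" for j f a
  proof -
    have zero: "l1_norm (partial_derivative a (\<lambda>x. 0)) = 0" if "a \<in> A"
      using DL1.seminorm_zero[OF DL1_is_seminorm[of a]] A(2) that by blast
    have "K j f \<in> carrier DL1 \<and> (a \<in> A \<longrightarrow> l1_norm (partial_derivative a (K j f)) \<le> B * l1_norm f)"
    proof (cases "j < m")
      case True
      then have "Ks ! j \<in> set Ks" by (simp add: m_def)
      from bspec[OF Ks this] show ?thesis
        using True f subsetD[OF A(2), of a] subseq_concat[of a as] as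
        by (simp add: K_def case_prod_unfold del: in_lists_conv_set)
    next
      case False
      then show ?thesis
        using zero mult_nonneg_nonneg[OF B l1_norm_nonneg[of f]] by (simp add: K_def DL1_zero)
    qed
    then show "K j f \<in> carrier DL1" "a \<in> A \<Longrightarrow> l1_norm (partial_derivative a (K j f)) \<le> B * l1_norm f" by auto
  qed
  have dec': "partial_derivative a f x = (\<Sum>j<m. partial_derivative (w j) (partial_derivative a (K j f)) x)"
    if "f \<in> carrier DL1" "a \<in> lists Basis" for f a x
  proof -
    have "partial_derivative a f x = (\<Sum>(w, K)\<leftarrow>Ks. partial_derivative w (partial_derivative a (K f)) x)"
      using dec that by blast
    also have "\<dots> = (\<Sum>j<m. partial_derivative (fst (Ks ! j)) (partial_derivative a (snd (Ks ! j) f)) x)"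
      by (simp add: sum_list_sum_nth m_def case_prod_unfold atLeast0LessThan)
    finally show ?thesis by (simp add: w_def K_def)
  qed
  have w_rev: "rev (w j) \<in> lists Basis" for j using w[of j] by auto
  show thesis
  proof (rule that[of "C * (card A * B)" "\<lambda>j. rev (w j)" m])
    show "0 \<le> C * (card A * B)" using C B by simp
    show "rev (w j) \<in> lists Basis" for j by (rule w_rev)
  next
    fix F :: "('a \<Rightarrow> complex) set" and \<eta> :: real
    assume F: "finite F" "F \<subseteq> carrier DL1" and \<eta>: "0 < \<eta>"
    \<comment> \<open>the bound for single derivatives that makes \<open>p\<close> less than \<open>\<eta>\<close>\<close>
    define d where "d = \<eta> / (C * card A + 1)"
    have pos: "0 < C * card A + 1" using C by (simp add: add_nonneg_pos)
    have d: "0 < d" unfolding d_def using \<eta> pos by simp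
    define N where "N = (\<Sum>f\<in>F. \<Sum>a\<in>A. \<Sum>b\<in>Basis. l1_norm (partial_derivative (b # a) f))"
    have N0: "0 \<le> N" unfolding N_def by (intro sum_nonneg l1_norm_nonneg)
    have N: "(\<Sum>b\<in>Basis. l1_norm (partial_derivative (b # a) f)) \<le> N" if "f \<in> F" "a \<in> A" for f a
    proof -
      have "(\<Sum>b\<in>Basis. l1_norm (partial_derivative (b # a) f)) \<le> (\<Sum>a\<in>A. \<Sum>b\<in>Basis. l1_norm (partial_derivative (b # a) f))"
        using that A(1) by (intro member_le_sum[where f = "\<lambda>a. \<Sum>b\<in>Basis. l1_norm (partial_derivative (b # a) f)"]) (auto intro!: sum_nonneg l1_norm_nonneg)
      also have "\<dots> \<le> N"
        unfolding N_def using that F(1)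
        by (intro member_le_sum[where f = "\<lambda>f. \<Sum>a\<in>A. \<Sum>b\<in>Basis. l1_norm (partial_derivative (b # a) f)"]) (auto intro!: sum_nonneg l1_norm_nonneg)
      finally show ?thesis .
    qed
    \<comment> \<open>half of the error is left to mollification, half to discretisation\<close>
    define e where "e = d / (2 * (N + 1))"
    have e: "0 < e" unfolding e_def using d N0 by simp
    have eN: "e * N \<le> d / 2" unfolding e_def using d N0 by (simp add: field_simps)
    have \<psi>: "K j (gaussian e) \<in> carrier DL1" for j by (rule K[OF gaussian_DL1[OF e]])
    obtain \<tau> :: "nat \<Rightarrow> 'a \<Rightarrow> 'a" where \<tau>: "\<And>n. \<tau> n \<in> borel_measurable borel"
      "\<And>n. finite (range (\<tau> n))" "\<And>s. (\<lambda>n. \<tau> n s) \<longlonglongrightarrow> s"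
      using simple_approximations_of_identity by blast
    let ?R = "\<lambda>n f x. f x - (\<Sum>(j, v)\<in>{..<m} \<times> range (\<tau> n).
      (LINT s:(\<tau> n -` {v})|lborel. partial_derivative (rev (w j)) f s) * K j (gaussian e) (x - v))"
    have "\<forall>\<^sub>F n in sequentially. \<forall>f\<in>F. \<forall>a\<in>A. l1_norm (partial_derivative a (?R n f)) < d"
    proof (intro eventually_ball_finite F(1) A(1) ballI)
      fix f a assume fa: "f \<in> F" "a \<in> A"
      have a: "a \<in> lists Basis" and f: "f \<in> carrier DL1" using fa A(2) F(2) by auto
      have "\<forall>\<^sub>F n in sequentially. l1_norm (partial_derivative a (?R n f)) <
          e * (\<Sum>b\<in>Basis. l1_norm (partial_derivative (b # a) f)) + d / 2"
        by (rule translate_approximation[OF f a e _ w \<psi> dec'[OF gaussian_DL1[OF e] a] \<tau>]) (use d in simp)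
      then show "\<forall>\<^sub>F n in sequentially. l1_norm (partial_derivative a (?R n f)) < d"
      proof eventually_elim
        case (elim n)
        have "e * (\<Sum>b\<in>Basis. l1_norm (partial_derivative (b # a) f)) \<le> e * N"
          using N[OF fa] e by (intro mult_left_mono) auto
        with elim eN show ?case by linarith
      qed
    qed
    then obtain n where n: "\<And>f a. f \<in> F \<Longrightarrow> a \<in> A \<Longrightarrow> l1_norm (partial_derivative a (?R n f)) < d"
      unfolding eventually_sequentially by blast
    let ?\<psi> = "\<lambda>j v x. K j (gaussian e) (x - v)"
    have \<psi>': "?\<psi> j v \<in> carrier DL1" for j v by (rule DL1_translate(1)[OF \<psi>])
    have "p (?\<psi> j v) \<le> C * (card A * B)" for j v
    proof -
      have "l1_norm (partial_derivative a (?\<psi> j v)) \<le> B" if a: "a \<in> A" for a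
      proof -
        have a': "a \<in> lists Basis" using a A(2) by blast
        have "l1_norm (partial_derivative a (?\<psi> j v)) = l1_norm (partial_derivative a (K j (gaussian e)))"
          unfolding DL1_translate(2)[OF \<psi> a'] by (rule l1_norm_translate[OF smooth_measurable[OF DL1_smooth[OF \<psi>] a']])
        also have "\<dots> \<le> B" using Kb[OF gaussian_DL1[OF e] a, of j] by (simp add: integral_gaussian(1)[OF e])
        finally show ?thesis .
      qed
      then have "(\<Sum>a\<in>A. l1_norm (partial_derivative a (?\<psi> j v))) \<le> card A * B"
        by (intro sum_bounded_above) auto
      then show ?thesis using p[OF \<psi>'] C by (meson mult_left_mono order_trans)
    qed
    moreover have "p (?R n f) < \<eta>" if f: "f \<in> F" for f
    proof -
      have "?R n f \<in> carrier DL1"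
      proof (rule DL1.diff_closed)
        show "f \<in> carrier DL1" using f F(2) by blast
        show "(\<lambda>x. \<Sum>(j, v)\<in>{..<m} \<times> range (\<tau> n).
            (LINT s:(\<tau> n -` {v})|lborel. partial_derivative (rev (w j)) f s) * ?\<psi> j v x) \<in> carrier DL1"
          unfolding case_prod_unfold by (intro DL1.sum_closed DL1.scale_closed \<psi>')
      qed
      then have "p (?R n f) \<le> C * (\<Sum>a\<in>A. l1_norm (partial_derivative a (?R n f)))" by (rule p)
      also have "\<dots> \<le> C * (card A * d)"
        by (intro mult_left_mono[OF _ C] sum_bounded_above less_imp_le[OF n[OF f]])
      also have "\<dots> < (C * card A + 1) * d" using d by (simp add: algebra_simps)
      also have "\<dots> = \<eta>" using pos by (simp add: d_def)
      finally show ?thesis .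
    qed
    ultimately show "\<exists>(\<tau> :: 'a \<Rightarrow> 'a) \<psi>. \<tau> \<in> borel_measurable borel \<and> finite (range \<tau>) \<and>
        (\<forall>j v. \<psi> j v \<in> carrier DL1 \<and> p (\<psi> j v) \<le> C * (card A * B)) \<and>
        (\<forall>f\<in>F. p (\<lambda>x. f x - (\<Sum>(j, v)\<in>{..<m} \<times> range \<tau>.
          (LINT s:(\<tau> -` {v})|lborel. partial_derivative (rev (w j)) f s) * \<psi> j v x)) < \<eta>)"
      using \<tau>(1,2)[of n] \<psi>'
      by (intro exI[of _ "\<tau> n"] exI[of _ ?\<psi>]) blast
  qed
qed

text \<open>The discretisation of the plain mollification, with the empty word as only word.\<close>

lemma gaussian_translates_dense:
  fixes f :: "'a::euclidean_space \<Rightarrow> complex"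
  assumes f: "f \<in> carrier DL1" and A: "finite A" "A \<subseteq> lists Basis" and \<eta>: "0 < \<eta>"
  obtains e V c where "0 < e" "finite V"
    "\<And>a. a \<in> A \<Longrightarrow> l1_norm (partial_derivative a (\<lambda>x. f x - (\<Sum>v\<in>V. c v * gaussian e (x - v)))) < \<eta>"
proof -
  define N where "N = (\<Sum>a\<in>A. \<Sum>b\<in>Basis. l1_norm (partial_derivative (b # a) f))"
  have N0: "0 \<le> N" unfolding N_def by (intro sum_nonneg l1_norm_nonneg)
  have N: "(\<Sum>b\<in>Basis. l1_norm (partial_derivative (b # a) f)) \<le> N" if "a \<in> A" for a
    unfolding N_def using that A(1)
    by (intro member_le_sum[where f = "\<lambda>a. \<Sum>b\<in>Basis. l1_norm (partial_derivative (b # a) f)"]) (auto intro!: sum_nonneg l1_norm_nonneg)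
  define e where "e = \<eta> / (2 * (N + 1))"
  have e: "0 < e" unfolding e_def using \<eta> N0 by simp
  have eN: "e * N \<le> \<eta> / 2" unfolding e_def using \<eta> N0 by (simp add: field_simps)
  obtain \<tau> :: "nat \<Rightarrow> 'a \<Rightarrow> 'a" where \<tau>: "\<And>n. \<tau> n \<in> borel_measurable borel"
    "\<And>n. finite (range (\<tau> n))" "\<And>s. (\<lambda>n. \<tau> n s) \<longlonglongrightarrow> s"
    using simple_approximations_of_identity by blast
  let ?c = "\<lambda>n v. LINT s:(\<tau> n -` {v})|lborel. f s"
  let ?R = "\<lambda>n x. f x - (\<Sum>v\<in>range (\<tau> n). ?c n v * gaussian e (x - v))"
  have "\<forall>\<^sub>F n in sequentially. \<forall>a\<in>A. l1_norm (partial_derivative a (?R n)) < \<eta>"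
  proof (intro eventually_ball_finite A(1) ballI)
    fix a assume a: "a \<in> A"
    then have a': "a \<in> lists Basis" using A(2) by blast
    have sum_singleton: "(\<Sum>(j, v)\<in>{..<Suc 0} \<times> V. h j v) = (\<Sum>v\<in>V. h 0 v)"
      for h :: "nat \<Rightarrow> 'a \<Rightarrow> complex" and V
      by (simp flip: sum.cartesian_product)
    have "\<forall>\<^sub>F n in sequentially. l1_norm (partial_derivative a (?R n)) <
        e * (\<Sum>b\<in>Basis. l1_norm (partial_derivative (b # a) f)) + \<eta> / 2"
      using translate_approximation[OF f a' e _ _ gaussian_DL1[OF e] _ \<tau>, of "\<eta> / 2" "Suc 0" "\<lambda>j. []"] \<eta>
      unfolding sum_singleton by simp
    then show "\<forall>\<^sub>F n in sequentially. l1_norm (partial_derivative a (?R n)) < \<eta>"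
    proof eventually_elim
      case (elim n)
      have "e * (\<Sum>b\<in>Basis. l1_norm (partial_derivative (b # a) f)) \<le> e * N"
        using N[OF a] e by (intro mult_left_mono) auto
      with elim eN show ?case by linarith
    qed
  qed
  then obtain n where "\<And>a. a \<in> A \<Longrightarrow> l1_norm (partial_derivative a (?R n)) < \<eta>"
    unfolding eventually_sequentially by blast
  then show thesis by (intro that[of e "range (\<tau> n)" "?c n"] e \<tau>(2)) auto
qed

section \<open>Kernels of tensors\<close>

lemma product_integral:
  fixes f :: "'a::euclidean_space \<Rightarrow> 'c::{real_normed_field, banach, second_countable_topology}"
    and g :: "'b::euclidean_space \<Rightarrow> 'c"
  assumes f: "integrable lborel f" and g: "integrable lborel g"
  shows "integrable lborel (\<lambda>(x, y). f x * g y)"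
    and "(LINT z|lborel. (case z of (x, y) \<Rightarrow> f x * g y)) = (LINT x|lborel. f x) * (LINT y|lborel. g y)"
proof -
  have [measurable]: "f \<in> borel_measurable borel" "g \<in> borel_measurable borel" using f g by auto
  have i: "integrable (lborel \<Otimes>\<^sub>M lborel) (\<lambda>(x, y). f x * g y)"
  proof (rule lborel_pair.Fubini_integrable)
    show "integrable lborel (\<lambda>x. LINT y|lborel. norm (case (x, y) of (x, y) \<Rightarrow> f x * g y))"
      using f g by (simp add: norm_mult)
    show "AE x in lborel. integrable lborel (\<lambda>y. case (x, y) of (x, y) \<Rightarrow> f x * g y)"
      using g by simp
  qed (simp add: case_prod_unfold)
  then show "integrable lborel (\<lambda>(x, y). f x * g y)" by (simp add: lborel_prod)
  have "(LINT z|(lborel \<Otimes>\<^sub>M lborel). (case z of (x, y) \<Rightarrow> f x * g y)) = (LINT x|lborel. LINT y|lborel. f x * g y)"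
    using lborel_pair.integral_fst'[OF i] by simp
  also have "\<dots> = (LINT x|lborel. f x) * (LINT y|lborel. g y)" using g f by simp
  finally show "(LINT z|lborel. (case z of (x, y) \<Rightarrow> f x * g y)) = (LINT x|lborel. f x) * (LINT y|lborel. g y)"
    by (simp add: lborel_prod)
qed

lemma l1_norm_product:
  fixes f :: "'a::euclidean_space \<Rightarrow> complex" and g :: "'b::euclidean_space \<Rightarrow> complex"
  assumes f: "integrable lborel f" and g: "integrable lborel g"
  shows "l1_norm (\<lambda>(x, y). f x * g y) = l1_norm f * l1_norm g"
  using product_integral(2)[of "\<lambda>x. cmod (f x)" "\<lambda>y. cmod (g y)"] f g
  by (simp add: l1_norm_def case_prod_unfold norm_mult)

text \<open>A basis vector of a product space has exactly one nonzero component. A word of directions splits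
  accordingly into one word for each factor.\<close>

definition fst_directions :: "('a::zero \<times> 'b) list \<Rightarrow> 'a list" where
  "fst_directions bs = filter (\<lambda>b. b \<noteq> 0) (map fst bs)"

definition snd_directions :: "('a \<times> 'b::zero) list \<Rightarrow> 'b list" where
  "snd_directions bs = filter (\<lambda>b. b \<noteq> 0) (map snd bs)"

lemma directions_in_Basis:
  assumes "bs \<in> lists (Basis :: ('a::euclidean_space \<times> 'b::euclidean_space) set)"
  shows "fst_directions bs \<in> lists Basis" "snd_directions bs \<in> lists Basis"
  using assms by (induction bs) (auto simp: fst_directions_def snd_directions_def Basis_prod_def)

definition product_directions :: "'a::zero list \<Rightarrow> 'b::zero list \<Rightarrow> ('a \<times> 'b) list" where
  "product_directions as bs = map (\<lambda>a. (a, 0)) as @ map (\<lambda>b. (0, b)) bs"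

lemma product_directions:
  assumes "as \<in> lists (Basis :: 'a::euclidean_space set)" "bs \<in> lists (Basis :: 'b::euclidean_space set)"
  shows "product_directions as bs \<in> lists Basis"
    and "fst_directions (product_directions as bs) = as" "snd_directions (product_directions as bs) = bs"
proof -
  have "filter (\<lambda>b. b \<noteq> 0) as = as" "filter (\<lambda>b. b \<noteq> 0) bs = bs"
    using assms by (auto intro!: filter_True)
  then show "product_directions as bs \<in> lists Basis"
    "fst_directions (product_directions as bs) = as" "snd_directions (product_directions as bs) = bs"
    using assms
    by (auto simp: product_directions_def fst_directions_def snd_directions_def Basis_prod_def comp_def)
qed

lemma sum_Basis_prod:
  fixes F :: "'a::euclidean_space \<times> 'b::euclidean_space \<Rightarrow> 'c::comm_monoid_add"
  shows "(\<Sum>b\<in>Basis. F b) = (\<Sum>b\<in>Basis. F (b, 0)) + (\<Sum>b\<in>Basis. F (0, b))"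
  unfolding Basis_prod_def
  by (subst sum.union_disjoint) (auto simp: sum.reindex inj_on_def)

lemma product_derivative_family:
  fixes f :: "'a::euclidean_space \<Rightarrow> complex" and g :: "'b::euclidean_space \<Rightarrow> complex"
  assumes f: "smooth f" and g: "smooth g"
  shows "derivative_family (\<lambda>bs (x, y).
    partial_derivative (fst_directions bs) f x * partial_derivative (snd_directions bs) g y)"
  unfolding derivative_family_def
proof (intro ballI allI)
  fix bs and z :: "'a \<times> 'b" assume bs: "bs \<in> lists (Basis :: ('a \<times> 'b) set)"
  let ?F = "\<lambda>bs. partial_derivative (fst_directions bs) f" and ?G = "\<lambda>bs. partial_derivative (snd_directions bs) g"
  obtain x y where z: "z = (x, y)" by force
  have "((\<lambda>z. ?F bs (fst z)) has_derivative
      (\<lambda>h. \<Sum>b\<in>Basis. (fst h \<bullet> b) *\<^sub>R partial_derivative (b # fst_directions bs) f x)) (at z)"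
    using has_derivative_compose[OF has_derivative_fst[OF has_derivative_ident]
        smooth_has_derivative[OF f directions_in_Basis(1)[OF bs], of "fst z"]] by (simp add: z)
  moreover have "((\<lambda>z. ?G bs (snd z)) has_derivative
      (\<lambda>h. \<Sum>b\<in>Basis. (snd h \<bullet> b) *\<^sub>R partial_derivative (b # snd_directions bs) g y)) (at z)"
    using has_derivative_compose[OF has_derivative_snd[OF has_derivative_ident]
        smooth_has_derivative[OF g directions_in_Basis(2)[OF bs], of "snd z"]] by (simp add: z)
  ultimately have "((\<lambda>z. ?F bs (fst z) * ?G bs (snd z)) has_derivative
      (\<lambda>h. ?F bs (fst z) * (\<Sum>b\<in>Basis. (snd h \<bullet> b) *\<^sub>R partial_derivative (b # snd_directions bs) g y) +
        (\<Sum>b\<in>Basis. (fst h \<bullet> b) *\<^sub>R partial_derivative (b # fst_directions bs) f x) * ?G bs (snd z))) (at z)"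
    by (rule has_derivative_mult)
  moreover have "?F bs (fst z) * (\<Sum>b\<in>Basis. (snd h \<bullet> b) *\<^sub>R partial_derivative (b # snd_directions bs) g y) +
        (\<Sum>b\<in>Basis. (fst h \<bullet> b) *\<^sub>R partial_derivative (b # fst_directions bs) f x) * ?G bs (snd z) =
      (\<Sum>b\<in>Basis. (h \<bullet> b) *\<^sub>R (?F (b # bs) x * ?G (b # bs) y))" for h :: "'a \<times> 'b"
  proof -
    have 1: "?F ((b, 0) # bs) x * ?G ((b, 0) # bs) y = partial_derivative (b # fst_directions bs) f x * ?G bs y"
      if "b \<in> Basis" for b :: 'a
      using that by (simp add: fst_directions_def snd_directions_def nonzero_Basis del: partial_derivative.simps)
    have 2: "?F ((0, b) # bs) x * ?G ((0, b) # bs) y = ?F bs x * partial_derivative (b # snd_directions bs) g y"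
      if "b \<in> Basis" for b :: 'b
      using that by (simp add: fst_directions_def snd_directions_def nonzero_Basis del: partial_derivative.simps)
    have "(\<Sum>b\<in>Basis. (h \<bullet> b) *\<^sub>R (?F (b # bs) x * ?G (b # bs) y)) =
        (\<Sum>b\<in>Basis. (fst h \<bullet> b) *\<^sub>R (?F ((b, 0) # bs) x * ?G ((b, 0) # bs) y)) +
        (\<Sum>b\<in>Basis. (snd h \<bullet> b) *\<^sub>R (?F ((0, b) # bs) x * ?G ((0, b) # bs) y))"
      unfolding sum_Basis_prod by (simp add: inner_prod_def del: partial_derivative.simps)
    also have "\<dots> = (\<Sum>b\<in>Basis. (fst h \<bullet> b) *\<^sub>R (partial_derivative (b # fst_directions bs) f x * ?G bs y)) +
        (\<Sum>b\<in>Basis. (snd h \<bullet> b) *\<^sub>R (?F bs x * partial_derivative (b # snd_directions bs) g y))"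
      by (intro arg_cong2[of _ _ _ _ "(+)"] sum.cong refl) (simp_all only: 1 2)
    finally show ?thesis
      by (simp add: z sum_distrib_left sum_distrib_right add.commute del: partial_derivative.simps)
  qed
  ultimately show "((\<lambda>(x, y). ?F bs x * ?G bs y) has_derivative
      (\<lambda>h. \<Sum>b\<in>Basis. (h \<bullet> b) *\<^sub>R (case z of (x, y) \<Rightarrow> ?F (b # bs) x * ?G (b # bs) y))) (at z)"
    by (simp add: z case_prod_unfold del: partial_derivative.simps)
qed

lemma product_DL1:
  fixes f :: "'a::euclidean_space \<Rightarrow> complex" and g :: "'b::euclidean_space \<Rightarrow> complex"
  assumes f: "f \<in> carrier DL1" and g: "g \<in> carrier DL1"
  shows "(\<lambda>(x, y). f x * g y) \<in> carrier DL1"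
    and "bs \<in> lists Basis \<Longrightarrow> partial_derivative bs (\<lambda>(x, y). f x * g y) =
      (\<lambda>(x, y). partial_derivative (fst_directions bs) f x * partial_derivative (snd_directions bs) g y)"
proof -
  let ?J = "\<lambda>bs (x, y). partial_derivative (fst_directions bs) f x * partial_derivative (snd_directions bs) g y"
  have J: "derivative_family ?J"
    by (rule product_derivative_family[OF DL1_smooth[OF f] DL1_smooth[OF g]])
  have J0: "?J [] = (\<lambda>(x, y). f x * g y)" by (simp add: fst_directions_def snd_directions_def)
  have "?J [] \<in> carrier DL1"
    by (rule DL1_I[OF J]) (intro product_integral(1) DL1_integrable f g directions_in_Basis)
  then show "(\<lambda>(x, y). f x * g y) \<in> carrier DL1" unfolding J0 .
  show "partial_derivative bs (\<lambda>(x, y). f x * g y) = ?J bs" if "bs \<in> lists Basis"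
    using partial_derivative_family[OF J that] unfolding J0 .
qed

interpretation DL1_tensor: tensor_factors
  "DL1 :: ('a::euclidean_space \<Rightarrow> complex) lcs" "DL1 :: ('b::euclidean_space \<Rightarrow> complex) lcs" ..

interpretation DL1_projective: function_lcs
  "projective_tensor (DL1 :: ('a::euclidean_space \<Rightarrow> complex) lcs) (DL1 :: ('b::euclidean_space \<Rightarrow> complex) lcs)"
  by (rule DL1_tensor.projective_tensor_function_lcs)

text \<open>The value of a tensor at the bilinear form \<open>(f, g) \<mapsto> f x * g y\<close>. It is defined without reference to
  a representation as a sum of elementary tensors.\<close>

definition tensor_kernel :: "('a::euclidean_space \<Rightarrow> complex, 'b::euclidean_space \<Rightarrow> complex) tensor \<Rightarrow> 'a \<times> 'b \<Rightarrow> complex" where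
  "tensor_kernel u = (\<lambda>(x, y). u (\<lambda>f g. f x * g y))"

lemma evaluation_bilinear: "bilinear_form DL1 DL1 (\<lambda>f g. f x * g y)"
  by (simp add: bilinear_form_def algebra_simps)

lemma kernel_tensor: "tensor_kernel (tensor DL1 DL1 f g) = (\<lambda>(x, y). f x * g y)"
  by (simp add: tensor_kernel_def tensor_def evaluation_bilinear)

lemma kernel_tensor_sum:
  "tensor_kernel (tensor_sum DL1 DL1 fgs) = (\<lambda>z. \<Sum>i<length fgs. case z of (x, y) \<Rightarrow> fst (fgs ! i) x * snd (fgs ! i) y)"
  by (simp add: tensor_kernel_def tensor_sum_def tensor_def evaluation_bilinear sum_list_sum_nth case_prod_unfold
      atLeast0LessThan fun_eq_iff)

lemma tensor_sum_nth:
  "tensor_sum X Y xys = (\<lambda>B. \<Sum>i<length xys. tensor X Y (fst (xys ! i)) (snd (xys ! i)) B)"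
  by (simp add: tensor_sum_def sum_list_sum_nth case_prod_unfold atLeast0LessThan)

lemma in_lists_product_nth:
  assumes "xys \<in> lists (A \<times> B)" "i < length xys"
  shows "fst (xys ! i) \<in> A" "snd (xys ! i) \<in> B"
proof -
  have "xys ! i \<in> A \<times> B" using assms nth_mem[of i xys] unfolding in_lists_conv_set by blast
  then show "fst (xys ! i) \<in> A" "snd (xys ! i) \<in> B" by auto
qed

lemma kernel_closed_derivative:
  assumes fgs: "fgs \<in> lists (carrier DL1 \<times> carrier DL1)"
  shows "tensor_kernel (tensor_sum DL1 DL1 fgs) \<in> carrier DL1"
    and "bs \<in> lists Basis \<Longrightarrow> partial_derivative bs (tensor_kernel (tensor_sum DL1 DL1 fgs)) =
      (\<lambda>z. \<Sum>i<length fgs. case z of (x, y) \<Rightarrow> partial_derivative (fst_directions bs) (fst (fgs ! i)) x *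
        partial_derivative (snd_directions bs) (snd (fgs ! i)) y)"
proof -
  have p: "(\<lambda>(x, y). fst (fgs ! i) x * snd (fgs ! i) y) \<in> carrier DL1" if "i < length fgs" for i
    using in_lists_product_nth[OF fgs that] by (rule product_DL1(1))
  show "tensor_kernel (tensor_sum DL1 DL1 fgs) \<in> carrier DL1"
    unfolding kernel_tensor_sum by (rule DL1.sum_closed) (use p in simp)
  show "partial_derivative bs (tensor_kernel (tensor_sum DL1 DL1 fgs)) =
      (\<lambda>z. \<Sum>i<length fgs. case z of (x, y) \<Rightarrow> partial_derivative (fst_directions bs) (fst (fgs ! i)) x *
        partial_derivative (snd_directions bs) (snd (fgs ! i)) y)" if bs: "bs \<in> lists Basis"
  proof -
    have "partial_derivative bs (tensor_kernel (tensor_sum DL1 DL1 fgs)) =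
        (\<lambda>z. \<Sum>i<length fgs. partial_derivative bs (\<lambda>(x, y). fst (fgs ! i) x * snd (fgs ! i) y) z)"
      unfolding kernel_tensor_sum by (rule DL1_sum[OF p bs]) simp
    also have "\<dots> = (\<lambda>z. \<Sum>i<length fgs. case z of (x, y) \<Rightarrow>
        partial_derivative (fst_directions bs) (fst (fgs ! i)) x *
        partial_derivative (snd_directions bs) (snd (fgs ! i)) y)"
      by (intro ext sum.cong refl) (simp add: product_DL1(2)[OF in_lists_product_nth[OF fgs] bs])
    finally show ?thesis .
  qed
qed

lemma kernel_linear: "linear_map (projective_tensor DL1 DL1) DL1 tensor_kernel"
  unfolding linear_map_def
proof (intro conjI ballI allI)
  show "tensor_kernel \<in> carrier (projective_tensor DL1 DL1) \<rightarrow> carrier DL1"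
    unfolding DL1_tensor.carrier_projective_tensor Pi_def using kernel_closed_derivative(1) by blast
qed (simp_all add: tensor_kernel_def case_prod_unfold)

text \<open>The derivative of the kernel of an elementary tensor is again a product, and its norm is the product of
  the two norms. The triangle inequality extends this to all representations as sums.\<close>

lemma kernel_bounded:
  fixes u :: "('a::euclidean_space \<Rightarrow> complex, 'b::euclidean_space \<Rightarrow> complex) tensor"
  assumes u: "u \<in> carrier (projective_tensor DL1 DL1)" and bs: "bs \<in> lists Basis"
  shows "l1_norm (partial_derivative bs (tensor_kernel u)) \<le>
    projective_seminorm DL1 DL1 (\<lambda>f. l1_norm (partial_derivative (fst_directions bs) f))
      (\<lambda>g. l1_norm (partial_derivative (snd_directions bs) g)) u"
proof (rule DL1_tensor.projective_seminorm_greatest[OF DL1_is_seminorm DL1_is_seminorm u])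
  note dirs = directions_in_Basis[OF bs]
  show "fst_directions bs \<in> lists Basis" "snd_directions bs \<in> lists Basis" by fact+
  fix fgs :: "(('a \<Rightarrow> complex) \<times> ('b \<Rightarrow> complex)) list"
  assume fgs: "fgs \<in> lists (carrier DL1 \<times> carrier DL1)" and eq: "tensor_sum DL1 DL1 fgs = u"
  let ?f = "\<lambda>i. partial_derivative (fst_directions bs) (fst (fgs ! i))"
    and ?g = "\<lambda>i. partial_derivative (snd_directions bs) (snd (fgs ! i))"
  have i: "integrable lborel (?f i)" "integrable lborel (?g i)" if "i < length fgs" for i
    using in_lists_product_nth[OF fgs that] dirs DL1_integrable by auto
  have "l1_norm (partial_derivative bs (tensor_kernel u)) = l1_norm (\<lambda>z. \<Sum>i<length fgs. (\<lambda>(x, y). ?f i x * ?g i y) z)"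
    using kernel_closed_derivative(2)[OF fgs bs] by (simp add: eq)
  also have "\<dots> \<le> (\<Sum>i<length fgs. l1_norm (\<lambda>(x, y). ?f i x * ?g i y))"
    by (intro l1_norm_sum product_integral(1) i) auto
  also have "\<dots> = (\<Sum>i<length fgs. l1_norm (?f i) * l1_norm (?g i))"
    by (intro sum.cong refl l1_norm_product i) auto
  also have "\<dots> = (\<Sum>(f, g)\<leftarrow>fgs. l1_norm (partial_derivative (fst_directions bs) f) *
      l1_norm (partial_derivative (snd_directions bs) g))"
    by (simp add: sum_list_sum_nth case_prod_unfold atLeast0LessThan)
  finally show "l1_norm (partial_derivative bs (tensor_kernel u)) \<le> (\<Sum>(f, g)\<leftarrow>fgs.
      l1_norm (partial_derivative (fst_directions bs) f) * l1_norm (partial_derivative (snd_directions bs) g))" .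
qed

section \<open>The kernel theorem\<close>

lemma set_integral_product:
  fixes f :: "'a::euclidean_space \<Rightarrow> complex" and g :: "'b::euclidean_space \<Rightarrow> complex"
  assumes f: "integrable lborel f" and g: "integrable lborel g" and Q: "Q \<in> sets borel" and R: "R \<in> sets borel"
  shows "(LINT s:Q|lborel. f s) * (LINT t:R|lborel. g t) = (LINT z:(Q \<times> R)|lborel. case z of (x, y) \<Rightarrow> f x * g y)"
proof -
  have "integrable lborel (\<lambda>s. indicator Q s *\<^sub>R f s)" "integrable lborel (\<lambda>t. indicator R t *\<^sub>R g t)"
    using f g Q R by (auto intro: integrable_mult_indicator)
  from product_integral(2)[OF this] show ?thesis
    by (simp add: set_lebesgue_integral_def case_prod_unfold indicator_times mult_ac)
qed

text \<open>The \<open>L\<^sup>1\<close> norm is additive over the cells of a partition. This is the reason why projective tensor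
  products fit spaces modelled on \<open>L\<^sup>1\<close>.\<close>

lemma sum_norm_set_integrals_le_l1_norm:
  fixes H :: "'a::euclidean_space \<times> 'b::euclidean_space \<Rightarrow> complex"
  assumes H: "integrable lborel H" and \<tau>: "\<tau> \<in> borel_measurable borel" "finite (range \<tau>)"
    and \<tau>': "\<tau>' \<in> borel_measurable borel" "finite (range \<tau>')"
  shows "(\<Sum>v\<in>range (\<tau> :: 'a \<Rightarrow> 'a). \<Sum>v'\<in>range (\<tau>' :: 'b \<Rightarrow> 'b).
    cmod (LINT z:(\<tau> -` {v} \<times> \<tau>' -` {v'})|lborel. H z)) \<le> l1_norm H"
proof -
  let ?S = "\<lambda>v v'. \<tau> -` {v} \<times> \<tau>' -` {v'}"
  have sets: "?S v v' \<in> sets lborel" for v v'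
    using measurable_sets[OF \<tau>(1), of "{v}"] measurable_sets[OF \<tau>'(1), of "{v'}"] by (simp add: borel_Times)
  have i: "integrable lborel (\<lambda>z. indicator (?S v v') z *\<^sub>R cmod (H z))" for v v'
    by (rule integrable_mult_indicator[OF sets integrable_norm[OF H]])
  have one: "(\<Sum>v\<in>range \<tau>. \<Sum>v'\<in>range \<tau>'. indicator (?S v v') z *\<^sub>R cmod (H z)) = cmod (H z)" for z
  proof -
    obtain x y where z: "z = (x, y)" by force
    have "indicator (?S v v') z *\<^sub>R cmod (H z) = (if v' = \<tau>' y then (if v = \<tau> x then cmod (H z) else 0) else 0)" for v v'
      by (auto simp: z indicator_def)
    then have "(\<Sum>v'\<in>range \<tau>'. indicator (?S v v') z *\<^sub>R cmod (H z)) = (if v = \<tau> x then cmod (H z) else 0)" for v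
      using \<tau>'(2) by (simp only: sum.delta) simp
    then show ?thesis using \<tau>(2) by simp
  qed
  have "(\<Sum>v\<in>range \<tau>. \<Sum>v'\<in>range \<tau>'. cmod (LINT z:?S v v'|lborel. H z)) \<le>
      (\<Sum>v\<in>range \<tau>. \<Sum>v'\<in>range \<tau>'. LINT z|lborel. indicator (?S v v') z *\<^sub>R cmod (H z))"
  proof (intro sum_mono)
    fix v v'
    show "cmod (LINT z:?S v v'|lborel. H z) \<le> (LINT z|lborel. indicator (?S v v') z *\<^sub>R cmod (H z))"
      unfolding set_lebesgue_integral_def
      by (rule order_trans[OF integral_norm_bound]) simp
  qed
  also have "\<dots> = (LINT z|lborel. (\<Sum>v\<in>range \<tau>. \<Sum>v'\<in>range \<tau>'. indicator (?S v v') z *\<^sub>R cmod (H z)))"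
    using i by (simp add: Bochner_Integration.integral_sum Bochner_Integration.integrable_sum)
  also have "\<dots> = l1_norm H" unfolding one by (simp add: l1_norm_def)
  finally show ?thesis .
qed

lemma tensor_expansion:
  assumes "\<And>k. k \<in> K \<Longrightarrow> a k \<in> carrier DL1" "\<And>l. l \<in> L \<Longrightarrow> b l \<in> carrier DL1"
  shows "tensor DL1 DL1 (\<lambda>x. \<Sum>k\<in>K. c k * a k x) (\<lambda>y. \<Sum>l\<in>L. d l * b l y) =
    (\<lambda>B. \<Sum>k\<in>K. \<Sum>l\<in>L. (c k * d l) * tensor DL1 DL1 (a k) (b l) B)"
proof -
  have "(\<lambda>y. \<Sum>l\<in>L. d l * b l y) \<in> carrier DL1" by (intro DL1.sum_closed DL1.scale_closed assms(2))
  then show ?thesis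
    by (simp add: DL1_tensor.tensor_sum_left[OF assms(1)] DL1_tensor.tensor_sum_right[OF assms(1) assms(2)]
        sum_distrib_left mult.assoc)
qed

text \<open>Let \<open>T\<close> and \<open>T'\<close> be approximations of the identity by operators of finite rank on the two
  factors. A tensor is the sum of its image under \<open>T \<otimes> T'\<close> and of a remainder of small projective
  seminorm. The image is a sum of elementary tensors of bounded seminorms, and the moduli of its
  coefficients, integrals of derivatives of the kernel over products of cells, add up to at most \<open>L\<^sup>1\<close>
  norms of these derivatives.\<close>

lemma kernel_embedding:
  fixes p :: "('a::euclidean_space \<Rightarrow> complex) \<Rightarrow> real" and q :: "('b::euclidean_space \<Rightarrow> complex) \<Rightarrow> real"
  assumes p: "p \<in> continuous_seminorms DL1" and q: "q \<in> continuous_seminorms DL1"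
  obtains W and C where "finite W" "W \<subseteq> lists (Basis :: ('a::euclidean_space \<times> 'b::euclidean_space) set)" "0 \<le> C"
    "\<And>u. u \<in> carrier (projective_tensor DL1 DL1) \<Longrightarrow> projective_seminorm DL1 DL1 p q u \<le>
      C * (\<Sum>w\<in>W. l1_norm (partial_derivative w (tensor_kernel u)))"
proof -
  have sp: "is_seminorm DL1 p" and sq: "is_seminorm DL1 q"
    using p q by (auto simp: continuous_seminorms_def)
  let ?\<pi> = "projective_seminorm DL1 DL1 p q"
  have s\<pi>: "is_seminorm (projective_tensor DL1 DL1) ?\<pi>"
    by (rule DL1_tensor.projective_seminorm_is_seminorm[OF sp sq])
  obtain m and w :: "nat \<Rightarrow> 'a list" and C where C: "0 \<le> C" and w: "\<And>j. w j \<in> lists Basis"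
    and ap: "\<And>F \<eta>. finite F \<Longrightarrow> F \<subseteq> carrier DL1 \<Longrightarrow> 0 < \<eta> \<Longrightarrow>
      \<exists>(\<tau> :: 'a \<Rightarrow> 'a) \<psi>. \<tau> \<in> borel_measurable borel \<and> finite (range \<tau>) \<and>
        (\<forall>j v. \<psi> j v \<in> carrier DL1 \<and> p (\<psi> j v) \<le> C) \<and>
        (\<forall>f\<in>F. p (\<lambda>x. f x - (\<Sum>(j, v)\<in>{..<m} \<times> range \<tau>.
          (LINT s:(\<tau> -` {v})|lborel. partial_derivative (w j) f s) * \<psi> j v x)) < \<eta>)"
    by (rule finite_rank_approximation[OF p], rule that)
  obtain m' and w' :: "nat \<Rightarrow> 'b list" and C' where C': "0 \<le> C'" and w': "\<And>j. w' j \<in> lists Basis"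
    and aq: "\<And>F \<eta>. finite F \<Longrightarrow> F \<subseteq> carrier DL1 \<Longrightarrow> 0 < \<eta> \<Longrightarrow>
      \<exists>(\<tau> :: 'b \<Rightarrow> 'b) \<psi>. \<tau> \<in> borel_measurable borel \<and> finite (range \<tau>) \<and>
        (\<forall>j v. \<psi> j v \<in> carrier DL1 \<and> q (\<psi> j v) \<le> C') \<and>
        (\<forall>f\<in>F. q (\<lambda>x. f x - (\<Sum>(j, v)\<in>{..<m'} \<times> range \<tau>.
          (LINT s:(\<tau> -` {v})|lborel. partial_derivative (w' j) f s) * \<psi> j v x)) < \<eta>)"
    by (rule finite_rank_approximation[OF q], rule that)
  let ?W = "\<lambda>(j, j'). product_directions (w j) (w' j')"
  let ?JJ = "{..<m} \<times> {..<m'}"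
  have W: "?W jj \<in> lists Basis" for jj
    using product_directions(1)[OF w w'] by (cases jj) simp
  have main: "?\<pi> u \<le> (C * C') * (\<Sum>jj\<in>?JJ. l1_norm (partial_derivative (?W jj) (tensor_kernel u)))"
    if u: "u \<in> carrier (projective_tensor DL1 DL1)" for u
  proof (rule field_le_epsilon)
    fix \<delta> :: real assume \<delta>: "0 < \<delta>"
    obtain fgs where fgs: "fgs \<in> lists (carrier DL1 \<times> carrier DL1)" "u = tensor_sum DL1 DL1 fgs"
      using u unfolding DL1_tensor.carrier_projective_tensor by blast
    define n where "n = length fgs"
    define f where "f i = fst (fgs ! i)" for i
    define g where "g i = snd (fgs ! i)" for i
    have f: "f i \<in> carrier DL1" and g: "g i \<in> carrier DL1" if "i < n" for i
      using in_lists_product_nth[OF fgs(1)] that by (auto simp: f_def g_def n_def)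
    have u_eq: "u = (\<lambda>B. \<Sum>i<n. tensor DL1 DL1 (f i) (g i) B)"
      by (simp add: fgs(2) tensor_sum_nth f_def g_def n_def)
    have small: "\<exists>\<eta>>0. \<eta> * s < \<delta> / 2" if "0 \<le> s" for s
    proof -
      have "\<delta> / (2 * (s + 1)) * s < \<delta> / 2" using that \<delta> by (simp add: field_simps)
      then show ?thesis using that \<delta> by (intro exI[of _ "\<delta> / (2 * (s + 1))"]) auto
    qed
    have qs: "0 \<le> (\<Sum>i<n. q (g i))" by (intro sum_nonneg DL1.seminorm_nonneg[OF sq] g) simp
    \<comment> \<open>the second accuracy is chosen after the first operator, whose values enter the bound for the remainder\<close>
    obtain \<eta> where \<eta>: "0 < \<eta>" "\<eta> * (\<Sum>i<n. q (g i)) < \<delta> / 2" using small[OF qs] by blast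
    have "finite (f ` {..<n})" "f ` {..<n} \<subseteq> carrier DL1" using f by auto
    from ap[OF this \<eta>(1)] obtain \<tau> :: "'a \<Rightarrow> 'a" and \<psi>
      where \<tau>: "\<tau> \<in> borel_measurable borel" "finite (range \<tau>)"
      and \<psi>_all: "\<forall>j v. \<psi> j v \<in> carrier DL1 \<and> p (\<psi> j v) \<le> C"
      and p\<eta>: "\<forall>f\<in>f ` {..<n}. p (\<lambda>x. f x - (\<Sum>(j, v)\<in>{..<m} \<times> range \<tau>.
          (LINT s:(\<tau> -` {v})|lborel. partial_derivative (w j) f s) * \<psi> j v x)) < \<eta>"
      by (elim exE conjE) iprover
    have \<psi>: "\<psi> j v \<in> carrier DL1" "p (\<psi> j v) \<le> C" for j v
      using \<psi>_all by auto
    define c where "c i k = (LINT s:(\<tau> -` {snd k})|lborel. partial_derivative (w (fst k)) (f i) s)" for i k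
    define a where "a k = \<psi> (fst k) (snd k)" for k
    let ?K = "{..<m} \<times> range \<tau>"
    define Tf where "Tf i x = (\<Sum>k\<in>?K. c i k * a k x)" for i x
    have a: "a k \<in> carrier DL1" and pa: "p (a k) \<le> C" for k by (simp_all add: a_def \<psi>)
    have Tf: "Tf i \<in> carrier DL1" for i
      unfolding Tf_def[abs_def] by (intro DL1.sum_closed DL1.scale_closed a)
    have p\<eta>': "p (\<lambda>x. f i x - Tf i x) < \<eta>" if "i < n" for i
      using p\<eta> that by (simp add: Tf_def c_def a_def case_prod_unfold)
    have ps: "0 \<le> (\<Sum>i<n. p (Tf i))" by (intro sum_nonneg DL1.seminorm_nonneg[OF sp] Tf)
    obtain \<eta>' where \<eta>': "0 < \<eta>'" "\<eta>' * (\<Sum>i<n. p (Tf i)) < \<delta> / 2" using small[OF ps] by blast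
    have "finite (g ` {..<n})" "g ` {..<n} \<subseteq> carrier DL1" using g by auto
    from aq[OF this \<eta>'(1)] obtain \<tau>' :: "'b \<Rightarrow> 'b" and \<psi>'
      where \<tau>': "\<tau>' \<in> borel_measurable borel" "finite (range \<tau>')"
      and \<psi>_all': "\<forall>j v. \<psi>' j v \<in> carrier DL1 \<and> q (\<psi>' j v) \<le> C'"
      and q\<eta>: "\<forall>f\<in>g ` {..<n}. q (\<lambda>x. f x - (\<Sum>(j, v)\<in>{..<m'} \<times> range \<tau>'.
          (LINT s:(\<tau>' -` {v})|lborel. partial_derivative (w' j) f s) * \<psi>' j v x)) < \<eta>'"
      by (elim exE conjE) iprover
    have \<psi>': "\<psi>' j v \<in> carrier DL1" "q (\<psi>' j v) \<le> C'" for j v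
      using \<psi>_all' by auto
    define d where "d i l = (LINT s:(\<tau>' -` {snd l})|lborel. partial_derivative (w' (fst l)) (g i) s)" for i l
    define b where "b l = \<psi>' (fst l) (snd l)" for l
    let ?L = "{..<m'} \<times> range \<tau>'"
    define Tg where "Tg i y = (\<Sum>l\<in>?L. d i l * b l y)" for i y
    have b: "b l \<in> carrier DL1" and qb: "q (b l) \<le> C'" for l by (simp_all add: b_def \<psi>')
    have Tg: "Tg i \<in> carrier DL1" for i
      unfolding Tg_def[abs_def] by (intro DL1.sum_closed DL1.scale_closed b)
    have q\<eta>': "q (\<lambda>y. g i y - Tg i y) < \<eta>'" if "i < n" for i
      using q\<eta> that by (simp add: Tg_def d_def b_def case_prod_unfold)
    \<comment> \<open>\<open>r i\<close> is the remainder \<open>f \<otimes> g - T f \<otimes> T' g\<close>, and the \<open>t kl\<close> are the terms of the image under \<open>T \<otimes> T'\<close>\<close>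
    define r where "r i = (\<lambda>B. tensor DL1 DL1 (\<lambda>x. f i x - Tf i x) (g i) B + tensor DL1 DL1 (Tf i) (\<lambda>y. g i y - Tg i y) B)" for i
    define t where "t kl = (\<lambda>B. (\<Sum>i<n. c i (fst kl) * d i (snd kl)) * tensor DL1 DL1 (a (fst kl)) (b (snd kl)) B)" for kl
    have tensor_closed: "tensor DL1 DL1 x y \<in> carrier (projective_tensor DL1 DL1)"
      if "x \<in> carrier DL1" "y \<in> carrier DL1" for x :: "'a \<Rightarrow> complex" and y :: "'b \<Rightarrow> complex"
      using that by (rule DL1_tensor.tensor_in_carrier)
    have r: "r i \<in> carrier (projective_tensor DL1 DL1)" if "i < n" for i
      unfolding r_def by (intro DL1_projective.add_closed tensor_closed DL1.diff_closed f g Tf Tg that)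
    have t: "t kl \<in> carrier (projective_tensor DL1 DL1)" for kl
      unfolding t_def by (intro DL1_projective.scale_closed tensor_closed a b)
    have decomposition: "u = (\<lambda>B. (\<Sum>i<n. r i B) + (\<Sum>kl\<in>?K \<times> ?L. t kl B))"
    proof
      fix B
      have "tensor DL1 DL1 (f i) (g i) B = r i B + tensor DL1 DL1 (Tf i) (Tg i) B" if "i < n" for i
        unfolding r_def
        by (simp add: DL1_tensor.tensor_diff_left[OF f[OF that] Tf g[OF that]]
            DL1_tensor.tensor_diff_right[OF Tf g[OF that] Tg])
      then have "u B = (\<Sum>i<n. r i B) + (\<Sum>i<n. tensor DL1 DL1 (Tf i) (Tg i) B)"
        unfolding u_eq by (simp add: sum.distrib)
      also have "(\<Sum>i<n. tensor DL1 DL1 (Tf i) (Tg i) B) =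
          (\<Sum>i<n. \<Sum>kl\<in>?K \<times> ?L. (c i (fst kl) * d i (snd kl)) * tensor DL1 DL1 (a (fst kl)) (b (snd kl)) B)"
        unfolding Tf_def[abs_def] Tg_def[abs_def] tensor_expansion[OF a b]
        by (simp add: sum.cartesian_product case_prod_unfold)
      also have "\<dots> = (\<Sum>kl\<in>?K \<times> ?L. t kl B)"
        unfolding t_def sum_distrib_right by (rule sum.swap)
      finally show "u B = (\<Sum>i<n. r i B) + (\<Sum>kl\<in>?K \<times> ?L. t kl B)" .
    qed
    have rest: "?\<pi> (\<lambda>B. \<Sum>i<n. r i B) \<le> \<delta>"
    proof -
      have "?\<pi> (r i) \<le> \<eta> * q (g i) + \<eta>' * p (Tf i)" if i: "i < n" for i
      proof -
        have "?\<pi> (r i) \<le> ?\<pi> (tensor DL1 DL1 (\<lambda>x. f i x - Tf i x) (g i)) + ?\<pi> (tensor DL1 DL1 (Tf i) (\<lambda>y. g i y - Tg i y))"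
          unfolding r_def by (intro DL1_projective.seminorm_add[OF s\<pi>] tensor_closed DL1.diff_closed f g Tf Tg i)
        also have "\<dots> \<le> p (\<lambda>x. f i x - Tf i x) * q (g i) + p (Tf i) * q (\<lambda>y. g i y - Tg i y)"
          by (intro add_mono DL1_tensor.projective_seminorm_tensor[OF sp sq] DL1.diff_closed f g Tf Tg i)
        also have "\<dots> \<le> \<eta> * q (g i) + p (Tf i) * \<eta>'"
          by (intro add_mono mult_right_mono mult_left_mono less_imp_le[OF p\<eta>'[OF i]] less_imp_le[OF q\<eta>'[OF i]]
              DL1.seminorm_nonneg[OF sp] DL1.seminorm_nonneg[OF sq] Tf g i)
        finally show ?thesis by (simp add: mult.commute)
      qed
      then have "(\<Sum>i<n. ?\<pi> (r i)) \<le> (\<Sum>i<n. \<eta> * q (g i) + \<eta>' * p (Tf i))" by (intro sum_mono) simp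
      also have "\<dots> = \<eta> * (\<Sum>i<n. q (g i)) + \<eta>' * (\<Sum>i<n. p (Tf i))"
        by (simp add: sum.distrib sum_distrib_left)
      also have "\<dots> \<le> \<delta>" using \<eta>(2) \<eta>'(2) by simp
      finally show ?thesis
        using DL1_projective.seminorm_sum[OF s\<pi>, of "{..<n}" r] r by fastforce
    qed
    \<comment> \<open>the coefficients are integrals of derivatives of the kernel over the cells of a product partition\<close>
    define H where "H jj = partial_derivative (?W jj) (tensor_kernel u)" for jj
    have H: "H (j, j') = (\<lambda>z. \<Sum>i<n. case z of (x, y) \<Rightarrow> partial_derivative (w j) (f i) x * partial_derivative (w' j') (g i) y)" for j j'
      unfolding H_def fgs(2) using kernel_closed_derivative(2)[OF fgs(1) W, of "(j, j')"]
      by (simp add: product_directions[OF w w'] f_def g_def n_def)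
    have Hi: "integrable lborel (H jj)" for jj
      unfolding H_def fgs(2) by (rule DL1_integrable[OF kernel_closed_derivative(1)[OF fgs(1)] W])
    have cells: "\<tau> -` {v} \<in> sets borel" "\<tau>' -` {v'} \<in> sets borel" for v v'
      using measurable_sets[OF \<tau>(1), of "{v}"] measurable_sets[OF \<tau>'(1), of "{v'}"] by simp_all
    have coeff: "(\<Sum>i<n. c i (j, v) * d i (j', v')) = (LINT z:(\<tau> -` {v} \<times> \<tau>' -` {v'})|lborel. H (j, j') z)" for j v j' v'
    proof -
      let ?h = "\<lambda>i z. case z of (x, y) \<Rightarrow> partial_derivative (w j) (f i) x * partial_derivative (w' j') (g i) y"
      have "c i (j, v) * d i (j', v') = (LINT z|lborel. indicator (\<tau> -` {v} \<times> \<tau>' -` {v'}) z *\<^sub>R ?h i z)" if "i < n" for i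
        unfolding c_def d_def
        using set_integral_product[OF DL1_integrable[OF f[OF that] w] DL1_integrable[OF g[OF that] w'] cells]
        by (simp add: set_lebesgue_integral_def)
      then have "(\<Sum>i<n. c i (j, v) * d i (j', v')) =
          (\<Sum>i<n. LINT z|lborel. indicator (\<tau> -` {v} \<times> \<tau>' -` {v'}) z *\<^sub>R ?h i z)" by simp
      also have "\<dots> = (LINT z|lborel. (\<Sum>i<n. indicator (\<tau> -` {v} \<times> \<tau>' -` {v'}) z *\<^sub>R ?h i z))"
      proof (rule Bochner_Integration.integral_sum[symmetric])
        fix i assume "i \<in> {..<n}"
        then have i: "i < n" by simp
        have "\<tau> -` {v} \<times> \<tau>' -` {v'} \<in> sets lborel" using cells by (simp add: borel_Times)
        then show "integrable lborel (\<lambda>z. indicator (\<tau> -` {v} \<times> \<tau>' -` {v'}) z *\<^sub>R ?h i z)"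
          by (rule integrable_mult_indicator) (intro product_integral(1) DL1_integrable f g i w w')
      qed
      finally show ?thesis
        by (simp add: set_lebesgue_integral_def H scaleR_sum_right)
    qed
    have "?\<pi> (\<lambda>B. \<Sum>kl\<in>?K \<times> ?L. t kl B) \<le> (\<Sum>kl\<in>?K \<times> ?L. ?\<pi> (t kl))"
      by (rule DL1_projective.seminorm_sum[OF s\<pi> t])
    also have "\<dots> \<le> (\<Sum>kl\<in>?K \<times> ?L. (C * C') * cmod (\<Sum>i<n. c i (fst kl) * d i (snd kl)))"
    proof (rule sum_mono)
      fix kl
      have "?\<pi> (tensor DL1 DL1 (a (fst kl)) (b (snd kl))) \<le> p (a (fst kl)) * q (b (snd kl))"
        by (rule DL1_tensor.projective_seminorm_tensor[OF sp sq a b])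
      also have "\<dots> \<le> C * C'"
        by (intro mult_mono pa qb C DL1.seminorm_nonneg[OF sq] b)
      finally show "?\<pi> (t kl) \<le> (C * C') * cmod (\<Sum>i<n. c i (fst kl) * d i (snd kl))"
        unfolding t_def DL1_projective.seminorm_scale[OF s\<pi> tensor_closed[OF a b]]
        by (simp add: mult.commute[of "cmod _"] mult_right_mono)
    qed
    also have "\<dots> = (C * C') * (\<Sum>(j, v)\<in>?K. \<Sum>(j', v')\<in>?L. cmod (\<Sum>i<n. c i (j, v) * d i (j', v')))"
      by (simp add: sum_distrib_left sum.cartesian_product case_prod_unfold)
    also have "(\<Sum>(j, v)\<in>?K. \<Sum>(j', v')\<in>?L. cmod (\<Sum>i<n. c i (j, v) * d i (j', v'))) =
        (\<Sum>j<m. \<Sum>v\<in>range \<tau>. \<Sum>j'<m'. \<Sum>v'\<in>range \<tau>'. cmod (LINT z:(\<tau> -` {v} \<times> \<tau>' -` {v'})|lborel. H (j, j') z))"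
      unfolding coeff by (simp flip: sum.cartesian_product)
    also have "\<dots> = (\<Sum>j<m. \<Sum>j'<m'. \<Sum>v\<in>range \<tau>. \<Sum>v'\<in>range \<tau>'. cmod (LINT z:(\<tau> -` {v} \<times> \<tau>' -` {v'})|lborel. H (j, j') z))"
      by (intro sum.cong refl sum.swap)
    also have "\<dots> \<le> (\<Sum>j<m. \<Sum>j'<m'. l1_norm (H (j, j')))"
      by (intro sum_mono sum_norm_set_integrals_le_l1_norm Hi \<tau> \<tau>')
    also have "\<dots> = (\<Sum>jj\<in>?JJ. l1_norm (H jj))"
      by (simp add: sum.cartesian_product)
    finally have "?\<pi> (\<lambda>B. \<Sum>kl\<in>?K \<times> ?L. t kl B) \<le> (C * C') * (\<Sum>jj\<in>?JJ. l1_norm (H jj))"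
      using C C' by (simp add: mult_left_mono)
    moreover have "?\<pi> u \<le> ?\<pi> (\<lambda>B. \<Sum>i<n. r i B) + ?\<pi> (\<lambda>B. \<Sum>kl\<in>?K \<times> ?L. t kl B)"
      by (subst decomposition, rule DL1_projective.seminorm_add[OF s\<pi>])
        (use r t in \<open>auto intro!: DL1_projective.sum_closed\<close>)
    ultimately show "?\<pi> u \<le> (C * C') * (\<Sum>jj\<in>?JJ. l1_norm (partial_derivative (?W jj) (tensor_kernel u))) + \<delta>"
      using rest by (simp add: H_def)
  qed
  let ?V = "?W ` ?JJ"
  show thesis
  proof (rule that[of ?V "(C * C') * card ?JJ"])
    show "finite ?V" by simp
    show "?V \<subseteq> lists Basis" using W by blast
    show "0 \<le> C * C' * card ?JJ" using C C' by simp
    fix u :: "('a \<Rightarrow> complex, 'b \<Rightarrow> complex) tensor" assume u: "u \<in> carrier (projective_tensor DL1 DL1)"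
    have "(\<Sum>jj\<in>?JJ. l1_norm (partial_derivative (?W jj) (tensor_kernel u))) \<le>
        card ?JJ * (\<Sum>w\<in>?V. l1_norm (partial_derivative w (tensor_kernel u)))"
      by (intro sum_bounded_above member_le_sum[where f = "\<lambda>w. l1_norm (partial_derivative w (tensor_kernel u))"])
        (auto simp: l1_norm_nonneg)
    then show "?\<pi> u \<le> (C * C') * card ?JJ * (\<Sum>w\<in>?V. l1_norm (partial_derivative w (tensor_kernel u)))"
      using main[OF u] mult_left_mono[of _ _ "C * C'"] C C'
      by (smt (verit) mult.assoc mult_nonneg_nonneg)
  qed
qed

text \<open>Translates of Gaussians on the product space are elementary tensors of translates of Gaussians.\<close>

lemma kernel_dense:
  fixes z :: "'a::euclidean_space \<times> 'b::euclidean_space \<Rightarrow> complex"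
  assumes z: "z \<in> carrier DL1" and Q: "finite Q" "Q \<subseteq> seminorms DL1" and e: "0 < e"
  shows "\<exists>u\<in>carrier (projective_tensor DL1 DL1). \<forall>q\<in>Q. q (\<lambda>i. tensor_kernel u i - z i) < e"
proof -
  obtain A where A: "A \<subseteq> lists Basis" "finite A" "Q = (\<lambda>bs f. l1_norm (partial_derivative bs f)) ` A"
    using finite_subset_image[OF Q(1), of "\<lambda>bs f. l1_norm (partial_derivative bs f)" "lists Basis"] Q(2)
    unfolding DL1_seminorms by blast
  obtain \<epsilon> V c where \<epsilon>: "0 < \<epsilon>" and V: "finite V"
    and approx: "\<And>a. a \<in> A \<Longrightarrow> l1_norm (partial_derivative a (\<lambda>x. z x - (\<Sum>v\<in>V. c v * gaussian \<epsilon> (x - v)))) < e"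
    using gaussian_translates_dense[OF z A(2,1) e] by blast
  define s :: "'a \<times> 'b \<Rightarrow> ('a \<Rightarrow> complex, 'b \<Rightarrow> complex) tensor" where
    "s v = tensor DL1 DL1 (\<lambda>x. gaussian \<epsilon> (x - fst v)) (\<lambda>y. gaussian \<epsilon> (y - snd v))" for v
  define u where "u = (\<lambda>B. \<Sum>v\<in>V. c v * s v B)"
  have u: "u \<in> carrier (projective_tensor DL1 DL1)"
    unfolding u_def s_def
    by (intro DL1_projective.sum_closed DL1_projective.scale_closed DL1_tensor.tensor_in_carrier
        DL1_translate(1) gaussian_DL1 \<epsilon>)
  have "tensor_kernel (s v) x = gaussian \<epsilon> (x - v)" for v x
    unfolding s_def kernel_tensor by (cases x; cases v) (simp add: gaussian_prod)
  then have ku: "tensor_kernel u = (\<lambda>x. \<Sum>v\<in>V. c v * gaussian \<epsilon> (x - v))"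
    by (auto simp: tensor_kernel_def u_def fun_eq_iff case_prod_unfold)
  have kc: "tensor_kernel u \<in> carrier DL1" using kernel_linear u by (auto simp: linear_map_def)
  have "l1_norm (partial_derivative a (\<lambda>i. tensor_kernel u i - z i)) < e" if a: "a \<in> A" for a
  proof -
    have a': "a \<in> lists Basis" using a A(1) by blast
    show ?thesis
      using approx[OF a] DL1.seminorm_commute[OF DL1_is_seminorm[OF a'] kc z]
      unfolding ku by simp
  qed
  then show ?thesis using u A(3) by (intro bexI[of _ u]) auto
qed

lemma DL1_generator_continuous:
  assumes "bs \<in> lists Basis"
  shows "(\<lambda>f. l1_norm (partial_derivative bs f)) \<in> continuous_seminorms DL1"
proof (rule DL1.generators_continuous)
  show "(\<lambda>f. l1_norm (partial_derivative bs f)) \<in> seminorms DL1"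
    unfolding DL1_seminorms using assms by (rule imageI)
qed

lemma tensor_kernel_dense_embedding:
  "dense_embedding (projective_tensor DL1 DL1)
    (DL1 :: ('a::euclidean_space \<times> 'b::euclidean_space \<Rightarrow> complex) lcs) tensor_kernel"
proof
  show "linear_map (projective_tensor DL1 DL1) DL1 (tensor_kernel :: _ \<Rightarrow> 'a \<times> 'b \<Rightarrow> complex)"
    by (rule kernel_linear)
  fix q :: "('a \<times> 'b \<Rightarrow> complex) \<Rightarrow> real" assume "q \<in> seminorms DL1"
  then obtain bs :: "('a \<times> 'b) list" where bs: "bs \<in> lists Basis" "q = (\<lambda>f. l1_norm (partial_derivative bs f))"
    by (auto simp: DL1_seminorms)
  define r :: "('a \<Rightarrow> complex, 'b \<Rightarrow> complex) tensor \<Rightarrow> real" where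
    "r = projective_seminorm DL1 DL1 (\<lambda>f. l1_norm (partial_derivative (fst_directions bs) f))
      (\<lambda>g. l1_norm (partial_derivative (snd_directions bs) g))"
  have "(\<lambda>f. l1_norm (partial_derivative (fst_directions bs) f)) \<in> continuous_seminorms DL1"
    "(\<lambda>g. l1_norm (partial_derivative (snd_directions bs) g)) \<in> continuous_seminorms DL1"
    by (rule DL1_generator_continuous[OF directions_in_Basis(1)[OF bs(1)]],
        rule DL1_generator_continuous[OF directions_in_Basis(2)[OF bs(1)]])
  then have "\<exists>p q. r = projective_seminorm DL1 DL1 p q \<and>
      p \<in> continuous_seminorms DL1 \<and> q \<in> continuous_seminorms DL1"
    unfolding r_def by (intro exI conjI) (rule refl, assumption+)
  then have "r \<in> seminorms (projective_tensor DL1 DL1)"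
    by (simp add: projective_tensor_def)
  moreover have "q (tensor_kernel u) \<le> 1 * (\<Sum>p\<in>{r}. p u)" if "u \<in> carrier (projective_tensor DL1 DL1)" for u
    using kernel_bounded[OF that bs(1)] by (simp add: bs(2) r_def)
  ultimately show "\<exists>P C. finite P \<and> P \<subseteq> seminorms (projective_tensor DL1 DL1) \<and> 0 \<le> C \<and>
      (\<forall>u\<in>carrier (projective_tensor DL1 DL1). q (tensor_kernel u) \<le> C * (\<Sum>p\<in>P. p u))"
    by (intro exI[of _ "{r}"] exI[of _ 1]) auto
next
  fix r :: "('a \<Rightarrow> complex, 'b \<Rightarrow> complex) tensor \<Rightarrow> real"
  assume "r \<in> seminorms (projective_tensor DL1 DL1)"
  then obtain p q where pq: "p \<in> continuous_seminorms DL1" "q \<in> continuous_seminorms DL1"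
    "r = projective_seminorm DL1 DL1 p q"
    by (auto simp: projective_tensor_def)
  obtain W C where W: "finite W" "W \<subseteq> lists (Basis :: ('a \<times> 'b) set)" "0 \<le> C"
    "\<And>u. u \<in> carrier (projective_tensor DL1 DL1) \<Longrightarrow> r u \<le> C * (\<Sum>w\<in>W. l1_norm (partial_derivative w (tensor_kernel u)))"
    using kernel_embedding[OF pq(1,2)] unfolding pq(3) by blast
  let ?q = "\<lambda>w (f :: 'a \<times> 'b \<Rightarrow> complex). l1_norm (partial_derivative w f)"
  have "r u \<le> (C * card W) * (\<Sum>q\<in>?q ` W. q (tensor_kernel u))" if u: "u \<in> carrier (projective_tensor DL1 DL1)" for u
  proof -
    have "(\<Sum>w\<in>W. ?q w (tensor_kernel u)) \<le> card W * (\<Sum>q\<in>?q ` W. q (tensor_kernel u))"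
      using W(1) by (intro sum_bounded_above member_le_sum[where f = "\<lambda>q. q (tensor_kernel u)"])
        (auto simp: l1_norm_nonneg)
    then show ?thesis
      using W(4)[OF u] mult_left_mono[OF _ W(3)] by (smt (verit) mult.assoc)
  qed
  then show "\<exists>Q C. finite Q \<and> Q \<subseteq> seminorms (DL1 :: ('a \<times> 'b \<Rightarrow> complex) lcs) \<and> 0 \<le> C \<and>
      (\<forall>u\<in>carrier (projective_tensor DL1 DL1). r u \<le> C * (\<Sum>q\<in>Q. q (tensor_kernel u)))"
    using W(1-3) by (intro exI[of _ "?q ` W"] exI[of _ "C * card W"]) (auto simp: DL1_seminorms)
qed (rule kernel_dense DL1_complete DL1_hausdorff, assumption+)+

theorem proposition6:
  fixes Dx :: "(real ^ 'n \<Rightarrow> complex) lcs"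
    and Dy :: "(real ^ 'm \<Rightarrow> complex) lcs"
    and Dxy :: "((real ^ 'n) \<times> (real ^ 'm) \<Rightarrow> complex) lcs"
  defines "Dx \<equiv> DL1" and "Dy \<equiv> DL1" and "Dxy \<equiv> DL1"
  shows "\<exists>\<Phi>. lcs_isomorphism (completed_projective_tensor Dx Dy) Dxy \<Phi> \<and>
    (\<forall>f\<in>carrier Dx. \<forall>g\<in>carrier Dy. \<Phi> (completed_tensor Dx Dy f g) = (\<lambda>(x, y). f x * g y))"
proof -
  obtain \<Phi> where iso: "lcs_isomorphism (completion (projective_tensor Dx Dy)) Dxy \<Phi>"
    and \<Phi>: "\<forall>u\<in>carrier (projective_tensor Dx Dy). \<Phi> (to_completion (projective_tensor Dx Dy) u) = tensor_kernel u"
    using dense_embedding.completion_isomorphism[OF tensor_kernel_dense_embedding]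
    unfolding Dx_def Dy_def Dxy_def by blast
  have "\<Phi> (completed_tensor Dx Dy f g) = (\<lambda>(x, y). f x * g y)" if "f \<in> carrier Dx" "g \<in> carrier Dy" for f g
    using \<Phi> DL1_tensor.tensor_in_carrier[of f g] that kernel_tensor[of f g]
    unfolding Dx_def Dy_def completed_tensor_def by simp
  with iso show ?thesis
    unfolding completed_projective_tensor_def by blast
qed


end
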